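(* Let $F_\infty \sim N_1\times N_2$, where $N_1,N_2\sim\mathscr N(0,1)$ are independent standard normal random variables. Let $\{F_n\}_{n\ge1}$ be a sequence of elements of the second Wiener chaos such that $\mathbb E(F_n^2)=1$ for all $n\ge1$. Then, as $n\to\infty$, the following assertions are equivalent: (I) $d_{W_2}(F_n,F_\infty)\to0$; (II) $F_n\to F_\infty$ in distribution; (III) (1) $\mu_4(F_n)\to 9$, and (2) $\mu_{2r}(F_n)\to\big((2r-1)!!\big)^2$ for some integer $r\ge3$.
   Context: Let $W=\{W(h):h\in\mathfrak H\}$ be an isonormal Gaussian process over a real separable Hilbert space $\mathfrak H$. The second Wiener chaos is $\mathscr H_2=\{I_2(f): f\in\mathfrak H^{\odot2}\}$ ($I_2$ the double Wiener integral). Equivalently, every $F\in\mathscr H_2$ can be written $F=\sum_{z\in\mathbb Z}\lambda_z\,(N_z^2-1)/\sqrt2$ with $(N_z)_{z\in\mathbb Z}$ i.i.d. standard Gaussian random variables and real coefficients with $\sum_z\lambda_z^2=\mathbb E(F^2)<\infty$, the series converging in $L^2$ and almost surely. Notation: $\mu_k(F)=\mathbb E(F^k)$ is the $k$-th moment. The Wasserstein-2 distance between (the laws of) two real random variables is $d_{W_2}(X,Y)=\inf \mathbb E\big((X'-Y')^2\big)^{1/2}$, the infimum over all pairs $(X',Y')$ on a common probability space with $X'\sim X$, $Y'\sim Y$. *)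

theory Defs
  imports "HOL-Probability.Probability"
begin

text \<open>The degenerate Gaussian law (Dirac mass at 0) is included, as in \<open>W 0 = 0\<close> almost surely.\<close>

definition centered_gaussian :: "'a measure \<Rightarrow> ('a \<Rightarrow> real) \<Rightarrow> bool" where
  "centered_gaussian M X \<longleftrightarrow>
     X \<in> borel_measurable M \<and>
     ((AE \<omega> in M. X \<omega> = 0) \<or> (\<exists>\<sigma>>0. distributed M lborel X (normal_density 0 \<sigma>)))"

text \<open>A real separable Hilbert space is a type of sort \<open>{real_inner, polish_space}\<close>:
  a complete inner product space with a countable base.\<close>

definition isonormal_gaussian_process ::
    "'a measure \<Rightarrow> ('h::{real_inner,polish_space} \<Rightarrow> 'a \<Rightarrow> real) \<Rightarrow> bool" where
  "isonormal_gaussian_process M W \<longleftrightarrow>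
     (\<forall>S c. finite S \<longrightarrow> centered_gaussian M (\<lambda>\<omega>. \<Sum>h\<in>S. c h * W h \<omega>)) \<and>
     (\<forall>g h. (LINT \<omega>|M. W g \<omega> * W h \<omega>) = g \<bullet> h)"

text \<open>The Hilbert space tensor product of \<open>H\<close> with itself is realised as the space of
  Hilbert--Schmidt bilinear forms on \<open>H\<close>, the elementary tensor of \<open>g\<close> and \<open>h\<close> being the form
  \<open>\<lambda>x y. (g \<bullet> x) * (h \<bullet> y)\<close>. In the Hilbert--Schmidt norm, the supremum over finite orthonormal
  sets is the sum over an orthonormal basis.\<close>

definition orthonormal :: "'h::real_inner set \<Rightarrow> bool" where
  "orthonormal S \<longleftrightarrow> pairwise orthogonal S \<and> (\<forall>e\<in>S. norm e = 1)"

definition hs_norm_sq :: "('h::real_inner \<Rightarrow> 'h \<Rightarrow> real) \<Rightarrow> ennreal" where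
  "hs_norm_sq f =
     (SUP S\<in>{S. finite S \<and> orthonormal S}. ennreal (\<Sum>e\<in>S. \<Sum>e'\<in>S. (f e e')\<^sup>2))"

definition sym_tensors2 :: "('h::real_inner \<Rightarrow> 'h \<Rightarrow> real) set" where
  "sym_tensors2 = {f. bounded_bilinear f \<and> (\<forall>x y. f x y = f y x) \<and> hs_norm_sq f < \<infinity>}"

text \<open>A list of pairs \<open>(c, h)\<close> encodes the finite linear combination of the tensor squares
  of the vectors \<open>h\<close> with coefficients \<open>c\<close>; by polarisation these are all finite-rank symmetric
  tensors.\<close>

definition simple_tensor :: "(real \<times> 'h::real_inner) list \<Rightarrow> 'h \<Rightarrow> 'h \<Rightarrow> real" where
  "simple_tensor cs = (\<lambda>x y. \<Sum>(c, h)\<leftarrow>cs. c * ((h \<bullet> x) * (h \<bullet> y)))"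

definition simple_wiener_I2 ::
    "('h::real_inner \<Rightarrow> 'a \<Rightarrow> real) \<Rightarrow> (real \<times> 'h) list \<Rightarrow> 'a \<Rightarrow> real" where
  "simple_wiener_I2 W cs = (\<lambda>\<omega>. \<Sum>(c, h)\<leftarrow>cs. c * ((W h \<omega>)\<^sup>2 - (norm h)\<^sup>2))"

text \<open>\<open>is_wiener_I2 M W f X\<close>: the square integrable random variable \<open>X\<close> is a version of the double
  Wiener integral of \<open>f\<close>. The integral is the continuous extension of \<open>simple_wiener_I2\<close>, which
  satisfies \<open>E[I\<^sub>2(f)\<^sup>2] = 2 \<parallel>f\<parallel>\<^sup>2\<close>; thus \<open>X\<close> is determined up to almost sure equality.\<close>

definition is_wiener_I2 ::
    "'a measure \<Rightarrow> ('h::{real_inner,polish_space} \<Rightarrow> 'a \<Rightarrow> real) \<Rightarrow>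
     ('h \<Rightarrow> 'h \<Rightarrow> real) \<Rightarrow> ('a \<Rightarrow> real) \<Rightarrow> bool" where
  "is_wiener_I2 M W f X \<longleftrightarrow>
     X \<in> borel_measurable M \<and> integrable M (\<lambda>\<omega>. (X \<omega>)\<^sup>2) \<and>
     (\<exists>cs :: nat \<Rightarrow> (real \<times> 'h) list.
        (\<lambda>k. hs_norm_sq (\<lambda>x y. f x y - simple_tensor (cs k) x y)) \<longlonglongrightarrow> 0 \<and>
        (\<lambda>k. LINT \<omega>|M. (X \<omega> - simple_wiener_I2 W (cs k) \<omega>)\<^sup>2) \<longlonglongrightarrow> 0)"

definition second_wiener_chaos ::
    "'a measure \<Rightarrow> ('h::{real_inner,polish_space} \<Rightarrow> 'a \<Rightarrow> real) \<Rightarrow> ('a \<Rightarrow> real) set" where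
  "second_wiener_chaos M W = {X. \<exists>f\<in>sym_tensors2. is_wiener_I2 M W f X}"

definition moment :: "'a measure \<Rightarrow> nat \<Rightarrow> ('a \<Rightarrow> real) \<Rightarrow> real" where
  "moment M k X = (LINT \<omega>|M. X \<omega> ^ k)"

fun double_fact :: "nat \<Rightarrow> nat" where
  "double_fact 0 = 1"
| "double_fact (Suc 0) = 1"
| "double_fact (Suc (Suc n)) = Suc (Suc n) * double_fact n"

text \<open>A coupling is the joint law of a pair \<open>(X', Y')\<close> on a common probability space.\<close>

definition couplings :: "real measure \<Rightarrow> real measure \<Rightarrow> (real \<times> real) measure set" where
  "couplings \<mu> \<nu> =
     {\<gamma>. prob_space \<gamma> \<and> sets \<gamma> = sets (borel \<Otimes>\<^sub>M borel) \<and>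
         distr \<gamma> borel fst = \<mu> \<and> distr \<gamma> borel snd = \<nu>}"

definition ennreal_sqrt :: "ennreal \<Rightarrow> ennreal" where
  "ennreal_sqrt x = (if x = \<infinity> then \<infinity> else ennreal (sqrt (enn2real x)))"

definition wasserstein2 :: "real measure \<Rightarrow> real measure \<Rightarrow> ennreal" where
  "wasserstein2 \<mu> \<nu> =
     (INF \<gamma>\<in>couplings \<mu> \<nu>. ennreal_sqrt (\<integral>\<^sup>+ (x, y). ennreal ((x - y)\<^sup>2) \<partial>\<gamma>))"

end

theory Submission
  imports Defs
begin

text \<open>A simple double integral diagonalises as \<open>1/2 \<Sum>\<^sub>e y\<^sub>e (W(e)\<^sup>2 - 1)\<close> with orthonormal \<open>e\<close>, hence with
  independent standard normal \<open>W(e)\<close>. Its moments are polynomials with nonnegative coefficients in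
  the normalised cumulants \<open>m\<^sub>j = 1/2 \<Sum>\<^sub>e y\<^sub>e\<^bsup>j+2\<^esup>\<close>; for \<open>N\<^sub>1 N\<^sub>2\<close> these are \<open>1\<close> for even and \<open>0\<close> for odd
  \<open>j\<close>. The second and fourth moments determine \<open>m\<^sub>0\<close> and \<open>m\<^sub>2\<close>. If both tend to \<open>1\<close>, then
  asymptotically \<open>m\<^sub>j \<ge> 1\<close> for even \<open>j\<close>, and all odd \<open>m\<^sub>j\<close> have the sign of the eigenvalue of
  largest modulus, because that eigenvalue carries asymptotically at least half of every power sum
  \<open>\<Sum>\<^sub>e \<bar>y\<^sub>e\<bar>\<^bsup>j+2\<^esup>\<close>. Up to the
  sign of \<open>F\<close>, the moment of order \<open>2r\<close> is therefore bounded below by the one of \<open>N\<^sub>1 N\<^sub>2\<close>, with an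
  excess of at least \<open>m\<^sub>4 - 1\<close> and at least \<open>m\<^sub>1\<^sup>2\<close>. If the excess vanishes in the limit, one
  eigenvalue tends to \<open>1\<close>, one to \<open>-1\<close>, and the others are negligible in \<open>\<ell>\<^sup>2\<close>, so that \<open>F\<close> is
  \<open>L\<^sup>2\<close>-close to \<open>(W(a)\<^sup>2 - W(b)\<^sup>2)/2\<close>, which has the law of \<open>N\<^sub>1 N\<^sub>2\<close>. In the other direction, \<open>W\<^sub>2\<close>
  convergence implies convergence in law, and hypercontractivity upgrades convergence in law to
  convergence of moments.\<close>

section \<open>Moments in terms of cumulants\<close>

text \<open>Elements of the chaos are never diagonalised themselves: they are replaced by
  finite-rank integrals at small L2 distance, and hypercontractivity carries all moments across.
  Hence a spectral theorem is needed only for symmetric forms on spans of finite sets. The factor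
  1/2 in front of the eigenvalues makes the cumulant of order \<open>k\<close> of the diagonal form
  equal to \<open>(k - 1)!\<close> times half the \<open>k\<close>-th power sum, and places the two
  eigenvalues of the limit law at 1 and -1. The obstacle is that the cumulants dominate those of the
  limit only up to vanishing errors, while monotonicity of the moment polynomials asks for exact
  inequalities between nonnegative sequences. The cumulants are therefore clipped from below at
  those of the limit, and continuity of the polynomials shows that clipping does not change the
  limit of the moments. The bound \<open>r \<ge> 3\<close> enters because \<open>m 4\<close> and the
  square of \<open>m 1\<close> occur in even moments only from order six on; order four sees nothing
  but \<open>m 0\<close> and \<open>m 2\<close>.\<close>

text \<open>The moments of a centred random variable whose cumulant of order \<open>k + 2\<close> is \<open>(k + 1)! m\<^sub>k\<close>.\<close>

fun cmoment :: "(nat \<Rightarrow> real) \<Rightarrow> nat \<Rightarrow> real" where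
  "cmoment m 0 = 1"
| "cmoment m (Suc n) = (\<Sum>k<n. fact n / fact (n - Suc k) * m k * cmoment m (n - Suc k))"

text \<open>The factor \<open>fact n / fact (n - Suc k)\<close> is the coefficient
  \<open>n choose (k + 1)\<close> of the classical moment-cumulant recursion times the
  \<open>(k + 1)!\<close> from the normalisation of the cumulants. It is positive, so all moments
  are polynomials in \<open>m\<close> with nonnegative coefficients.\<close>

lemma cmoment_mono:
  assumes "\<And>j. 0 \<le> m j" "\<And>j. m j \<le> m' j"
  shows "0 \<le> cmoment m n \<and> cmoment m n \<le> cmoment m' n"
proof (induction n rule: less_induct)
  case (less n)
  show ?case
  proof (cases n)
    case (Suc l)
    have "0 \<le> fact l / fact (l - Suc k) * m k * cmoment m (l - Suc k) \<and>
      fact l / fact (l - Suc k) * m k * cmoment m (l - Suc k)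
      \<le> fact l / fact (l - Suc k) * m' k * cmoment m' (l - Suc k)" for k
      using less[of "l - Suc k"] Suc assms[of k]
      by (auto intro!: mult_mono mult_nonneg_nonneg divide_right_mono order_trans[OF assms])
    then show ?thesis
      unfolding Suc by (auto intro!: sum_nonneg sum_mono)
  qed simp
qed

lemma cmoment_nonneg: "(\<And>j. 0 \<le> m j) \<Longrightarrow> 0 \<le> cmoment m n"
  using cmoment_mono[of m m] by simp

lemma abs_cmoment_le:
  assumes "\<And>j. \<bar>m j\<bar> \<le> b j"
  shows "\<bar>cmoment m n\<bar> \<le> cmoment b n"
proof (induction n rule: less_induct)
  case (less n)
  show ?case
  proof (cases n)
    case (Suc l)
    have "\<bar>fact l / fact (l - Suc k) * m k * cmoment m (l - Suc k)\<bar>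
      \<le> fact l / fact (l - Suc k) * b k * cmoment b (l - Suc k)" for k
    proof -
      have "\<bar>m k\<bar> * \<bar>cmoment m (l - Suc k)\<bar> \<le> b k * cmoment b (l - Suc k)"
        using less[of "l - Suc k"] Suc assms[of k] by (intro mult_mono) auto
      then show ?thesis
        by (simp add: abs_mult mult.assoc divide_right_mono)
    qed
    then show ?thesis
      unfolding Suc by (auto intro!: order_trans[OF sum_abs] sum_mono)
  qed simp
qed

text \<open>The polynomials are weighted homogeneous, \<open>m j\<close> having weight
  \<open>j + 2\<close>: this is multiplication of the random variable by \<open>c\<close>. It serves
  for sign changes and for normalising the variance.\<close>

lemma cmoment_scale: "cmoment (\<lambda>j. c ^ (j + 2) * m j) n = c ^ n * cmoment m n"
proof (induction n rule: less_induct)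
  case (less n)
  show ?case
  proof (cases n)
    case (Suc l)
    have "fact l / fact (l - Suc k) * (c ^ (k + 2) * m k) * cmoment (\<lambda>j. c ^ (j + 2) * m j) (l - Suc k)
       = c ^ Suc l * (fact l / fact (l - Suc k) * m k * cmoment m (l - Suc k))" if "k < l" for k
    proof -
      have "c ^ Suc l = c ^ (k + 2) * c ^ (l - Suc k)"
        using that by (simp flip: power_add del: power_Suc)
      then show ?thesis
        using less[of "l - Suc k"] Suc by (simp del: power_Suc)
    qed
    then show ?thesis unfolding Suc by (auto simp: sum_distrib_left intro!: sum.cong)
  qed simp
qed

definition cmoment_egf :: "(nat \<Rightarrow> real) \<Rightarrow> real fps" where
  "cmoment_egf m = Abs_fps (\<lambda>n. cmoment m n / fact n)"

text \<open>The logarithmic derivative of the moment generating function is the derivative of the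
  cumulant generating function. With mean zero and cumulants \<open>(k + 1)! * m k\<close> of order
  \<open>k + 2\<close>, the latter is \<open>fps_X * Abs_fps m\<close>.\<close>

lemma fps_deriv_cmoment_egf:
  "fps_deriv (cmoment_egf m) = fps_X * Abs_fps m * cmoment_egf m"
proof (rule fps_ext)
  fix n
  show "fps_nth (fps_deriv (cmoment_egf m)) n = fps_nth (fps_X * Abs_fps m * cmoment_egf m) n"
  proof (cases n)
    case (Suc l)
    have "fps_nth (fps_X * Abs_fps m * cmoment_egf m) n = (\<Sum>k\<le>l. m k * (cmoment m (l - k) / fact (l - k)))"
      by (simp only: Suc mult.assoc fps_X_mult_nth) (simp add: cmoment_egf_def fps_mult_nth atLeast0AtMost)
    moreover have "fps_nth (fps_deriv (cmoment_egf m)) n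
        = (\<Sum>k\<le>l. fact n / fact (l - k) * m k * cmoment m (l - k)) / fact n"
    proof -
      have "fps_nth (fps_deriv (cmoment_egf m)) n = cmoment m (Suc n) / fact n"
        by (simp add: cmoment_egf_def field_simps del: cmoment.simps of_nat_Suc)
      then show ?thesis by (simp add: Suc lessThan_Suc_atMost del: fact_Suc)
    qed
    ultimately show ?thesis
      by (simp add: sum_divide_distrib mult.assoc)
  qed (simp add: cmoment_egf_def)
qed

lemma fps_deriv_eq_mult_unique:
  fixes f g L :: "real fps"
  assumes "fps_deriv f = L * f" "fps_deriv g = L * g" "fps_nth f 0 = fps_nth g 0"
  shows "f = g"
proof (rule fps_ext)
  fix n show "fps_nth f n = fps_nth g n"
  proof (induction n rule: less_induct)
    case (less n)
    show ?case
    proof (cases n)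
      case (Suc l)
      have "fps_nth (fps_deriv f) l = fps_nth (fps_deriv g) l"
        unfolding assms fps_mult_nth using less Suc by (intro sum.cong) auto
      then show ?thesis using Suc by simp
    qed (use assms in simp)
  qed
qed

text \<open>Additivity of cumulants under independent sums, in the form of a binomial expansion of
  the moments. The product of two generating functions solves the differential equation whose
  coefficient is the sum of the two.\<close>

lemma cmoment_add:
  "cmoment (\<lambda>j. m j + m' j) n = (\<Sum>k\<le>n. of_nat (n choose k) * cmoment m k * cmoment m' (n - k))"
proof -
  have "cmoment_egf (\<lambda>j. m j + m' j) = cmoment_egf m * cmoment_egf m'"
  proof (rule fps_deriv_eq_mult_unique)
    show "fps_deriv (cmoment_egf (\<lambda>j. m j + m' j))
      = fps_X * Abs_fps (\<lambda>j. m j + m' j) * cmoment_egf (\<lambda>j. m j + m' j)"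
      by (rule fps_deriv_cmoment_egf)
    have "Abs_fps (\<lambda>j. m j + m' j) = Abs_fps m + Abs_fps m'"
      by (simp add: fps_eq_iff)
    then show "fps_deriv (cmoment_egf m * cmoment_egf m')
      = fps_X * Abs_fps (\<lambda>j. m j + m' j) * (cmoment_egf m * cmoment_egf m')"
      by (simp add: fps_deriv_cmoment_egf algebra_simps)
  qed (simp add: cmoment_egf_def)
  then have "cmoment (\<lambda>j. m j + m' j) n / fact n = fps_nth (cmoment_egf m * cmoment_egf m') n"
    by (metis cmoment_egf_def fps_nth_Abs_fps)
  also have "\<dots> = (\<Sum>k\<le>n. cmoment m k / fact k * (cmoment m' (n - k) / fact (n - k)))"
    by (simp add: fps_mult_nth cmoment_egf_def atLeast0AtMost)
  finally have "cmoment (\<lambda>j. m j + m' j) n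
      = fact n * (\<Sum>k\<le>n. cmoment m k / fact k * (cmoment m' (n - k) / fact (n - k)))"
    by (simp add: field_simps)
  also have "\<dots> = (\<Sum>k\<le>n. of_nat (n choose k) * cmoment m k * cmoment m' (n - k))"
    by (auto simp: sum_distrib_left binomial_fact intro!: sum.cong)
  finally show ?thesis .
qed

text \<open>For geometric cumulants the terms with \<open>k > 0\<close> of the recursion are
  \<open>(n + 1) * y\<close> times the recursion one order lower, so the whole history collapses to
  two terms.\<close>

lemma cmoment_geometric_rec:
  "cmoment (\<lambda>j. y ^ (j + 2) / 2) (Suc (Suc n))
   = real (Suc n) * y * cmoment (\<lambda>j. y ^ (j + 2) / 2) (Suc n)
     + real (Suc n) * (y\<^sup>2 / 2) * cmoment (\<lambda>j. y ^ (j + 2) / 2) n"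
  by (subst cmoment.simps(2), subst sum.lessThan_Suc_shift)
    (simp add: sum_distrib_left field_simps power2_eq_square power3_eq_cube)

text \<open>Continuity of the moment polynomials along sequences that may fail to converge: only the
  difference tends to zero, and the common bound \<open>b\<close> controls the other factor of each
  product.\<close>

lemma cmoment_perturb:
  assumes b: "\<And>n j. \<bar>m n j\<bar> \<le> b j" and b': "\<And>n j. \<bar>m' n j\<bar> \<le> b j"
    and lim: "\<And>j. (\<lambda>n. m n j - m' n j) \<longlonglongrightarrow> 0"
  shows "(\<lambda>n. cmoment (m n) k - cmoment (m' n) k) \<longlonglongrightarrow> 0"
proof (induction k rule: less_induct)
  case (less k)
  show ?case
  proof (cases k)
    case (Suc l)
    have "(\<lambda>n. \<Sum>i<l. fact l / fact (l - Suc i) *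
        ((m n i - m' n i) * cmoment (m n) (l - Suc i)
          + m' n i * (cmoment (m n) (l - Suc i) - cmoment (m' n) (l - Suc i))))
        \<longlonglongrightarrow> (\<Sum>i<l. fact l / fact (l - Suc i) * (0 + 0))"
    proof (intro tendsto_sum tendsto_mult[OF tendsto_const] tendsto_add)
      fix i
      have "Bfun (\<lambda>n. cmoment (m n) (l - Suc i)) sequentially"
        by (rule BfunI[where K = "cmoment b (l - Suc i)"]) (auto intro!: always_eventually abs_cmoment_le b)
      then show "(\<lambda>n. (m n i - m' n i) * cmoment (m n) (l - Suc i)) \<longlonglongrightarrow> 0"
        using lim[of i] unfolding tendsto_Zfun_iff
        by (auto intro: bounded_bilinear.Zfun_prod_Bfun[OF bounded_bilinear_mult])
      have "Bfun (\<lambda>n. m' n i) sequentially"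
        by (rule BfunI[where K = "b i"]) (auto intro!: always_eventually b')
      then show "(\<lambda>n. m' n i * (cmoment (m n) (l - Suc i) - cmoment (m' n) (l - Suc i))) \<longlonglongrightarrow> 0"
        using less[of "l - Suc i"] Suc unfolding tendsto_Zfun_iff
        by (auto intro: bounded_bilinear.Bfun_prod_Zfun[OF bounded_bilinear_mult])
    qed
    then show ?thesis
      unfolding Suc cmoment.simps sum_subtractf[symmetric] by (simp add: field_simps)
  qed simp
qed

text \<open>The normalised cumulants of the product of two independent standard normal variables.\<close>

definition alt_cumulants :: "nat \<Rightarrow> real" where
  "alt_cumulants j = of_bool (even j)"

text \<open>\<open>alt_cumulants\<close> has period two, so the terms with \<open>k \<ge> 2\<close>
  reproduce the recursion two orders lower and add up to \<open>(n + 1) * n\<close> times the moment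
  of order \<open>n\<close>; the term \<open>k = 0\<close> adds \<open>n + 1\<close> times that
  moment.\<close>

lemma cmoment_alt_rec:
  "cmoment alt_cumulants (Suc (Suc n)) = (real (Suc n))\<^sup>2 * cmoment alt_cumulants n"
proof (cases n)
  case (Suc l)
  have "cmoment alt_cumulants (Suc (Suc n))
    = real (Suc n) * cmoment alt_cumulants n
      + (\<Sum>k<l. fact (Suc n) / fact (l - Suc k) * alt_cumulants k * cmoment alt_cumulants (l - Suc k))"
    unfolding Suc
    by (subst cmoment.simps(2), subst sum.lessThan_Suc_shift, subst sum.lessThan_Suc_shift)
      (simp add: alt_cumulants_def del: cmoment.simps)
  also have "(\<Sum>k<l. fact (Suc n) / fact (l - Suc k) * alt_cumulants k * cmoment alt_cumulants (l - Suc k))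
    = real (Suc n) * real n * cmoment alt_cumulants n"
    by (simp add: Suc sum_distrib_left mult.assoc)
  finally show ?thesis by (simp add: algebra_simps power2_eq_square)
qed (simp add: alt_cumulants_def)

lemma cmoment_alt_even: "cmoment alt_cumulants (2 * r) = (real (double_fact (2 * r - 1)))\<^sup>2"
proof (induction r)
  case (Suc r)
  have "double_fact (2 * Suc r - 1) = Suc (2 * r) * double_fact (2 * r - 1)"
    by (cases r) simp_all
  with Suc show ?case
    using cmoment_alt_rec[of "2 * r"] by (simp add: power_mult_distrib[symmetric] algebra_simps del: cmoment.simps)
qed simp

lemma cmoment_alt_even_ge_1: "1 \<le> cmoment alt_cumulants (2 * r)"
proof (induction r)
  case (Suc r)
  have "1 * 1 \<le> (real (Suc (2 * r)))\<^sup>2 * cmoment alt_cumulants (2 * r)"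
    using Suc by (intro mult_mono) (auto simp: power2_eq_square algebra_simps)
  then show ?case using cmoment_alt_rec[of "2 * r"] by (simp del: cmoment.simps)
qed simp

text \<open>Each inequality keeps the excess of one term of the recursion and drops the nonnegative
  excess of the others. The term \<open>k = 4\<close> yields \<open>m 4 - 1\<close>. The term
  \<open>k = 1\<close>, absent for the limit law, contains a moment of odd order, which is itself at
  least \<open>m 1\<close>; hence the square.\<close>

lemma cmoment_even_lower_bound:
  assumes m: "\<And>j. alt_cumulants j \<le> m j" and "r \<ge> 3"
  shows "cmoment alt_cumulants (2 * r) + (m 4 - 1) \<le> cmoment m (2 * r)"
    and "cmoment alt_cumulants (2 * r) + (m 1)\<^sup>2 \<le> cmoment m (2 * r)"
proof -
  have a0: "0 \<le> alt_cumulants j" for j by (simp add: alt_cumulants_def)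
  have m0: "0 \<le> m j" for j using a0[of j] m[of j] by linarith
  have mono: "0 \<le> cmoment alt_cumulants n \<and> cmoment alt_cumulants n \<le> cmoment m n" for n
    by (rule cmoment_mono[OF a0 m])
  have nonneg: "0 \<le> cmoment m n" for n by (rule cmoment_nonneg[OF m0])
  have term_le: "fact n / fact (n - Suc k) * alt_cumulants k * cmoment alt_cumulants (n - Suc k)
       \<le> fact n / fact (n - Suc k) * m k * cmoment m (n - Suc k)" for n k
    using mono[of "n - Suc k"] m[of k] m0[of k] a0[of k] by (intro mult_mono) auto
  have step: "cmoment alt_cumulants (Suc n)
       + (fact n / fact (n - Suc k) * m k * cmoment m (n - Suc k)
          - fact n / fact (n - Suc k) * alt_cumulants k * cmoment alt_cumulants (n - Suc k))
       \<le> cmoment m (Suc n)" if "k < n" for n k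
  proof -
    have "(\<Sum>i\<in>{..<n} - {k}. fact n / fact (n - Suc i) * alt_cumulants i * cmoment alt_cumulants (n - Suc i))
      \<le> (\<Sum>i\<in>{..<n} - {k}. fact n / fact (n - Suc i) * m i * cmoment m (n - Suc i))"
      by (intro sum_mono term_le)
    then show ?thesis using that
      by (simp add: sum.remove[of "{..<n}" k] field_simps)
  qed
  have fact_ge: "1 \<le> (fact n / fact k :: real)" if "k \<le> n" for n k
    using that by (simp add: fact_mono)
  \<comment> \<open>Starting from order \<open>2 * s + 6\<close>, both the term \<open>k = 4\<close>
    and two successive terms \<open>k = 1\<close> end at the moment of order \<open>2 * s\<close>,
    which dominates an even moment of the limit law and is therefore at least 1.\<close>
  obtain s where s: "2 * r = Suc (2 * s + 5)" 
    using \<open>r \<ge> 3\<close> by (intro that[of "r - 3"]) simp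
  have "1 * (m 4 - 1) * 1 \<le> fact (2 * s+5) / fact (2 * s) * (m 4 - 1) * cmoment m (2 * s)"
    using fact_ge[of "2 * s" "2 * s+5"] m[of 4] mono[of "2 * s"] cmoment_alt_even_ge_1[of s]
    by (intro mult_mono) (auto simp: alt_cumulants_def)
  also have "\<dots> \<le> fact (2 * s+5) / fact (2 * s) * m 4 * cmoment m (2 * s)
          - fact (2 * s+5) / fact (2 * s) * alt_cumulants 4 * cmoment alt_cumulants (2 * s)"
    using mono[of "2 * s"] by (simp add: alt_cumulants_def field_simps)
  finally show "cmoment alt_cumulants (2 * r) + (m 4 - 1) \<le> cmoment m (2 * r)"
    using step[of 4 "2 * s+5"] unfolding s by (simp del: cmoment.simps)
  have m1: "m 1 \<le> cmoment m (2 * s + 3)"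
  proof -
    have "1 * m 1 * 1 \<le> fact (2 * s+2) / fact (2 * s) * m 1 * cmoment m (2 * s)"
      using fact_ge[of "2 * s" "2 * s+2"] m0[of 1] mono[of "2 * s"] cmoment_alt_even_ge_1[of s]
      by (intro mult_mono) auto
    also have "\<dots> \<le> cmoment m (Suc (2 * s+2))"
      using step[of 1 "2 * s+2"] mono[of "Suc (2 * s+2)"] by (simp add: alt_cumulants_def del: cmoment.simps)
    finally show ?thesis by (simp add: numeral_3_eq_3 del: cmoment.simps)
  qed
  have "1 * m 1 * m 1 \<le> fact (2 * s+5) / fact (2 * s+3) * m 1 * cmoment m (2 * s+3)"
    using fact_ge[of "2 * s+3" "2 * s+5"] m0[of 1] m1 by (intro mult_mono) auto
  also have "\<dots> = fact (2 * s+5) / fact (2 * s+3) * m 1 * cmoment m (2 * s+3)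
          - fact (2 * s+5) / fact (2 * s+3) * alt_cumulants 1 * cmoment alt_cumulants (2 * s+3)"
    by (simp add: alt_cumulants_def)
  finally show "cmoment alt_cumulants (2 * r) + (m 1)\<^sup>2 \<le> cmoment m (2 * r)"
    using step[of 1 "2 * s+5"] unfolding s power2_eq_square by (simp add: numeral_3_eq_3 del: cmoment.simps)
qed

section \<open>Power sums of the eigenvalues\<close>

definition power_sum :: "'i set \<Rightarrow> ('i \<Rightarrow> real) \<Rightarrow> nat \<Rightarrow> real" where
  "power_sum I y k = (\<Sum>i\<in>I. y i ^ k)"

lemma power_sum_even_nonneg: "even k \<Longrightarrow> 0 \<le> power_sum I y k"
  by (auto simp: power_sum_def intro!: sum_nonneg zero_le_even_power)

lemma power_sum_remove:
  "finite I \<Longrightarrow> i \<in> I \<Longrightarrow> power_sum I y k = y i ^ k + power_sum (I - {i}) y k"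
  unfolding power_sum_def by (rule sum.remove)

lemma sq_le_power_sum_2: "finite I \<Longrightarrow> i \<in> I \<Longrightarrow> (y i)\<^sup>2 \<le> power_sum I y 2"
  by (simp add: power_sum_remove power_sum_even_nonneg)

lemma abs_le_sqrt_power_sum_2: "finite I \<Longrightarrow> i \<in> I \<Longrightarrow> \<bar>y i\<bar> \<le> sqrt (power_sum I y 2)"
  by (metis real_sqrt_abs real_sqrt_le_iff sq_le_power_sum_2)

lemma sum_abs_power_le:
  fixes y :: "'i \<Rightarrow> real"
  assumes "\<And>i. i \<in> I \<Longrightarrow> \<bar>y i\<bar> \<le> c"
  shows "(\<Sum>i\<in>I. \<bar>y i\<bar> ^ (k + l)) \<le> c ^ l * (\<Sum>i\<in>I. \<bar>y i\<bar> ^ k)"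
  unfolding sum_distrib_left
proof (intro sum_mono)
  fix i assume "i \<in> I"
  then have "\<bar>y i\<bar> ^ l \<le> c ^ l" by (intro power_mono assms) auto
  then show "\<bar>y i\<bar> ^ (k + l) \<le> c ^ l * \<bar>y i\<bar> ^ k"
    by (simp add: power_add) (metis mult.commute mult_left_mono zero_le_power abs_ge_zero)
qed

lemma abs_power_sum_le:
  assumes "finite I"
  shows "\<bar>power_sum I y (2 + l)\<bar> \<le> sqrt (power_sum I y 2) ^ l * power_sum I y 2"
proof -
  have "\<bar>power_sum I y (2 + l)\<bar> \<le> (\<Sum>i\<in>I. \<bar>y i\<bar> ^ (2 + l))"
    unfolding power_sum_def by (rule order_trans[OF sum_abs]) (simp add: power_abs abs_mult)
  also have "\<dots> \<le> sqrt (power_sum I y 2) ^ l * (\<Sum>i\<in>I. \<bar>y i\<bar> ^ 2)"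
    by (rule sum_abs_power_le) (rule abs_le_sqrt_power_sum_2[OF assms])
  finally show ?thesis by (simp add: power_sum_def)
qed

text \<open>The bound compares the fourth power sum with the largest square times the second. The
  quantifier stands outside the implication so that an index can be chosen for every member of a
  sequence, even where the second power sum is zero.\<close>

lemma exists_max_abs:
  fixes y :: "'i \<Rightarrow> real"
  assumes "finite I"
  shows "\<exists>i. 0 < power_sum I y 2 \<longrightarrow> i \<in> I \<and> (\<forall>k\<in>I. \<bar>y k\<bar> \<le> \<bar>y i\<bar>) \<and>
    power_sum I y 4 / power_sum I y 2 \<le> (y i)\<^sup>2"
proof (cases "0 < power_sum I y 2")
  case True
  have ne: "(\<lambda>i. \<bar>y i\<bar>) ` I \<noteq> {}" "finite ((\<lambda>i. \<bar>y i\<bar>) ` I)"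
    using assms True by (auto simp: power_sum_def)
  obtain i where i: "i \<in> I" "\<bar>y i\<bar> = Max ((\<lambda>i. \<bar>y i\<bar>) ` I)"
    using Max_in[OF ne(2,1)] by auto
  then have max: "\<bar>y k\<bar> \<le> \<bar>y i\<bar>" if "k \<in> I" for k
    using ne that by auto
  have "(\<Sum>k\<in>I. \<bar>y k\<bar> ^ (2 + 2)) \<le> \<bar>y i\<bar> ^ 2 * (\<Sum>k\<in>I. \<bar>y k\<bar> ^ 2)"
    by (rule sum_abs_power_le) (rule max)
  then have "power_sum I y 4 \<le> (y i)\<^sup>2 * power_sum I y 2"
    by (simp add: power_sum_def)
  with True i(1) max show ?thesis
    by (intro exI[of _ i]) (auto simp: divide_le_eq)
qed auto

text \<open>The eigenvalue of largest modulus satisfies \<open>y\<^sup>2 \<ge> p\<^sub>4 / p\<^sub>2\<close>, so if \<open>p\<^sub>2\<close> and \<open>p\<^sub>4\<close> are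
  both close to \<open>2\<close> it carries at least half of each odd absolute power sum, up to a small error,
  and hence fixes their common sign.\<close>

lemma odd_power_sums_sign:
  fixes y :: "'i \<Rightarrow> real"
  assumes "finite I"
  defines "w \<equiv> power_sum I y 4 / power_sum I y 2"
  shows "\<exists>s. (s = 1 \<or> s = - 1) \<and> (0 < power_sum I y 2 \<longrightarrow> (\<forall>l. even l \<longrightarrow>
    - (sqrt (power_sum I y 2) ^ l *
        \<bar>sqrt w ^ 3 + (w + w\<^sup>2) / 2 - (power_sum I y 2 + power_sum I y 4) / 2\<bar>)
      \<le> s * power_sum I y (3 + l)))"
proof (cases "0 < power_sum I y 2")
  case True
  \<comment> \<open>This vanishes when both power sums equal 2, since then \<open>w = 1\<close>. It
    bounds from below the cube of the leading modulus minus the sum of the cubes of the other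
    moduli.\<close>
  define g where "g = sqrt w ^ 3 + (w + w\<^sup>2) / 2 - (power_sum I y 2 + power_sum I y 4) / 2"
  obtain i where i: "i \<in> I" and max: "\<And>k. k \<in> I \<Longrightarrow> \<bar>y k\<bar> \<le> \<bar>y i\<bar>" and wi: "w \<le> (y i)\<^sup>2"
    using exists_max_abs[OF \<open>finite I\<close>, of y] True unfolding w_def by blast
  define u where "u = \<bar>y i\<bar>"
  define s :: real where "s = (if 0 \<le> y i then 1 else - 1)"
  have s: "s = 1 \<or> s = - 1" and su: "s * y i = u" by (auto simp: s_def u_def)
  have w0: "0 \<le> w" by (simp add: w_def power_sum_even_nonneg)
  have wu: "w \<le> u\<^sup>2" "sqrt w \<le> u"
    using wi unfolding u_def by (auto simp: real_le_lsqrt sqrt_le_D intro!: real_le_lsqrt)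
  have "- (sqrt (power_sum I y 2) ^ l * \<bar>g\<bar>) \<le> s * power_sum I y (3 + l)" if "even l" for l
  proof -
    \<comment> \<open>The inequality \<open>2 t^3 \<le> t^2 + t^4\<close> is an equality at 0 and 1,
      the moduli present in the limit, so it loses nothing asymptotically.\<close>
    have "(\<Sum>k\<in>I - {i}. \<bar>y k\<bar> ^ 3) \<le> (\<Sum>k\<in>I - {i}. ((y k) ^ 2 + (y k) ^ 4) / 2)"
    proof (rule sum_mono)
      fix k
      have "0 \<le> \<bar>y k\<bar>\<^sup>2 * (\<bar>y k\<bar> - 1)\<^sup>2" by simp
      then show "\<bar>y k\<bar> ^ 3 \<le> ((y k) ^ 2 + (y k) ^ 4) / 2"
        by (simp add: power2_eq_square power3_eq_cube power4_eq_xxxx algebra_simps)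
    qed
    also have "\<dots> = (power_sum I y 2 + power_sum I y 4 - u\<^sup>2 - u ^ 4) / 2"
      using power_sum_remove[OF \<open>finite I\<close> i, of y]
      by (simp add: power_sum_def u_def sum.distrib flip: sum_divide_distrib)
    finally have rest: "(\<Sum>k\<in>I - {i}. \<bar>y k\<bar> ^ 3) \<le> (power_sum I y 2 + power_sum I y 4 - u\<^sup>2 - u ^ 4) / 2" .
    have "sqrt w ^ 3 \<le> u ^ 3" "w\<^sup>2 \<le> u\<^sup>2 ^ 2"
      using wu(2) power_mono[OF wu(1) w0, of 2] w0 by (simp_all add: power_mono)
    then have gu: "g \<le> u ^ 3 - (\<Sum>k\<in>I - {i}. \<bar>y k\<bar> ^ 3)"
      using rest wu(1) unfolding g_def by (simp flip: power_mult) (simp add: field_simps)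
    have "- (sqrt (power_sum I y 2) ^ l * \<bar>g\<bar>) \<le> - (u ^ l * \<bar>g\<bar>)"
      unfolding u_def using abs_le_sqrt_power_sum_2[OF \<open>finite I\<close> i, of y]
      by (auto intro!: mult_right_mono power_mono)
    also have "\<dots> \<le> u ^ l * g"
      by (metis abs_ge_minus_self mult_left_mono mult_minus_right u_def zero_le_power abs_ge_zero minus_le_iff)
    also have "\<dots> \<le> u ^ l * (u ^ 3 - (\<Sum>k\<in>I - {i}. \<bar>y k\<bar> ^ 3))"
      using gu by (intro mult_left_mono) (auto simp: u_def)
    \<comment> \<open>Raising the exponent by \<open>l\<close> multiplies the leading term by
      exactly \<open>u ^ l\<close> and every other term by at most that.\<close>
    also have "\<dots> \<le> u ^ (3 + l) - (\<Sum>k\<in>I - {i}. \<bar>y k\<bar> ^ (3 + l))"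
      using sum_abs_power_le[of "I - {i}" y u 3 l] max
      by (simp add: u_def power_add algebra_simps)
    also have "\<dots> \<le> (s * y i) ^ (3 + l) + (\<Sum>k\<in>I - {i}. (s * y k) ^ (3 + l))"
    proof -
      have "- (\<bar>y k\<bar> ^ (3 + l)) \<le> (s * y k) ^ (3 + l)" for k
        using s abs_ge_minus_self[of "(s * y k) ^ (3 + l)"] by (auto simp: power_abs abs_mult)
      then have "- (\<Sum>k\<in>I - {i}. \<bar>y k\<bar> ^ (3 + l)) \<le> (\<Sum>k\<in>I - {i}. (s * y k) ^ (3 + l))"
        by (auto simp flip: sum_negf intro!: sum_mono)
      then show ?thesis by (simp add: su)
    qed
    also have "\<dots> = s ^ (3 + l) * power_sum I y (3 + l)"
      using power_sum_remove[OF \<open>finite I\<close> i, of y "3 + l"]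
      by (simp add: power_sum_def power_mult_distrib sum_distrib_left algebra_simps)
    also have "s ^ (3 + l) = s"
      using s that by (auto simp: power_add)
    finally show ?thesis .
  qed
  with s show ?thesis unfolding g_def by blast
qed auto

text \<open>The tangent line of \<open>t ^ l\<close> at \<open>t = 1\<close>, evaluated at the
  squared eigenvalues and weighted by them. If the power sums on the left both tend to 2, so does
  the lower bound.\<close>

lemma power_sum_even_ge:
  "power_sum I y 2 + real l * (power_sum I y 4 - power_sum I y 2) \<le> power_sum I y (2 * l + 2)"
proof -
  have "(\<Sum>i\<in>I. y i ^ 2 + real l * (y i ^ 4 - y i ^ 2)) \<le> (\<Sum>i\<in>I. y i ^ (2 * l + 2))"
  proof (rule sum_mono)
    fix i
    have "1 + real l * ((y i)\<^sup>2 - 1) \<le> (1 + ((y i)\<^sup>2 - 1)) ^ l"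
      by (rule Bernoulli_inequality) simp
    then have "(y i)\<^sup>2 * (1 + real l * ((y i)\<^sup>2 - 1)) \<le> (y i)\<^sup>2 * ((y i)\<^sup>2) ^ l"
      by (intro mult_left_mono) auto
    then show "y i ^ 2 + real l * (y i ^ 4 - y i ^ 2) \<le> y i ^ (2 * l + 2)"
      by (simp add: power_add power_mult algebra_simps power2_eq_square power4_eq_xxxx)
  qed
  then show ?thesis
    by (simp add: power_sum_def sum.distrib sum_subtractf flip: sum_distrib_left)
qed


text \<open>The factor \<open>s n ^ (j + 2)\<close> is the effect on the cumulants of multiplying
  the variable by the sign \<open>s n\<close>, and the maximum is the clipping that makes the
  comparison with the limit law exact.\<close>

lemma max_alt_cumulants_limit:
  assumes fin: "\<And>n. finite (I n)"
    and p2: "(\<lambda>n. power_sum (I n) (y n) 2) \<longlonglongrightarrow> 2"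
    and p4: "(\<lambda>n. power_sum (I n) (y n) 4) \<longlonglongrightarrow> 2"
  obtains s :: "nat \<Rightarrow> real" where "\<And>n. s n = 1 \<or> s n = - 1"
    "\<And>j. (\<lambda>n. max (alt_cumulants j) (s n ^ (j + 2) * (power_sum (I n) (y n) (j + 2) / 2))
        - s n ^ (j + 2) * (power_sum (I n) (y n) (j + 2) / 2)) \<longlonglongrightarrow> 0"
proof -
  define w where "w n = power_sum (I n) (y n) 4 / power_sum (I n) (y n) 2" for n
  define g where "g n = sqrt (w n) ^ 3 + (w n + (w n)\<^sup>2) / 2
    - (power_sum (I n) (y n) 2 + power_sum (I n) (y n) 4) / 2" for n
  have "\<forall>n. \<exists>s. (s = 1 \<or> s = - 1) \<and> (0 < power_sum (I n) (y n) 2 \<longrightarrow> (\<forall>l. even l \<longrightarrow>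
      - (sqrt (power_sum (I n) (y n) 2) ^ l * \<bar>g n\<bar>) \<le> s * power_sum (I n) (y n) (3 + l)))"
    unfolding g_def w_def by (intro allI odd_power_sums_sign fin)
  then obtain s where s: "\<And>n. s n = 1 \<or> s n = - 1"
    and low: "\<And>n l. 0 < power_sum (I n) (y n) 2 \<Longrightarrow> even l \<Longrightarrow>
      - (sqrt (power_sum (I n) (y n) 2) ^ l * \<bar>g n\<bar>) \<le> s n * power_sum (I n) (y n) (3 + l)"
    by metis
  have "w \<longlonglongrightarrow> 2 / 2"
    unfolding w_def by (intro tendsto_divide p2 p4) simp
  then have "g \<longlonglongrightarrow> sqrt 1 ^ 3 + (1 + 1\<^sup>2) / 2 - (2 + 2) / 2"
    unfolding g_def by (intro tendsto_intros p2 p4) simp_all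
  then have g: "g \<longlonglongrightarrow> 0" by simp
  have ev: "\<forall>\<^sub>F n in sequentially. 0 < power_sum (I n) (y n) 2"
    using order_tendstoD(1)[OF p2, of 0] by simp
  show ?thesis
  proof (rule that[OF s])
    fix j
    show "(\<lambda>n. max (alt_cumulants j) (s n ^ (j + 2) * (power_sum (I n) (y n) (j + 2) / 2))
        - s n ^ (j + 2) * (power_sum (I n) (y n) (j + 2) / 2)) \<longlonglongrightarrow> 0" (is "?f \<longlonglongrightarrow> 0")
    proof (cases "even j")
      case True
      then obtain l where l: "j = 2 * l" by blast
      \<comment> \<open>For even \<open>j\<close> the sign disappears and the clipping error is the
        amount by which the cumulant falls short of 1, which the tangent line bound
        controls.\<close>
      define h where "h n = max 0 (1 - (power_sum (I n) (y n) 2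
        + real l * (power_sum (I n) (y n) 4 - power_sum (I n) (y n) 2)) / 2)" for n
      have "h \<longlonglongrightarrow> max 0 (1 - (2 + real l * (2 - 2)) / 2)"
        unfolding h_def by (intro tendsto_intros p2 p4) simp_all
      then have h: "h \<longlonglongrightarrow> 0" by simp
      have "s n ^ (j + 2) = 1" for n
        using s[of n] l by auto
      then have "0 \<le> ?f n \<and> ?f n \<le> h n" for n
        using power_sum_even_ge[of "I n" "y n" l] l unfolding h_def
        by (auto simp: alt_cumulants_def max_def field_simps)
      then show ?thesis
        by (intro tendsto_sandwich[OF _ _ tendsto_const h]) auto
    next
      case False
      then obtain l where l: "j = Suc l" "even l" by (cases j) auto
      define h where "h n = sqrt (power_sum (I n) (y n) 2) ^ l * \<bar>g n\<bar>" for n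
      have "h \<longlonglongrightarrow> sqrt 2 ^ l * \<bar>0\<bar>"
        unfolding h_def by (intro tendsto_intros p2 g)
      then have h: "h \<longlonglongrightarrow> 0" by simp
      have sj: "s n ^ (j + 2) = s n" for n
        using s[of n] l by auto
      have "0 \<le> ?f n \<and> ?f n \<le> h n" if "0 < power_sum (I n) (y n) 2" for n
      proof -
        have "0 \<le> h n" using that by (simp add: h_def)
        moreover have "- h n \<le> s n * power_sum (I n) (y n) (j + 2)"
          using low[OF that \<open>even l\<close>] l(1) by (simp add: h_def numeral_3_eq_3)
        moreover have "alt_cumulants j = 0" using False by (simp add: alt_cumulants_def)
        ultimately show ?thesis unfolding sj by (simp add: max_def)
      qed
      then show ?thesis
        by (intro tendsto_sandwich[OF _ _ tendsto_const h]) (use ev in \<open>auto elim!: eventually_mono\<close>)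
    qed
  qed
qed

lemma power_sums_limit_of_cmoment:
  assumes fin: "\<And>n. finite (I n)"
    and p2: "(\<lambda>n. power_sum (I n) (y n) 2) \<longlonglongrightarrow> 2"
    and p4: "(\<lambda>n. power_sum (I n) (y n) 4) \<longlonglongrightarrow> 2"
    and "r \<ge> 3"
    and lim: "(\<lambda>n. cmoment (\<lambda>j. power_sum (I n) (y n) (j + 2) / 2) (2 * r))
      \<longlonglongrightarrow> cmoment alt_cumulants (2 * r)"
  shows "(\<lambda>n. power_sum (I n) (y n) 6) \<longlonglongrightarrow> 2" "(\<lambda>n. power_sum (I n) (y n) 3) \<longlonglongrightarrow> 0"
proof -
  define m where "m n j = power_sum (I n) (y n) (j + 2) / 2" for n j
  obtain s where s: "\<And>n. s n = 1 \<or> s n = - 1"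
    and hat: "\<And>j. (\<lambda>n. max (alt_cumulants j) (s n ^ (j + 2) * m n j) - s n ^ (j + 2) * m n j) \<longlonglongrightarrow> 0"
    using max_alt_cumulants_limit[OF fin p2 p4, folded m_def] by blast
  define ms where "ms n j = s n ^ (j + 2) * m n j" for n j
  define mh where "mh n j = max (alt_cumulants j) (ms n j)" for n j
  have sq: "s n ^ k * s n ^ k = 1" for n k
    using s[of n] by (auto simp flip: power_mult_distrib)
  obtain K where K: "\<And>n. \<bar>power_sum (I n) (y n) 2\<bar> \<le> K" "0 < K"
    using convergent_imp_Bseq[OF convergentI[OF p2]] unfolding Bseq_def by auto
  \<comment> \<open>The maximum with 1 makes the bound valid also for the clipped cumulants, which
    may take the value 1.\<close>
  define b where "b j = max 1 (sqrt K ^ j * K / 2)" for j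
  have "\<bar>ms n j\<bar> \<le> b j" for n j
  proof -
    have "\<bar>ms n j\<bar> = \<bar>power_sum (I n) (y n) (2 + j)\<bar> / 2"
      using s[of n] by (auto simp: ms_def m_def abs_mult power_abs add.commute)
    also have "\<dots> \<le> sqrt (power_sum (I n) (y n) 2) ^ j * power_sum (I n) (y n) 2 / 2"
      using abs_power_sum_le[OF fin] by (simp add: divide_right_mono)
    also have "\<dots> \<le> sqrt K ^ j * K / 2"
      using K(1)[of n] power_sum_even_nonneg[of 2 "I n" "y n"] \<open>0 < K\<close>
      by (intro divide_right_mono mult_mono power_mono) auto
    finally show ?thesis by (simp add: b_def)
  qed
  moreover have "\<bar>mh n j\<bar> \<le> b j" for n j
    using \<open>\<bar>ms n j\<bar> \<le> b j\<close> by (auto simp: mh_def alt_cumulants_def b_def max_def)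
  ultimately have "(\<lambda>n. cmoment (mh n) (2 * r) - cmoment (ms n) (2 * r)) \<longlonglongrightarrow> 0"
    by (intro cmoment_perturb[where b = b]) (use hat in \<open>auto simp: mh_def ms_def\<close>)
  \<comment> \<open>Moments of even order do not notice the sign change.\<close>
  moreover have "cmoment (ms n) (2 * r) = cmoment (m n) (2 * r)" for n
    using cmoment_scale[of "s n" "m n" "2 * r"] s[of n]
    by (auto simp: ms_def[abs_def] power_mult simp del: cmoment.simps)
  ultimately have "(\<lambda>n. (cmoment (mh n) (2 * r) - cmoment (ms n) (2 * r)) + cmoment (m n) (2 * r))
      \<longlonglongrightarrow> 0 + cmoment alt_cumulants (2 * r)"
    using lim unfolding m_def[symmetric] by (intro tendsto_add) auto
  then have lim': "(\<lambda>n. cmoment (mh n) (2 * r)) \<longlonglongrightarrow> cmoment alt_cumulants (2 * r)"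
    using \<open>\<And>n. cmoment (ms n) (2 * r) = cmoment (m n) (2 * r)\<close> by simp
  then have gap: "(\<lambda>n. cmoment (mh n) (2 * r) - cmoment alt_cumulants (2 * r)) \<longlonglongrightarrow> 0"
    using LIM_zero by blast
  have mh: "alt_cumulants j \<le> mh n j" for n j by (simp add: mh_def)
  note bound = cmoment_even_lower_bound[of "mh _", OF mh \<open>r \<ge> 3\<close>]
  have "(\<lambda>n. mh n 4 - 1) \<longlonglongrightarrow> 0"
  proof (rule tendsto_sandwich[OF _ _ tendsto_const gap])
    show "\<forall>\<^sub>F n in sequentially. 0 \<le> mh n 4 - 1"
      using mh[of 4] by (simp add: alt_cumulants_def)
    show "\<forall>\<^sub>F n in sequentially. mh n 4 - 1 \<le> cmoment (mh n) (2 * r) - cmoment alt_cumulants (2 * r)"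
      using bound(1) by (intro always_eventually allI) (simp add: algebra_simps)
  qed
  then have "(\<lambda>n. (mh n 4 - 1) - (mh n 4 - ms n 4)) \<longlonglongrightarrow> 0 - 0"
    using hat[of 4] by (intro tendsto_diff) (auto simp: mh_def ms_def)
  then have "(\<lambda>n. ms n 4 - 1) \<longlonglongrightarrow> 0" by simp
  then have "(\<lambda>n. 2 * (ms n 4 - 1) + 2) \<longlonglongrightarrow> 2 * 0 + 2"
    by (intro tendsto_intros)
  moreover have "2 * (ms n 4 - 1) + 2 = power_sum (I n) (y n) 6" for n
    using s[of n] by (auto simp: ms_def m_def)
  ultimately show "(\<lambda>n. power_sum (I n) (y n) 6) \<longlonglongrightarrow> 2" by simp
  have "(\<lambda>n. (mh n 1)\<^sup>2) \<longlonglongrightarrow> 0"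
  proof (rule tendsto_sandwich[OF _ _ tendsto_const gap])
    show "\<forall>\<^sub>F n in sequentially. (mh n 1)\<^sup>2 \<le> cmoment (mh n) (2 * r) - cmoment alt_cumulants (2 * r)"
      using bound(2) by (intro always_eventually allI) (simp add: algebra_simps)
  qed simp
  then have "(\<lambda>n. sqrt ((mh n 1)\<^sup>2)) \<longlonglongrightarrow> sqrt 0" by (intro tendsto_intros)
  then have "(\<lambda>n. mh n 1) \<longlonglongrightarrow> 0" by (simp add: tendsto_rabs_zero_iff)
  then have "(\<lambda>n. mh n 1 - (mh n 1 - ms n 1)) \<longlonglongrightarrow> 0 - 0"
    using hat[of 1] by (intro tendsto_diff) (auto simp: mh_def ms_def)
  then have "(\<lambda>n. ms n 1) \<longlonglongrightarrow> 0" by simp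
  then have "(\<lambda>n. \<bar>2 * ms n 1\<bar>) \<longlonglongrightarrow> \<bar>2 * 0\<bar>" by (intro tendsto_intros)
  \<comment> \<open>The absolute value removes the sign \<open>s n\<close>, which may vary with
    \<open>n\<close>.\<close>
  moreover have "\<bar>2 * ms n 1\<bar> = \<bar>power_sum (I n) (y n) 3\<bar>" for n
    using s[of n] by (auto simp: ms_def m_def eval_nat_numeral)
  ultimately have "(\<lambda>n. \<bar>power_sum (I n) (y n) 3\<bar>) \<longlonglongrightarrow> 0"
    by (simp only: mult_zero_right abs_zero)
  then show "(\<lambda>n. power_sum (I n) (y n) 3) \<longlonglongrightarrow> 0"
    by (rule tendsto_rabs_zero_cancel)
qed

text \<open>Here \<open>p\<^sub>6 - 2 p\<^sub>4 + p\<^sub>2 = \<Sum> y\<^sup>2 (y\<^sup>2 - 1)\<^sup>2\<close> forces two eigenvalues of modulus close to \<open>1\<close>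
  to exhaust \<open>p\<^sub>2\<close>, and \<open>p\<^sub>3\<close> makes their signs opposite.\<close>

lemma two_eigenvalues_limit:
  assumes fin: "\<And>n. finite (I n)"
    and p2: "(\<lambda>n. power_sum (I n) (y n) 2) \<longlonglongrightarrow> 2"
    and p3: "(\<lambda>n. power_sum (I n) (y n) 3) \<longlonglongrightarrow> 0"
    and p4: "(\<lambda>n. power_sum (I n) (y n) 4) \<longlonglongrightarrow> 2"
    and p6: "(\<lambda>n. power_sum (I n) (y n) 6) \<longlonglongrightarrow> 2"
  obtains a b where "\<forall>\<^sub>F n in sequentially. a n \<in> I n \<and> b n \<in> I n \<and> a n \<noteq> b n"
    "(\<lambda>n. (y n (a n) - 1)\<^sup>2 + (y n (b n) + 1)\<^sup>2 + power_sum (I n - {a n, b n}) (y n) 2) \<longlonglongrightarrow> 0"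
proof -
  have "\<forall>n. \<exists>i. 0 < power_sum (I n) (y n) 2 \<longrightarrow>
    i \<in> I n \<and> (\<forall>k\<in>I n. \<bar>y n k\<bar> \<le> \<bar>y n i\<bar>) \<and> power_sum (I n) (y n) 4 / power_sum (I n) (y n) 2 \<le> (y n i)\<^sup>2"
    by (intro allI exists_max_abs fin)
  from choice[OF this] obtain i where i: "\<And>n. 0 < power_sum (I n) (y n) 2 \<Longrightarrow>
    i n \<in> I n \<and> (\<forall>k\<in>I n. \<bar>y n k\<bar> \<le> \<bar>y n (i n)\<bar>) \<and>
    power_sum (I n) (y n) 4 / power_sum (I n) (y n) 2 \<le> (y n (i n))\<^sup>2" by blast
  \<comment> \<open>Without the leading eigenvalue, the second and fourth power sums tend to 1, and
    the extremal argument can be repeated to find a second eigenvalue.\<close>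
  define I' where "I' n = I n - {i n}" for n
  have fin': "finite (I' n)" for n using fin by (simp add: I'_def)
  have "\<forall>n. \<exists>k. 0 < power_sum (I' n) (y n) 2 \<longrightarrow>
    k \<in> I' n \<and> (\<forall>j\<in>I' n. \<bar>y n j\<bar> \<le> \<bar>y n k\<bar>) \<and> power_sum (I' n) (y n) 4 / power_sum (I' n) (y n) 2 \<le> (y n k)\<^sup>2"
    by (intro allI exists_max_abs fin')
  from choice[OF this] obtain k where k: "\<And>n. 0 < power_sum (I' n) (y n) 2 \<Longrightarrow>
    k n \<in> I' n \<and> power_sum (I' n) (y n) 4 / power_sum (I' n) (y n) 2 \<le> (y n (k n))\<^sup>2" by blast
  define u where "u n = y n (i n)" for n
  define v where "v n = y n (k n)" for n
  define R where "R n = power_sum (I' n - {k n}) (y n) 2" for n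
  have ev: "\<forall>\<^sub>F n in sequentially. 0 < power_sum (I n) (y n) 2"
    using order_tendstoD(1)[OF p2, of 0] by simp
  have ev_i: "\<forall>\<^sub>F n in sequentially. i n \<in> I n"
    using ev by eventually_elim (use i in blast)
  have split: "\<forall>\<^sub>F n in sequentially. power_sum (I n) (y n) l = u n ^ l + power_sum (I' n) (y n) l" for l
    using ev_i by eventually_elim (simp add: power_sum_remove[OF fin] u_def I'_def)
  have u2: "(\<lambda>n. (u n)\<^sup>2) \<longlonglongrightarrow> 1"
  proof -
    define w where "w n = power_sum (I n) (y n) 4 / power_sum (I n) (y n) 2" for n
    have w: "w \<longlonglongrightarrow> 1"
      using tendsto_divide[OF p4 p2] by (simp add: w_def[abs_def])
    have d: "(\<lambda>n. power_sum (I n) (y n) 6 - 2 * power_sum (I n) (y n) 4 + power_sum (I n) (y n) 2) \<longlonglongrightarrow> 2 - 2 * 2 + 2"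
      by (intro tendsto_intros p2 p4 p6)
    have "(\<lambda>n. (power_sum (I n) (y n) 6 - 2 * power_sum (I n) (y n) 4 + power_sum (I n) (y n) 2) / w n)
      \<longlonglongrightarrow> (2 - 2 * 2 + 2) / 1"
      by (intro tendsto_divide d w) simp
    then have lim: "(\<lambda>n. (power_sum (I n) (y n) 6 - 2 * power_sum (I n) (y n) 4 + power_sum (I n) (y n) 2) / w n) \<longlonglongrightarrow> 0"
      by simp
    have "\<forall>\<^sub>F n in sequentially. ((u n)\<^sup>2 - 1)\<^sup>2
      \<le> (power_sum (I n) (y n) 6 - 2 * power_sum (I n) (y n) 4 + power_sum (I n) (y n) 2) / w n"
      using ev order_tendstoD(1)[OF w, of 0, simplified]
    proof eventually_elim
      case (elim n)
      have wu: "w n \<le> (u n)\<^sup>2" and "i n \<in> I n"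
        using i[OF elim(1)] by (auto simp: w_def u_def)
      have "w n * ((u n)\<^sup>2 - 1)\<^sup>2 \<le> (u n)\<^sup>2 * ((u n)\<^sup>2 - 1)\<^sup>2"
        using wu by (intro mult_right_mono) auto
      also have "\<dots> \<le> (\<Sum>j\<in>I n. (y n j)\<^sup>2 * ((y n j)\<^sup>2 - 1)\<^sup>2)"
        using member_le_sum[OF \<open>i n \<in> I n\<close> _ fin, of "\<lambda>j. (y n j)\<^sup>2 * ((y n j)\<^sup>2 - 1)\<^sup>2"] by (simp add: u_def)
      also have "\<dots> = (\<Sum>j\<in>I n. y n j ^ 6 - 2 * y n j ^ 4 + y n j ^ 2)"
        by (intro sum.cong refl) (simp add: eval_nat_numeral algebra_simps)
      also have "\<dots> = power_sum (I n) (y n) 6 - 2 * power_sum (I n) (y n) 4 + power_sum (I n) (y n) 2"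
        by (simp add: power_sum_def sum.distrib sum_subtractf sum_distrib_left)
      finally show ?case
        using elim(2) by (simp add: le_divide_eq mult.commute)
    qed
    then have "(\<lambda>n. ((u n)\<^sup>2 - 1)\<^sup>2) \<longlonglongrightarrow> 0"
      by (intro tendsto_sandwich[OF _ _ tendsto_const lim]) auto
    then have "(\<lambda>n. sqrt (((u n)\<^sup>2 - 1)\<^sup>2)) \<longlonglongrightarrow> sqrt 0" by (intro tendsto_intros)
    then have "(\<lambda>n. (u n)\<^sup>2 - 1) \<longlonglongrightarrow> 0" by (simp add: tendsto_rabs_zero_iff)
    then show ?thesis by (rule LIM_zero_cancel)
  qed
  have u4: "(\<lambda>n. u n ^ 4) \<longlonglongrightarrow> 1"
    using tendsto_power[OF u2, of 2] by (simp flip: power_mult)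
  have p2': "(\<lambda>n. power_sum (I' n) (y n) 2) \<longlonglongrightarrow> 1"
  proof (rule Lim_transform_eventually)
    show "(\<lambda>n. power_sum (I n) (y n) 2 - u n ^ 2) \<longlonglongrightarrow> 1"
      using tendsto_diff[OF p2 u2] by simp
  qed (use split[of 2] in eventually_elim, simp)
  have p4': "(\<lambda>n. power_sum (I' n) (y n) 4) \<longlonglongrightarrow> 1"
  proof (rule Lim_transform_eventually)
    show "(\<lambda>n. power_sum (I n) (y n) 4 - u n ^ 4) \<longlonglongrightarrow> 1"
      using tendsto_diff[OF p4 u4] by simp
  qed (use split[of 4] in eventually_elim, simp)
  have ev': "\<forall>\<^sub>F n in sequentially. 0 < power_sum (I' n) (y n) 2"
    using order_tendstoD(1)[OF p2', of 0] by simp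
  have ev_k: "\<forall>\<^sub>F n in sequentially. k n \<in> I' n"
    using ev' by eventually_elim (use k in blast)
  have split': "\<forall>\<^sub>F n in sequentially. power_sum (I' n) (y n) l = v n ^ l + power_sum (I' n - {k n}) (y n) l" for l
    using ev_k by eventually_elim (simp add: power_sum_remove[OF fin'] v_def)
  \<comment> \<open>The square is squeezed between the ratio of the fourth and the second remaining
    power sum and the second one itself; both tend to 1.\<close>
  have v2: "(\<lambda>n. (v n)\<^sup>2) \<longlonglongrightarrow> 1"
  proof (rule tendsto_sandwich)
    show "(\<lambda>n. power_sum (I' n) (y n) 4 / power_sum (I' n) (y n) 2) \<longlonglongrightarrow> 1"
      using tendsto_divide[OF p4' p2'] by simp
    show "\<forall>\<^sub>F n in sequentially. power_sum (I' n) (y n) 4 / power_sum (I' n) (y n) 2 \<le> (v n)\<^sup>2"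
      using ev' by eventually_elim (use k v_def in auto)
    show "\<forall>\<^sub>F n in sequentially. (v n)\<^sup>2 \<le> power_sum (I' n) (y n) 2"
      using ev_k by eventually_elim (simp add: v_def sq_le_power_sum_2[OF fin'])
  qed (rule p2')
  have R: "R \<longlonglongrightarrow> 0"
  proof (rule Lim_transform_eventually)
    show "(\<lambda>n. power_sum (I' n) (y n) 2 - v n ^ 2) \<longlonglongrightarrow> 0"
      using tendsto_diff[OF p2' v2] by simp
  qed (use split'[of 2] in \<open>eventually_elim, simp add: R_def\<close>)
  \<comment> \<open>In \<open>u^3 + v^3 = (u + v) * (u^2 - u * v + v^2)\<close> the left-hand side
    tends to zero, while the last factor is at least \<open>(u^2 + v^2) / 2\<close>, which tends to
    1.\<close>
  have uv: "(\<lambda>n. u n + v n) \<longlonglongrightarrow> 0"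
  proof -
    have "(\<lambda>n. sqrt (R n) ^ 1 * R n) \<longlonglongrightarrow> sqrt 0 ^ 1 * 0"
      by (intro tendsto_intros R)
    then have "(\<lambda>n. sqrt (R n) ^ 1 * R n) \<longlonglongrightarrow> 0" by simp
    then have "(\<lambda>n. power_sum (I' n - {k n}) (y n) 3) \<longlonglongrightarrow> 0"
      by (rule Lim_null_comparison[rotated])
        (use abs_power_sum_le[of "I' _ - {k _}" "y _" 1] fin' in \<open>auto simp: R_def intro!: always_eventually\<close>)
    from tendsto_diff[OF p3 this]
    have "(\<lambda>n. power_sum (I n) (y n) 3 - power_sum (I' n - {k n}) (y n) 3) \<longlonglongrightarrow> 0 - 0" .
    then have "(\<lambda>n. \<bar>power_sum (I n) (y n) 3 - power_sum (I' n - {k n}) (y n) 3\<bar> / (((u n)\<^sup>2 + (v n)\<^sup>2) / 2))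
        \<longlonglongrightarrow> \<bar>0 - 0\<bar> / ((1 + 1) / 2)"
      by (intro tendsto_divide tendsto_rabs tendsto_add tendsto_const u2 v2) auto
    then have lim: "(\<lambda>n. \<bar>power_sum (I n) (y n) 3 - power_sum (I' n - {k n}) (y n) 3\<bar> / (((u n)\<^sup>2 + (v n)\<^sup>2) / 2)) \<longlonglongrightarrow> 0"
      by simp
    show ?thesis
    proof (rule Lim_null_comparison[OF _ lim])
      show "\<forall>\<^sub>F n in sequentially. norm (u n + v n)
        \<le> \<bar>power_sum (I n) (y n) 3 - power_sum (I' n - {k n}) (y n) 3\<bar> / (((u n)\<^sup>2 + (v n)\<^sup>2) / 2)"
        using split[of 3] split'[of 3] order_tendstoD(1)[OF u2, of 0, simplified]
      proof eventually_elim
        case (elim n)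
        have "0 \<le> (u n - v n)\<^sup>2" by simp
        then have q: "((u n)\<^sup>2 + (v n)\<^sup>2) / 2 \<le> (u n)\<^sup>2 - u n * v n + (v n)\<^sup>2"
          by (simp add: power2_eq_square algebra_simps add_divide_distrib)
        have pos: "0 < ((u n)\<^sup>2 + (v n)\<^sup>2) / 2"
          using elim(3) by (simp add: add_pos_nonneg)
        have "\<bar>u n + v n\<bar> * (((u n)\<^sup>2 + (v n)\<^sup>2) / 2) \<le> \<bar>u n + v n\<bar> * \<bar>(u n)\<^sup>2 - u n * v n + (v n)\<^sup>2\<bar>"
          using q pos by (intro mult_left_mono) auto
        also have "\<dots> = \<bar>u n ^ 3 + v n ^ 3\<bar>"
          unfolding abs_mult[symmetric]
          by (rule arg_cong[where f = abs]) (simp add: power2_eq_square power3_eq_cube algebra_simps)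
        finally show ?case
          using elim(1,2) pos by (simp add: pos_le_divide_eq)
      qed
    qed
  qed
  \<comment> \<open>\<open>a\<close> marks the eigenvalue near 1 and \<open>b\<close> the one near
    -1; which of them is leading in modulus may change with \<open>n\<close>.\<close>
  define a where "a n = (if 0 < u n then i n else k n)" for n
  define b where "b n = (if 0 < u n then k n else i n)" for n
  have ev_ab: "\<forall>\<^sub>F n in sequentially. a n \<in> I n \<and> b n \<in> I n \<and> a n \<noteq> b n"
    using ev_i ev_k by eventually_elim (auto simp: a_def b_def I'_def)
  have u1: "(\<lambda>n. (\<bar>u n\<bar> - 1)\<^sup>2) \<longlonglongrightarrow> 0"
  proof -
    have "(\<lambda>n. (sqrt ((u n)\<^sup>2) - 1)\<^sup>2) \<longlonglongrightarrow> (sqrt 1 - 1)\<^sup>2"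
      by (intro tendsto_intros u2)
    then show ?thesis by simp
  qed
  \<comment> \<open>The deviation of \<open>v\<close> from its target is \<open>u + v\<close> plus
    or minus the deviation of \<open>u\<close>, so its square is at most twice the sum of both
    squares. With the deviation of \<open>u\<close> itself this gives the constants 3 and 2.\<close>
  have "(\<lambda>n. 3 * (\<bar>u n\<bar> - 1)\<^sup>2 + 2 * (u n + v n)\<^sup>2 + R n) \<longlonglongrightarrow> 3 * 0 + 2 * 0\<^sup>2 + 0"
    by (intro tendsto_intros u1 uv R)
  then have lim: "(\<lambda>n. 3 * (\<bar>u n\<bar> - 1)\<^sup>2 + 2 * (u n + v n)\<^sup>2 + R n) \<longlonglongrightarrow> 0" by simp
  have "(\<lambda>n. (y n (a n) - 1)\<^sup>2 + (y n (b n) + 1)\<^sup>2 + power_sum (I n - {a n, b n}) (y n) 2) \<longlonglongrightarrow> 0"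
  proof (rule tendsto_sandwich[OF _ _ tendsto_const lim])
    show "\<forall>\<^sub>F n in sequentially. 0 \<le> (y n (a n) - 1)\<^sup>2 + (y n (b n) + 1)\<^sup>2 + power_sum (I n - {a n, b n}) (y n) 2"
      by (simp add: power_sum_even_nonneg)
    show "\<forall>\<^sub>F n in sequentially. (y n (a n) - 1)\<^sup>2 + (y n (b n) + 1)\<^sup>2 + power_sum (I n - {a n, b n}) (y n) 2
      \<le> 3 * (\<bar>u n\<bar> - 1)\<^sup>2 + 2 * (u n + v n)\<^sup>2 + R n"
    proof (intro always_eventually allI)
      fix n
      have set: "I n - {i n, k n} = I' n - {k n}" "I n - {k n, i n} = I' n - {k n}"
        by (auto simp: I'_def)
      have sq: "(p + q)\<^sup>2 \<le> 2 * p\<^sup>2 + 2 * q\<^sup>2" for p q :: real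
        using zero_le_power2[of "p - q"] by (simp add: power2_eq_square algebra_simps)
      show "(y n (a n) - 1)\<^sup>2 + (y n (b n) + 1)\<^sup>2 + power_sum (I n - {a n, b n}) (y n) 2
        \<le> 3 * (\<bar>u n\<bar> - 1)\<^sup>2 + 2 * (u n + v n)\<^sup>2 + R n"
      proof (cases "0 < u n")
        case True
        then show ?thesis
          using sq[of "u n + v n" "1 - u n"]
          by (simp add: set R_def a_def b_def u_def v_def power2_commute[of 1] algebra_simps)
      next
        case False
        then show ?thesis
          using sq[of "u n + v n" "- u n - 1"]
          by (simp add: set R_def a_def b_def u_def v_def power2_commute algebra_simps)
      qed
    qed
  qed
  with ev_ab show ?thesis by (rule that)
qed

section \<open>Independence from characteristic functions\<close>

text \<open>After normalisation the weight is a density, and under the tilted measure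
  \<open>X\<close> has the characteristic function of \<open>N\<close>; Levy's uniqueness theorem
  identifies its law. The weight stands for what other variables contribute, and the conclusion
  separates it from events about \<open>X\<close>.\<close>

lemma (in prob_space) weighted_char_uniqueness:
  fixes X w :: "'a \<Rightarrow> real"
  assumes [measurable]: "X \<in> borel_measurable M" "w \<in> borel_measurable M"
    and w: "\<And>x. 0 \<le> w x" "\<And>x. w x \<le> B"
    and N: "real_distribution N"
    and char: "\<And>s. (CLINT x|M. w x * iexp (s * X x)) = expectation w * char N s"
    and A: "A \<in> sets borel"
  shows "(LINT x|M. w x * indicator A (X x)) = expectation w * measure N A"
proof -
  have int_w: "integrable M w"
    by (rule integrable_const_bound[where B = B]) (use w in auto)
  have "0 \<le> expectation w" using w by (intro Bochner_Integration.integral_nonneg) auto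
  show ?thesis
  proof (cases "expectation w = 0")
    case True
    then have "AE x in M. w x = 0"
      using integral_nonneg_eq_0_iff_AE[OF int_w] w by simp
    then have "(LINT x|M. w x * indicator A (X x)) = (LINT x|M. 0)"
      using A by (intro integral_cong_AE) auto
    with True show ?thesis by simp
  next
    case False
    define c where "c = expectation w"
    have c: "0 < c" using False \<open>0 \<le> expectation w\<close> by (simp add: c_def)
    define D where "D = density M (\<lambda>x. ennreal (w x / c))"
    have D: "sets D = sets M" "space D = space M" by (simp_all add: D_def)
    have XD[measurable]: "X \<in> borel_measurable D" by (simp add: D_def)
    have "emeasure D (space D) = (\<integral>\<^sup>+x. ennreal (w x / c) \<partial>M)"
      unfolding D_def by (subst emeasure_density) (auto intro!: nn_integral_cong)
    also have "\<dots> = ennreal (LINT x|M. w x / c)"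
      using c w int_w by (intro nn_integral_eq_integral) auto
    also have "\<dots> = 1" using c by (simp add: c_def)
    finally have "prob_space D" by (rule prob_spaceI)
    then interpret D: prob_space D .
    have integral_D: "(LINT x|D. f x) = (LINT x|M. (w x / c) *\<^sub>R f x)"
      if [measurable]: "f \<in> borel_measurable M" for f :: "'a \<Rightarrow> 'b::{banach, second_countable_topology}"
      unfolding D_def using c w by (subst integral_density) auto
    have "char (distr D borel X) s = char N s" for s
    proof -
      have "char (distr D borel X) s = (CLINT x|D. iexp (s * X x))"
        unfolding char_def by (subst integral_distr) auto
      also have "\<dots> = (CLINT x|M. (w x * iexp (s * X x)) / c)"
        by (subst integral_D) (auto simp: scaleR_conv_of_real)
      also have "\<dots> = char N s"
        using c char[of s] by (simp add: c_def)
      finally show ?thesis .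
    qed
    then have eq: "distr D borel X = N"
      by (intro Levy_uniqueness D.real_distribution_distr XD N ext)
    have "measure N A = measure D (X -` A \<inter> space D)"
      unfolding eq[symmetric] using A by (subst measure_distr) auto
    also have "\<dots> = (LINT x|D. indicator (X -` A \<inter> space D) x)"
      by simp
    also have "\<dots> = (LINT x|D. indicator A (X x))"
      by (intro Bochner_Integration.integral_cong) (auto split: split_indicator)
    also have "\<dots> = (LINT x|M. w x * indicator A (X x) / c)"
      using A by (subst integral_D) auto
    finally show ?thesis using c by (simp add: c_def)
  qed
qed

text \<open>The complex weight \<open>v e\<^bsup>i\<theta>\<^esup>\<close> is a combination of the nonnegative weights \<open>v\<close>,
  \<open>v (1 + cos \<theta>)\<close> and \<open>v (1 + sin \<theta>)\<close>.\<close>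

lemma (in prob_space) weighted_char_uniqueness_complex:
  fixes X v \<theta> :: "'a \<Rightarrow> real"
  assumes [measurable]: "X \<in> borel_measurable M" "v \<in> borel_measurable M" "\<theta> \<in> borel_measurable M"
    and v: "\<And>x. 0 \<le> v x" "\<And>x. v x \<le> 1"
    and N: "real_distribution N"
    and char: "\<And>c s. (CLINT x|M. v x * iexp (c * \<theta> x) * iexp (s * X x))
      = (CLINT x|M. v x * iexp (c * \<theta> x)) * char N s"
    and A: "A \<in> sets borel"
  shows "(CLINT x|M. v x * iexp (\<theta> x) * indicator A (X x)) = (CLINT x|M. v x * iexp (\<theta> x)) * measure N A"
proof -
  have [measurable]: "A \<in> sets borel" by fact
  have bdd: "integrable M f" if "f \<in> borel_measurable M" "\<And>x. cmod (f x) \<le> 2" for f :: "'a \<Rightarrow> complex"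
    using that by (intro integrable_const_bound[where B = 2]) auto
  have bddr: "integrable M f" if "f \<in> borel_measurable M" "\<And>x. \<bar>f x\<bar> \<le> 2" for f :: "'a \<Rightarrow> real"
    using that by (intro integrable_const_bound[where B = 2]) auto
  have le2: "v x * a \<le> 2" if "a \<le> 2" "0 \<le> a" for x a
    using mult_mono[of "v x" 1 a 2] v[of x] that by simp
  have lin: "(CLINT x|M. f x + a * g x + b * h x) = (CLINT x|M. f x) + a * (CLINT x|M. g x) + b * (CLINT x|M. h x)"
    if "integrable M f" "integrable M g" "integrable M h" for f g h :: "'a \<Rightarrow> complex" and a b
    using that by simp
  \<comment> \<open>A function spanned by the two opposite phases inherits the factorisation from
    \<open>char\<close> with \<open>c = 0, 1, -1\<close>, and adding 1 makes the weight
    nonnegative.\<close>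
  have key: "(LINT x|M. v x * (1 + g x) * indicator A (X x)) = (LINT x|M. v x * (1 + g x)) * measure N A"
    if [measurable]: "g \<in> borel_measurable M" and g: "\<And>x. \<bar>g x\<bar> \<le> 1"
      and g_eq: "\<And>x. complex_of_real (g x) = a * iexp (\<theta> x) + b * iexp (- \<theta> x)" for g a b
  proof (rule weighted_char_uniqueness[where B = 2])
    have w: "complex_of_real (v x * (1 + g x))
      = v x * iexp (0 * \<theta> x) + a * (v x * iexp (1 * \<theta> x)) + b * (v x * iexp (- 1 * \<theta> x))" for x
      by (simp add: g_eq algebra_simps)
    have int: "integrable M (\<lambda>x. complex_of_real (v x) * iexp (c * \<theta> x) * iexp (s * X x))" for c s
      by (rule bdd) (use v in \<open>auto simp: norm_mult intro: order_trans[of _ 1]\<close>)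
    have int': "integrable M (\<lambda>x. complex_of_real (v x) * iexp (c * \<theta> x))" for c
      by (rule bdd) (use v in \<open>auto simp: norm_mult intro: order_trans[of _ 1]\<close>)
    show "(CLINT x|M. complex_of_real (v x * (1 + g x)) * iexp (s * X x))
      = complex_of_real (LINT x|M. v x * (1 + g x)) * char N s" for s
    proof -
      have "(CLINT x|M. complex_of_real (v x * (1 + g x)) * iexp (s * X x)) =
        (CLINT x|M. v x * iexp (0 * \<theta> x) * iexp (s * X x) + a * (v x * iexp (1 * \<theta> x) * iexp (s * X x))
          + b * (v x * iexp (- 1 * \<theta> x) * iexp (s * X x)))"
        unfolding w by (simp only: distrib_right mult.assoc)
      also have "\<dots> = (CLINT x|M. v x * iexp (0 * \<theta> x) * iexp (s * X x))
          + a * (CLINT x|M. v x * iexp (1 * \<theta> x) * iexp (s * X x))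
          + b * (CLINT x|M. v x * iexp (- 1 * \<theta> x) * iexp (s * X x))"
        by (intro lin int)
      also have "\<dots> = ((CLINT x|M. v x * iexp (0 * \<theta> x)) + a * (CLINT x|M. v x * iexp (1 * \<theta> x))
          + b * (CLINT x|M. v x * iexp (- 1 * \<theta> x))) * char N s"
        unfolding char by (simp add: algebra_simps)
      also have "(CLINT x|M. v x * iexp (0 * \<theta> x)) + a * (CLINT x|M. v x * iexp (1 * \<theta> x))
          + b * (CLINT x|M. v x * iexp (- 1 * \<theta> x)) = (CLINT x|M. complex_of_real (v x * (1 + g x)))"
        unfolding w by (intro lin[symmetric] int')
      also have "\<dots> = complex_of_real (LINT x|M. v x * (1 + g x))"
        by (rule integral_complex_of_real)
      finally show ?thesis .
    qed
    show "0 \<le> v x * (1 + g x)" "v x * (1 + g x) \<le> 2" for x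
      using v[of x] g[of x] le2[of "1 + g x" x] by (auto simp: abs_le_iff)
  qed (use N A in auto)
  have vg: "v x * \<bar>a\<bar> \<le> 2" if "\<bar>a\<bar> \<le> 1" for x a
    using mult_mono[of "v x" 1 "\<bar>a\<bar>" 1] v[of x] that by simp
  \<comment> \<open>Subtracting the instance \<open>g = 0\<close> removes the constant 1
    again.\<close>
  have key0: "(LINT x|M. v x * g x * indicator A (X x)) = (LINT x|M. v x * g x) * measure N A"
    if [measurable]: "g \<in> borel_measurable M" and g: "\<And>x. \<bar>g x\<bar> \<le> 1"
      and g_eq: "\<And>x. complex_of_real (g x) = a * iexp (\<theta> x) + b * iexp (- \<theta> x)" for g a b
  proof -
    have i1: "integrable M v" "integrable M (\<lambda>x. v x * g x)"
      by (rule bddr; use v g in \<open>auto simp: abs_mult intro: vg order_trans[of _ 1]\<close>)+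
    have i2: "integrable M (\<lambda>x. v x * indicator A (X x))" "integrable M (\<lambda>x. v x * g x * indicator A (X x))"
      by (rule bddr; use v g in \<open>auto simp: abs_mult intro: vg order_trans[of _ 1] split: split_indicator\<close>)+
    have "(LINT x|M. v x * indicator A (X x)) = (LINT x|M. v x) * measure N A"
      using key[of "\<lambda>_. 0" 0 0] by simp
    moreover have "(LINT x|M. v x * indicator A (X x) + v x * g x * indicator A (X x))
      = (LINT x|M. v x + v x * g x) * measure N A"
      using key[OF that] by (simp add: algebra_simps)
    ultimately show ?thesis using i1 i2 by (simp add: algebra_simps)
  qed
  have c: "(LINT x|M. v x * cos (\<theta> x) * indicator A (X x)) = (LINT x|M. v x * cos (\<theta> x)) * measure N A"
    by (rule key0[of _ "1/2" "1/2"]) (auto simp: complex_eq_iff Re_exp Im_exp)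
  have s: "(LINT x|M. v x * sin (\<theta> x) * indicator A (X x)) = (LINT x|M. v x * sin (\<theta> x)) * measure N A"
    by (rule key0[of _ "-\<i>/2" "\<i>/2"]) (auto simp: complex_eq_iff Re_exp Im_exp)
  have parts: "(CLINT x|M. f x) = Complex (LINT x|M. Re (f x)) (LINT x|M. Im (f x))"
    if "integrable M f" for f
    using that by (simp add: complex_eq_iff integral_Re integral_Im)
  have v2: "\<bar>v x\<bar> \<le> 2" for x using v[of x] by simp
  have "integrable M (\<lambda>x. complex_of_real (v x) * iexp (\<theta> x) * indicator A (X x))"
    "integrable M (\<lambda>x. complex_of_real (v x) * iexp (\<theta> x))"
    by (auto intro!: bdd v2 simp: norm_mult split: split_indicator)
  note parts = this[THEN parts]
  have RI: "Re (complex_of_real (v x) * iexp (\<theta> x)) = v x * cos (\<theta> x)"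
    "Im (complex_of_real (v x) * iexp (\<theta> x)) = v x * sin (\<theta> x)"
    "Re (complex_of_real (v x) * iexp (\<theta> x) * indicator A (X x)) = v x * cos (\<theta> x) * indicator A (X x)"
    "Im (complex_of_real (v x) * iexp (\<theta> x) * indicator A (X x)) = v x * sin (\<theta> x) * indicator A (X x)" for x
    by (simp_all add: Re_exp Im_exp split: split_indicator)
  show ?thesis
    unfolding parts RI c s by (simp add: complex_eq_iff)
qed

text \<open>Coordinates are converted one at a time: the exponential in \<open>X k\<close> is
  replaced by the indicator of a Borel set, while all other coordinates stay in the weight. Once
  every coordinate is converted, what remains is the product formula for probabilities.\<close>

lemma (in prob_space) indep_vars_of_char_prod:
  fixes X :: "'i \<Rightarrow> 'a \<Rightarrow> real"
  assumes I: "finite I" "I \<noteq> {}"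
    and X[measurable]: "\<And>i. i \<in> I \<Longrightarrow> X i \<in> borel_measurable M"
    and char: "\<And>t. (CLINT x|M. iexp (\<Sum>i\<in>I. t i * X i x)) = (\<Prod>i\<in>I. char (distr M borel (X i)) (t i))"
  shows "indep_vars (\<lambda>_. borel) X I"
proof -
  have claim: "(CLINT x|M. complex_of_real (\<Prod>j\<in>J. indicator (A j) (X j x)) * iexp (\<Sum>i\<in>I - J. t i * X i x))
      = (\<Prod>j\<in>J. measure (distr M borel (X j)) (A j)) * (\<Prod>i\<in>I - J. char (distr M borel (X i)) (t i))"
    if "finite J" "J \<subseteq> I" and A: "\<And>i. i \<in> I \<Longrightarrow> A i \<in> sets borel" for J A t
    using that(1,2)
  proof (induction J arbitrary: t rule: finite_induct)
    case empty
    then show ?case using char by simp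
  next
    case (insert k J)
    have k: "k \<in> I" "k \<notin> J" and J: "J \<subseteq> I" and split: "I - J = insert k (I - insert k J)"
      using insert by auto
    have fin: "finite (I - insert k J)" using I by simp
    define v :: "'a \<Rightarrow> real" where "v x = (\<Prod>j\<in>J. indicator (A j) (X j x))" for x
    define \<theta> where "\<theta> x = (\<Sum>i\<in>I - insert k J. t i * X i x)" for x :: 'a
    have [measurable]: "X k \<in> borel_measurable M" using k by simp
    have [measurable]: "v \<in> borel_measurable M"
      unfolding v_def using J A X by (intro borel_measurable_prod borel_measurable_indicator') (auto intro: measurable_sets_borel)
    have [measurable]: "\<theta> \<in> borel_measurable M"
      unfolding \<theta>_def by (intro borel_measurable_sum borel_measurable_times borel_measurable_const X) auto
    have v: "0 \<le> v x" "v x \<le> 1" for x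
      unfolding v_def by (auto intro!: prod_nonneg prod_le_1 simp: indicator_def)
    have IH: "(CLINT x|M. v x * iexp (c * \<theta> x) * iexp (s * X k x))
      = (\<Prod>j\<in>J. measure (distr M borel (X j)) (A j)) *
        (\<Prod>i\<in>I - insert k J. char (distr M borel (X i)) (c * t i)) * char (distr M borel (X k)) s" for c s
    proof -
      \<comment> \<open>The one-dimensional uniqueness step needs every multiple \<open>c\<close> of
        the phase of the unconverted coordinates, so the induction hypothesis is used at scaled
        frequencies with the free value \<open>s\<close> at \<open>k\<close>.\<close>
      define t' where "t' i = (if i = k then s else c * t i)" for i
      have "(\<Sum>i\<in>I - J. t' i * X i x) = c * \<theta> x + s * X k x" for x
        unfolding split \<theta>_def using fin by (simp add: t'_def sum_distrib_left mult.assoc)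
      moreover have "(\<Prod>i\<in>I - J. char (distr M borel (X i)) (t' i))
        = (\<Prod>i\<in>I - insert k J. char (distr M borel (X i)) (c * t i)) * char (distr M borel (X k)) s"
        unfolding split using fin by (simp add: t'_def mult.commute)
      ultimately show ?thesis
        using insert.IH[OF J, of t'] unfolding v_def[symmetric]
        by (simp add: distrib_left exp_add mult.assoc)
    qed
    have N: "real_distribution (distr M borel (X k))" by simp
    interpret N: real_distribution "distr M borel (X k)" by (rule N)
    have IH0: "(CLINT x|M. v x * iexp (c * \<theta> x))
      = (\<Prod>j\<in>J. measure (distr M borel (X j)) (A j)) *
        (\<Prod>i\<in>I - insert k J. char (distr M borel (X i)) (c * t i))" for c
      using IH[of c 0] N.char_zero by simp
    have IH': "(CLINT x|M. v x * iexp (c * \<theta> x) * iexp (s * X k x))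
      = (CLINT x|M. v x * iexp (c * \<theta> x)) * char (distr M borel (X k)) s" for c s
      unfolding IH IH0 ..
    have "(CLINT x|M. v x * iexp (\<theta> x) * indicator (A k) (X k x))
      = (CLINT x|M. v x * iexp (\<theta> x)) * measure (distr M borel (X k)) (A k)"
      by (rule weighted_char_uniqueness_complex[OF _ _ _ v N IH']) (use A k in auto)
    also have "(CLINT x|M. v x * iexp (\<theta> x)) = (\<Prod>j\<in>J. measure (distr M borel (X j)) (A j)) *
        (\<Prod>i\<in>I - insert k J. char (distr M borel (X i)) (t i))"
      using IH0[of 1] by simp
    also have "(\<lambda>x. v x * iexp (\<theta> x) * indicator (A k) (X k x))
      = (\<lambda>x. complex_of_real (\<Prod>j\<in>insert k J. indicator (A j) (X j x)) * iexp (\<Sum>i\<in>I - insert k J. t i * X i x))"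
      using insert.hyps by (auto simp: v_def \<theta>_def fun_eq_iff split: split_indicator)
    finally show ?case
      using insert.hyps by (simp add: mult_ac)
  qed
  show ?thesis
  proof (subst indep_vars_finite[where E = "\<lambda>_. sets borel"])
    show "\<forall>A\<in>I \<rightarrow> sets borel. prob (\<Inter>j\<in>I. X j -` A j \<inter> space M) = (\<Prod>j\<in>I. prob (X j -` A j \<inter> space M))"
    proof
      fix A :: "'i \<Rightarrow> real set" assume "A \<in> I \<rightarrow> sets borel"
      then have A: "\<And>i. i \<in> I \<Longrightarrow> A i \<in> sets borel" by auto
      have "complex_of_real (LINT x|M. (\<Prod>j\<in>I. indicator (A j) (X j x) :: real)) = (\<Prod>j\<in>I. measure (distr M borel (X j)) (A j))"
        using claim[OF I(1) subset_refl A] by (simp flip: integral_complex_of_real)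
      then have "(LINT x|M. (\<Prod>j\<in>I. indicator (A j) (X j x) :: real)) = (\<Prod>j\<in>I. measure (distr M borel (X j)) (A j))"
        by (simp flip: of_real_prod)
      moreover define E where "E = (\<Inter>j\<in>I. X j -` A j \<inter> space M)"
      have "(LINT x|M. (\<Prod>j\<in>I. indicator (A j) (X j x) :: real)) = (LINT x|M. indicator E x)"
        using I by (intro Bochner_Integration.integral_cong refl) (auto simp: E_def indicator_def prod_zero_iff)
      moreover have "E \<subseteq> space M" using I(2) by (auto simp: E_def)
      ultimately show "prob (\<Inter>j\<in>I. X j -` A j \<inter> space M) = (\<Prod>j\<in>I. prob (X j -` A j \<inter> space M))"
        using A unfolding E_def[symmetric] by (simp add: measure_distr Int_absorb2 cong: prod.cong)
    qed
  qed (use I X in \<open>auto simp: sets.Int_stable sets.sigma_sets_eq[of borel, simplified]\<close>)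
qed

section \<open>Moments of Gaussian quadratic forms\<close>

lemma integrable_poly_std_normal: "integrable std_normal_distribution (poly q)"
  unfolding poly_altdef by (intro Bochner_Integration.integrable_sum integrable_mult_right integrable_std_normal_distribution_moment)

lemma integrable_times_poly_std_normal: "integrable std_normal_distribution (\<lambda>x. x * poly q x)"
proof -
  have "(\<lambda>x. x * poly q x) = poly (pCons 0 q)" by (simp add: fun_eq_iff)
  then show ?thesis by (simp only: integrable_poly_std_normal)
qed

lemma std_normal_moment_Suc_Suc:
  "(LINT x|std_normal_distribution. x ^ Suc (Suc n)) = real (Suc n) * (LINT x|std_normal_distribution. x ^ n)"
proof (cases "even n")
  case True
  then obtain k where k: "n = 2 * k" by blast
  have "(LINT x|std_normal_distribution. x ^ Suc (Suc n)) = fact (2 * Suc k) / (2 ^ Suc k * fact (Suc k))"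
    unfolding std_normal_distribution_even_moments(1)[symmetric] by (simp add: k)
  also have "\<dots> = (2 * real (Suc k) * (real (Suc (2 * k)) * fact (2 * k))) / (2 * real (Suc k) * (2 ^ k * fact k))"
    by (simp add: algebra_simps)
  also have "\<dots> = real (Suc (2 * k)) * fact (2 * k) / (2 ^ k * fact k)"
    by (rule mult_divide_mult_cancel_left) simp
  finally show ?thesis
    by (simp add: k std_normal_distribution_even_moments(1) del: power_Suc)
qed (simp only: integral_std_normal_distribution_moment_odd even_Suc simp_thms mult_zero_right)

text \<open>Stein's identity on polynomials. The constant coefficient contributes an odd moment,
  which is zero; what is left has the form \<open>x * (x * q)\<close>, where the identity is the
  two-step recursion of the Gaussian moments applied to each coefficient.\<close>

lemma std_normal_integration_by_parts:
  "(LINT x|std_normal_distribution. x * poly q x) = (LINT x|std_normal_distribution. poly (pderiv q) x)"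
proof (induction q)
  case (pCons a q)
  have eq: "x * poly (pCons a q) x = a * x ^ 1 + x * (x * poly q x)"
    "poly (pderiv (pCons a q)) x = poly q x + x * poly (pderiv q) x" for x
    by (simp_all add: pderiv_pCons algebra_simps)
  have "(LINT x|std_normal_distribution. x * (x * poly p x))
      = (LINT x|std_normal_distribution. poly p x) + (LINT x|std_normal_distribution. x * poly (pderiv p) x)" for p
  proof -
    have i: "integrable std_normal_distribution (\<lambda>x. coeff p n * x ^ Suc (Suc n))"
      "integrable std_normal_distribution (\<lambda>x. coeff p n * x ^ n)" for n
      by (intro integrable_mult_right integrable_std_normal_distribution_moment)+
    have "x * (x * poly p x) = (\<Sum>n\<le>degree p. coeff p n * x ^ Suc (Suc n))" for x
      by (simp add: poly_altdef sum_distrib_left mult_ac)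
    moreover have "poly p x + x * poly (pderiv p) x = (\<Sum>n\<le>degree p. real (Suc n) * (coeff p n * x ^ n))" for x
    proof -
      have "degree (pderiv (pCons 0 p)) = degree p" by (simp add: degree_pderiv)
      then show ?thesis
        using poly_altdef[of "pderiv (pCons 0 p)" x]
        by (simp add: coeff_pderiv mult.assoc) (simp add: pderiv_pCons)
    qed
    moreover have "(LINT x|std_normal_distribution. poly p x) + (LINT x|std_normal_distribution. x * poly (pderiv p) x)
       = (LINT x|std_normal_distribution. poly p x + x * poly (pderiv p) x)"
      by (intro Bochner_Integration.integral_add[symmetric] integrable_poly_std_normal integrable_times_poly_std_normal)
    ultimately show ?thesis
      using i by (simp add: Bochner_Integration.integral_sum std_normal_moment_Suc_Suc mult_ac del: power_Suc)
  qed
  note shift = this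
  have "(LINT x|std_normal_distribution. x * poly (pCons a q) x)
      = (LINT x|std_normal_distribution. a * x ^ 1) + (LINT x|std_normal_distribution. x * (x * poly q x))"
    unfolding eq using integrable_times_poly_std_normal[of "pCons 0 q"]
    by (intro Bochner_Integration.integral_add integrable_mult_right integrable_std_normal_distribution_moment) simp
  also have "(LINT x|std_normal_distribution. a * x ^ 1) = 0"
    using integral_std_normal_distribution_moment_odd[of 1] by simp
  also have "0 + (LINT x|std_normal_distribution. x * (x * poly q x))
      = (LINT x|std_normal_distribution. poly (pderiv (pCons a q)) x)"
    unfolding eq add_0_left shift
    by (intro Bochner_Integration.integral_add[symmetric] integrable_poly_std_normal integrable_times_poly_std_normal)
  finally show ?case .
qed simp

text \<open>Stein's identity for \<open>x * Z ^ n\<close>, with \<open>Z\<close> the scaled centred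
  square, gives a two-term recursion for the moments of \<open>Z\<close>. It coincides with the
  recursion for geometric cumulants.\<close>

lemma cmoment_gaussian_square:
  "(LINT x|std_normal_distribution. (y / 2 * (x\<^sup>2 - 1)) ^ n) = cmoment (\<lambda>j. y ^ (j + 2) / 2) n"
proof -
  interpret N: real_distribution std_normal_distribution by (rule real_dist_normal_dist)
  define Z where "Z = [:- (y / 2), 0, y / 2:]"
  have pZ: "poly Z x = y / 2 * (x\<^sup>2 - 1)" for x
    by (simp add: Z_def power2_eq_square algebra_simps)
  have dZ: "pderiv Z = [:0, y:]" by (simp add: Z_def pderiv_pCons)
  have int: "integrable std_normal_distribution (\<lambda>x. c * poly p x)" for c p
    using integrable_poly_std_normal by (rule integrable_mult_right)
  define e where "e n = (LINT x|std_normal_distribution. poly (Z ^ n) x)" for n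
  \<comment> \<open>The truncated \<open>n - 1\<close> is harmless at \<open>n = 0\<close>, where
    its coefficient vanishes.\<close>
  have step: "e (Suc n) = real n * y * e n + real n * (y\<^sup>2 / 2) * e (n - 1)" for n
  proof -
    have "e (Suc n) = (LINT x|std_normal_distribution. (y / 2) * (x * poly ([:0, 1:] * Z ^ n) x) - (y / 2) * poly (Z ^ n) x)"
      unfolding e_def by (intro Bochner_Integration.integral_cong refl) (simp only: power_Suc poly_mult pZ, simp add: power2_eq_square field_simps)
    also have "\<dots> = (y / 2) * (LINT x|std_normal_distribution. x * poly ([:0, 1:] * Z ^ n) x) - (y / 2) * e n"
      using int[of "y/2" "[:0, 0, 1:] * Z ^ n"] int[of "y/2" "Z ^ n"] by (simp add: e_def mult.assoc)
    also have "(LINT x|std_normal_distribution. x * poly ([:0, 1:] * Z ^ n) x)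
      = (LINT x|std_normal_distribution. poly (Z ^ n) x + real n * (2 * poly (Z ^ n) x + y * poly (Z ^ (n - 1)) x))"
      unfolding std_normal_integration_by_parts
    proof (intro Bochner_Integration.integral_cong refl)
      fix x
      show "poly (pderiv ([:0, 1:] * Z ^ n)) x = poly (Z ^ n) x + real n * (2 * poly (Z ^ n) x + y * poly (Z ^ (n - 1)) x)"
      proof (cases n)
        case (Suc k)
        \<comment> \<open>This relation eliminates the last factor \<open>x^2\<close> and leaves
          only powers of \<open>Z\<close>.\<close>
        have "y * x\<^sup>2 = 2 * poly Z x + y" by (simp add: pZ algebra_simps)
        then have "(y * x\<^sup>2) * poly Z x ^ k = (2 * poly Z x + y) * poly Z x ^ k" by (rule arg_cong)
        then have "x * (x * (y * poly Z x ^ k)) = y * poly Z x ^ k + 2 * (poly Z x * poly Z x ^ k)"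
          by (simp only: power2_eq_square mult_ac distrib_left distrib_right add_ac)
        then show ?thesis
          by (simp add: Suc pderiv_mult pderiv_power_Suc pderiv_pCons dZ del: power_Suc) (simp add: algebra_simps power2_eq_square)
      qed (simp add: pderiv_pCons)
    qed
    also have "\<dots> = e n + real n * (2 * e n + y * e (n - 1))"
    proof -
      have "integrable std_normal_distribution (\<lambda>x. poly Z x ^ m)" for m
        by (simp only: poly_power[symmetric] integrable_poly_std_normal)
      then show ?thesis by (simp add: e_def)
    qed
    finally show ?thesis by (simp add: algebra_simps power2_eq_square)
  qed
  have "e n = cmoment (\<lambda>j. y ^ (j + 2) / 2) n"
  proof (induction n rule: less_induct)
    case (less n)
    consider "n = 0" | "n = 1" | k where "n = Suc (Suc k)" by (metis One_nat_def not0_implies_Suc)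
    then show ?case
    proof cases
      case 1 then show ?thesis using N.prob_space by (simp add: e_def)
    next
      case 2 then show ?thesis using step[of 0] by simp
    next
      case 3
      then show ?thesis
        using step[of "Suc k"] less[of "Suc k"] less[of k] cmoment_geometric_rec[of y k]
        by (simp del: cmoment.simps)
    qed
  qed
  then show ?thesis by (simp add: e_def pZ)
qed

text \<open>Including one more independent square adds its geometric cumulants to the power sums:
  the binomial expansion of the new power is exactly the right-hand side of
  \<open>cmoment_add\<close>.\<close>

lemma (in prob_space) moments_quadratic_form:
  fixes X :: "'i \<Rightarrow> 'a \<Rightarrow> real"
  assumes "finite I" "indep_vars (\<lambda>_. borel) X I"
    and "\<And>i. i \<in> I \<Longrightarrow> distr M borel (X i) = std_normal_distribution"
  shows "integrable M (\<lambda>\<omega>. (\<Sum>i\<in>I. y i / 2 * ((X i \<omega>)\<^sup>2 - 1)) ^ n) \<and>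
    expectation (\<lambda>\<omega>. (\<Sum>i\<in>I. y i / 2 * ((X i \<omega>)\<^sup>2 - 1)) ^ n) = cmoment (\<lambda>j. power_sum I y (j + 2) / 2) n"
  using assms
proof (induction I arbitrary: n rule: finite_induct)
  case empty
  have "cmoment (\<lambda>j. 0) n = 0 ^ n" by (cases n) simp_all
  then show ?case by (simp add: power_sum_def power_0_left prob_space)
next
  case (insert i I)
  define Z where "Z k \<omega> = y k / 2 * ((X k \<omega>)\<^sup>2 - 1)" for k \<omega>
  define S where "S \<omega> = (\<Sum>k\<in>I. Z k \<omega>)" for \<omega>
  have [measurable]: "X i \<in> borel_measurable M"
    using insert.prems(1) by (auto simp: indep_vars_def)
  have IH: "integrable M (\<lambda>\<omega>. S \<omega> ^ n)" "expectation (\<lambda>\<omega>. S \<omega> ^ n) = cmoment (\<lambda>j. power_sum I y (j + 2) / 2) n" for n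
    using insert.IH[of n] indep_vars_subset[OF insert.prems(1)] insert.prems(2) by (auto simp: S_def Z_def)
  have [measurable]: "poly q \<in> borel_measurable borel" for q :: "real poly"
    by (rule borel_measurable_continuous_onI) (simp add: continuous_at_imp_continuous_on)
  have Z1: "integrable M (\<lambda>\<omega>. Z i \<omega> ^ n)" "expectation (\<lambda>\<omega>. Z i \<omega> ^ n) = cmoment (\<lambda>j. y i ^ (j + 2) / 2) n" for n
  proof -
    have "integrable (distr M borel (X i)) (poly ([:- (y i / 2), 0, y i / 2:] ^ n))"
      using insert.prems(2)[of i] integrable_poly_std_normal by simp
    then show "integrable M (\<lambda>\<omega>. Z i \<omega> ^ n)"
      by (subst (asm) integrable_distr_eq) (auto simp: Z_def power2_eq_square algebra_simps)
    have "expectation (\<lambda>\<omega>. Z i \<omega> ^ n) = (LINT x|distr M borel (X i). (y i / 2 * (x\<^sup>2 - 1)) ^ n)"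
      by (subst integral_distr) (auto simp: Z_def)
    then show "expectation (\<lambda>\<omega>. Z i \<omega> ^ n) = cmoment (\<lambda>j. y i ^ (j + 2) / 2) n"
      using insert.prems(2)[of i] cmoment_gaussian_square by simp
  qed
  have "indep_vars (\<lambda>_. borel) (\<lambda>k \<omega>. y k / 2 * ((X k \<omega>)\<^sup>2 - 1)) (insert i I)"
    by (rule indep_vars_compose2[OF insert.prems(1)]) simp
  then have "indep_vars (\<lambda>_. borel) Z (insert i I)"
    by (simp add: Z_def[abs_def])
  then have "indep_var borel (Z i) borel S"
    using indep_vars_sum[OF insert.hyps(1,2)] by (simp add: S_def[abs_def])
  then have ind: "indep_var borel (\<lambda>\<omega>. Z i \<omega> ^ k) borel (\<lambda>\<omega>. S \<omega> ^ l)" for k l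
    using indep_var_compose[of borel "Z i" borel S "\<lambda>x. x ^ k" borel "\<lambda>x. x ^ l" borel] by (simp add: comp_def)
  have sum: "(\<Sum>k\<in>insert i I. y k / 2 * ((X k \<omega>)\<^sup>2 - 1)) ^ n
    = (\<Sum>k\<le>n. of_nat (n choose k) * (Z i \<omega> ^ k * S \<omega> ^ (n - k)))" for \<omega>
  proof -
    have "(\<Sum>k\<in>insert i I. y k / 2 * ((X k \<omega>)\<^sup>2 - 1)) = Z i \<omega> + S \<omega>"
      using insert.hyps by (simp add: S_def Z_def)
    then show ?thesis by (simp add: binomial_ring mult.assoc)
  qed
  have int: "integrable M (\<lambda>\<omega>. of_nat (n choose k) * (Z i \<omega> ^ k * S \<omega> ^ (n - k)))" for k
    by (intro integrable_mult_right indep_var_integrable ind Z1 IH)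
  have "expectation (\<lambda>\<omega>. \<Sum>k\<le>n. of_nat (n choose k) * (Z i \<omega> ^ k * S \<omega> ^ (n - k)))
     = (\<Sum>k\<le>n. of_nat (n choose k) * (cmoment (\<lambda>j. y i ^ (j + 2) / 2) k * cmoment (\<lambda>j. power_sum I y (j + 2) / 2) (n - k)))"
    by (subst Bochner_Integration.integral_sum[OF int])
      (simp only: integral_mult_right_zero indep_var_lebesgue_integral[OF ind Z1(1) IH(1)] Z1(2) IH(2))
  also have "\<dots> = cmoment (\<lambda>j. y i ^ (j + 2) / 2 + power_sum I y (j + 2) / 2) n"
    by (simp add: cmoment_add mult.assoc)
  also have "(\<lambda>j. y i ^ (j + 2) / 2 + power_sum I y (j + 2) / 2) = (\<lambda>j. power_sum (insert i I) y (j + 2) / 2)"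
    using insert.hyps by (simp add: power_sum_def fun_eq_iff add_divide_distrib)
  finally show ?case
    unfolding sum using int by (auto intro: Bochner_Integration.integrable_sum)
qed

section \<open>Isonormal Gaussian processes\<close>

lemma (in prob_space)
  assumes "centered_gaussian M X"
  shows centered_gaussian_integrable_power: "integrable M (\<lambda>\<omega>. X \<omega> ^ k)"
    and centered_gaussian_char: "(CLINT \<omega>|M. iexp (X \<omega>)) = exp (- expectation (\<lambda>\<omega>. (X \<omega>)\<^sup>2) / 2)"
proof -
  have [measurable]: "X \<in> borel_measurable M" using assms by (simp add: centered_gaussian_def)
  consider "AE \<omega> in M. X \<omega> = 0" | \<sigma> where "\<sigma> > 0" "distributed M lborel X (normal_density 0 \<sigma>)"
    using assms unfolding centered_gaussian_def by blast
  then have "integrable M (\<lambda>\<omega>. X \<omega> ^ k) \<and>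
    (CLINT \<omega>|M. iexp (X \<omega>)) = exp (- expectation (\<lambda>\<omega>. (X \<omega>)\<^sup>2) / 2)"
  proof cases
    case 1
    have "integrable M (\<lambda>\<omega>. X \<omega> ^ k) \<longleftrightarrow> integrable M (\<lambda>\<omega>. (0::real) ^ k)"
      using 1 by (intro integrable_cong_AE) auto
    moreover have "(CLINT \<omega>|M. iexp (X \<omega>)) = (CLINT \<omega>|M. 1)"
      using 1 by (intro integral_cong_AE) auto
    moreover have "expectation (\<lambda>\<omega>. (X \<omega>)\<^sup>2) = (LINT \<omega>|M. 0)"
      using 1 by (intro integral_cong_AE) auto
    ultimately show ?thesis by (simp add: prob_space)
  next
    case (2 \<sigma>)
    define N where "N \<omega> = X \<omega> / \<sigma>" for \<omega>
    have [measurable]: "N \<in> borel_measurable M" by (simp add: N_def[abs_def])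
    have "distributed M lborel N std_normal_density"
      using 2 normal_standard_normal_convert[of \<sigma> X 0] by (simp add: N_def[abs_def])
    then have "distr M lborel N = std_normal_distribution" by (simp add: distributed_def)
    moreover have "distr M lborel N = distr M borel N" by (rule distr_cong) auto
    ultimately have N: "distr M borel N = std_normal_distribution" by simp
    have X: "X \<omega> = \<sigma> * N \<omega>" for \<omega> using 2 by (simp add: N_def)
    have "integrable M (\<lambda>\<omega>. N \<omega> ^ k)"
      using integrable_std_normal_distribution_moment[of k] unfolding N[symmetric]
      by (subst (asm) integrable_distr_eq) auto
    moreover have "(CLINT \<omega>|M. iexp (X \<omega>)) = char (distr M borel N) \<sigma>"
      unfolding char_def by (subst integral_distr) (auto simp: X)
    moreover have "expectation (\<lambda>\<omega>. (N \<omega>)\<^sup>2) = 1"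
    proof -
      have "expectation (\<lambda>\<omega>. (N \<omega>)\<^sup>2) = (LINT x|std_normal_distribution. x ^ (2 * 1))"
        unfolding N[symmetric] by (subst integral_distr) auto
      then show ?thesis by (simp only: std_normal_distribution_even_moments) simp
    qed
    ultimately show ?thesis
      by (simp add: X power_mult_distrib N char_std_normal_distribution)
  qed
  then show "integrable M (\<lambda>\<omega>. X \<omega> ^ k)"
    "(CLINT \<omega>|M. iexp (X \<omega>)) = exp (- expectation (\<lambda>\<omega>. (X \<omega>)\<^sup>2) / 2)" by auto
qed

locale isonormal = prob_space M
  for M :: "'a measure" and W :: "'h::{real_inner,polish_space} \<Rightarrow> 'a \<Rightarrow> real" +
  assumes isonormal: "isonormal_gaussian_process M W"
begin

lemma gaussian_sum: "finite S \<Longrightarrow> centered_gaussian M (\<lambda>\<omega>. \<Sum>h\<in>S. c h * W h \<omega>)"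
  using isonormal by (simp add: isonormal_gaussian_process_def)

lemma covariance: "expectation (\<lambda>\<omega>. W g \<omega> * W h \<omega>) = g \<bullet> h"
  using isonormal by (simp add: isonormal_gaussian_process_def)

lemma centered_gaussian_W: "centered_gaussian M (W h)"
  using gaussian_sum[of "{h}" "\<lambda>_. 1"] by simp

lemma W_measurable[measurable]: "W h \<in> borel_measurable M"
  using centered_gaussian_W[of h] by (simp add: centered_gaussian_def)

lemma integrable_W_power: "integrable M (\<lambda>\<omega>. W h \<omega> ^ k)"
  using centered_gaussian_W by (rule centered_gaussian_integrable_power)

lemma integrable_W_mult: "integrable M (\<lambda>\<omega>. W g \<omega> * W h \<omega>)"
proof (rule Bochner_Integration.integrable_bound)
  show "integrable M (\<lambda>\<omega>. (W g \<omega>) ^ 2 + (W h \<omega>) ^ 2)"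
    by (intro Bochner_Integration.integrable_add integrable_W_power)
  show "AE \<omega> in M. norm (W g \<omega> * W h \<omega>) \<le> norm ((W g \<omega>) ^ 2 + (W h \<omega>) ^ 2)"
  proof (intro AE_I2)
    fix \<omega>
    have "2 * (\<bar>W g \<omega>\<bar> * \<bar>W h \<omega>\<bar>) \<le> (W g \<omega>)\<^sup>2 + (W h \<omega>)\<^sup>2"
      using sum_squares_bound[of "\<bar>W g \<omega>\<bar>" "\<bar>W h \<omega>\<bar>"] by (simp add: mult.assoc)
    moreover have "0 \<le> \<bar>W g \<omega>\<bar> * \<bar>W h \<omega>\<bar>" by simp
    moreover have "norm (W g \<omega> * W h \<omega>) = \<bar>W g \<omega>\<bar> * \<bar>W h \<omega>\<bar>" by (simp add: abs_mult)
    moreover have "norm ((W g \<omega>) ^ 2 + (W h \<omega>) ^ 2) = (W g \<omega>)\<^sup>2 + (W h \<omega>)\<^sup>2" by simp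
    ultimately show "norm (W g \<omega> * W h \<omega>) \<le> norm ((W g \<omega>) ^ 2 + (W h \<omega>) ^ 2)"
      by linarith
  qed
qed simp

lemma variance_sum:
  assumes "finite S"
  shows "expectation (\<lambda>\<omega>. (\<Sum>h\<in>S. c h * W h \<omega>)\<^sup>2) = (norm (\<Sum>h\<in>S. c h *\<^sub>R h))\<^sup>2"
proof -
  have "(\<Sum>h\<in>S. c h * W h \<omega>)\<^sup>2 = (\<Sum>g\<in>S. \<Sum>h\<in>S. c g * c h * (W g \<omega> * W h \<omega>))" for \<omega>
    by (simp add: power2_eq_square sum_product mult_ac)
  moreover have "expectation (\<lambda>\<omega>. \<Sum>g\<in>S. \<Sum>h\<in>S. c g * c h * (W g \<omega> * W h \<omega>))
      = (\<Sum>g\<in>S. \<Sum>h\<in>S. c g * c h * (g \<bullet> h))"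
    by (simp add: integrable_W_mult covariance)
  ultimately show ?thesis
    by (simp add: power2_norm_eq_inner inner_sum_left inner_sum_right sum_distrib_left mult.assoc)
      (intro sum.cong refl, simp add: inner_commute)
qed

lemma char_sum:
  assumes "finite S"
  shows "(CLINT \<omega>|M. iexp (\<Sum>h\<in>S. c h * W h \<omega>)) = exp (- (norm (\<Sum>h\<in>S. c h *\<^sub>R h))\<^sup>2 / 2)"
  using centered_gaussian_char[OF gaussian_sum[OF assms], of c] by (simp only: variance_sum[OF assms])

text \<open>Linearity of \<open>W\<close> is a consequence of the covariance: the difference of the
  two sides has second moment zero.\<close>

lemma AE_W_linear:
  assumes "finite S" and h: "h = (\<Sum>e\<in>S. a e *\<^sub>R e)"
  shows "AE \<omega> in M. W h \<omega> = (\<Sum>e\<in>S. a e * W e \<omega>)"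
proof -
  \<comment> \<open>\<open>h\<close> may itself lie in \<open>S\<close>, so its coefficient has to
    combine both contributions.\<close>
  define c where "c g = (if g = h then 1 else 0) - (if g \<in> S then a g else 0)" for g
  define D where "D \<omega> = (\<Sum>g\<in>insert h S. c g * W g \<omega>)" for \<omega>
  have fin: "finite (insert h S)" using assms by simp
  have ins: "(\<Sum>g\<in>insert h S. (if g \<in> S then f g else 0)) = sum f S"
    "(\<Sum>g\<in>insert h S. (if g = h then f g else 0)) = f h"
    for f :: "'h \<Rightarrow> 'b::comm_monoid_add"
    using fin by (simp_all add: sum.If_cases Int_absorb1 subset_insertI)
  have D_eq: "D \<omega> = W h \<omega> - (\<Sum>e\<in>S. a e * W e \<omega>)" for \<omega>
  proof -
    have "D \<omega> = (\<Sum>g\<in>insert h S. (if g = h then W g \<omega> else 0) - (if g \<in> S then a g * W g \<omega> else 0))"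
      unfolding D_def by (intro sum.cong refl) (simp add: c_def left_diff_distrib)
    then show ?thesis by (simp only: sum_subtractf ins)
  qed
  have "(\<Sum>g\<in>insert h S. c g *\<^sub>R g) = (\<Sum>g\<in>insert h S. (if g = h then g else 0) - (if g \<in> S then a g *\<^sub>R g else 0))"
    by (intro sum.cong refl) (simp add: c_def scaleR_left_diff_distrib)
  also have "\<dots> = 0" by (simp only: sum_subtractf ins) (use h in simp)
  finally have "expectation (\<lambda>\<omega>. (D \<omega>)\<^sup>2) = 0"
    unfolding D_def variance_sum[OF fin] by simp
  moreover have "integrable M (\<lambda>\<omega>. (D \<omega>)\<^sup>2)"
    unfolding D_def by (intro centered_gaussian_integrable_power gaussian_sum fin)
  ultimately have "AE \<omega> in M. (D \<omega>)\<^sup>2 = 0"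
    by (subst (asm) integral_nonneg_eq_0_iff_AE) auto
  then show ?thesis by eventually_elim (simp add: D_eq)
qed

lemma norm_sum_orthonormal:
  assumes "finite S" "orthonormal S"
  shows "(norm (\<Sum>e\<in>S. c e *\<^sub>R e))\<^sup>2 = (\<Sum>e\<in>S. (c e)\<^sup>2)"
proof -
  have "(norm (\<Sum>e\<in>S. c e *\<^sub>R e))\<^sup>2 = (\<Sum>e\<in>S. (norm (c e *\<^sub>R e))\<^sup>2)"
    using assms by (intro norm_sum_Pythagorean)
      (auto simp: orthonormal_def pairwise_def orthogonal_def)
  then show ?thesis using assms by (simp add: orthonormal_def power_mult_distrib)
qed

lemma distr_W_unit:
  assumes "norm e = 1"
  shows "distr M borel (W e) = std_normal_distribution"
proof (rule Levy_uniqueness)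
  show "char (distr M borel (W e)) = char std_normal_distribution"
  proof
    fix t
    have "char (distr M borel (W e)) t = (CLINT \<omega>|M. iexp (\<Sum>h\<in>{e}. t * W h \<omega>))"
      unfolding char_def by (subst integral_distr) auto
    then show "char (distr M borel (W e)) t = char std_normal_distribution t"
      using assms by (subst (asm) char_sum) (auto simp: char_std_normal_distribution power_mult_distrib)
  qed
qed (auto intro: real_dist_normal_dist)

text \<open>The joint characteristic function depends only on the norm of a linear combination, and
  Pythagoras turns the exponential of its square into a product over the orthonormal set.\<close>

lemma indep_vars_orthonormal:
  assumes "finite S" "orthonormal S"
  shows "indep_vars (\<lambda>_. borel) W S"
proof (cases "S = {}")
  case False
  show ?thesis
  proof (rule indep_vars_of_char_prod)
    fix t
    have "(\<Prod>e\<in>S. char (distr M borel (W e)) (t e)) = (\<Prod>e\<in>S. complex_of_real (exp (- ((t e)\<^sup>2) / 2)))"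
      using assms by (intro prod.cong) (auto simp: orthonormal_def distr_W_unit char_std_normal_distribution)
    also have "\<dots> = exp (- (\<Sum>e\<in>S. (t e)\<^sup>2) / 2)"
    proof -
      have "(\<Prod>e\<in>S. exp (- ((t e)\<^sup>2) / 2)) = exp (\<Sum>e\<in>S. - ((t e)\<^sup>2) / 2)"
        using assms(1) by (simp only: exp_sum)
      also have "(\<Sum>e\<in>S. - ((t e)\<^sup>2) / 2) = - (\<Sum>e\<in>S. (t e)\<^sup>2) / 2"
        by (simp add: sum_negf sum_divide_distrib)
      finally show ?thesis by (simp only: flip: of_real_prod)
    qed
    finally show "(CLINT \<omega>|M. iexp (\<Sum>e\<in>S. t e * W e \<omega>)) = (\<Prod>e\<in>S. char (distr M borel (W e)) (t e))"
      using assms by (simp only: char_sum norm_sum_orthonormal)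
  qed (use assms False in auto)
qed (simp add: indep_vars_def2 indep_sets_def)

lemma moments_orthonormal:
  assumes "finite S" "orthonormal S"
  shows "integrable M (\<lambda>\<omega>. (\<Sum>e\<in>S. y e / 2 * ((W e \<omega>)\<^sup>2 - 1)) ^ n)"
    and "expectation (\<lambda>\<omega>. (\<Sum>e\<in>S. y e / 2 * ((W e \<omega>)\<^sup>2 - 1)) ^ n)
      = cmoment (\<lambda>j. power_sum S y (j + 2) / 2) n"
  using moments_quadratic_form[OF assms(1) indep_vars_orthonormal[OF assms]] assms(2)
  by (auto simp: orthonormal_def distr_W_unit)

end

section \<open>Diagonalisation of simple double integrals\<close>

text \<open>The ambient space may have infinite dimension, so compactness is drawn from the
  coefficients: each further vector gives a continuous image of the product with a compact
  interval.\<close>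

lemma compact_box_combinations:
  fixes S :: "'h::real_normed_vector set"
  assumes "finite S"
  shows "compact {\<Sum>e\<in>S. c e *\<^sub>R e |c. \<forall>e\<in>S. \<bar>c e\<bar> \<le> 1}"
  using assms
proof (induction S rule: finite_induct)
  case (insert b S)
  let ?K = "\<lambda>S. {\<Sum>e\<in>S. c e *\<^sub>R e |c. \<forall>e\<in>S. \<bar>c e\<bar> \<le> 1}"
  have "?K (insert b S) = (\<lambda>(t, k). t *\<^sub>R b + k) ` ({- 1..1} \<times> ?K S)"
  proof (intro set_eqI iffI)
    fix x assume "x \<in> ?K (insert b S)"
    then obtain c where c: "x = (\<Sum>e\<in>insert b S. c e *\<^sub>R e)" "\<forall>e\<in>insert b S. \<bar>c e\<bar> \<le> 1" by blast
    have "x = (\<lambda>(t, k). t *\<^sub>R b + k) (c b, \<Sum>e\<in>S. c e *\<^sub>R e)"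
      using c(1) insert.hyps by simp
    moreover have "c b \<in> {- 1..1}" using c(2) by (auto simp: abs_le_iff)
    moreover have "(\<Sum>e\<in>S. c e *\<^sub>R e) \<in> ?K S" using c(2) by blast
    ultimately show "x \<in> (\<lambda>(t, k). t *\<^sub>R b + k) ` ({- 1..1} \<times> ?K S)"
      by (intro image_eqI[where x = "(c b, \<Sum>e\<in>S. c e *\<^sub>R e)"] SigmaI)
  next
    fix x assume "x \<in> (\<lambda>(t, k). t *\<^sub>R b + k) ` ({- 1..1} \<times> ?K S)"
    then obtain t c where t: "x = t *\<^sub>R b + (\<Sum>e\<in>S. c e *\<^sub>R e)" "\<bar>t\<bar> \<le> 1" "\<forall>e\<in>S. \<bar>c e\<bar> \<le> 1"
      by (auto simp: abs_le_iff)
    define c' where "c' = c(b := t)"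
    have "(\<Sum>e\<in>S. c' e *\<^sub>R e) = (\<Sum>e\<in>S. c e *\<^sub>R e)"
      using insert.hyps by (intro sum.cong) (auto simp: c'_def)
    then have "x = (\<Sum>e\<in>insert b S. c' e *\<^sub>R e)" "\<forall>e\<in>insert b S. \<bar>c' e\<bar> \<le> 1"
      using t insert.hyps by (auto simp: c'_def)
    then show "x \<in> ?K (insert b S)" by blast
  qed
  moreover have "continuous_on ({- 1..1} \<times> ?K S) (\<lambda>(t, k). t *\<^sub>R b + k)"
    unfolding split_beta by (intro continuous_intros)
  ultimately show ?case
    using insert.IH by (simp only:) (intro compact_continuous_image compact_Times compact_Icc)
qed simp

lemma orthonormal_expand:
  assumes "finite S" "orthonormal S" "x \<in> span S"
  shows "(\<Sum>e\<in>S. (x \<bullet> e) *\<^sub>R e) = x"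
  using assms by (intro orthonormal_basis_expand) (auto simp: orthonormal_def)

text \<open>The bound on the cardinality serves the induction on the number of generators in
  \<open>symmetric_bilinear_diagonalization\<close>.\<close>

lemma exists_orthonormal_span:
  fixes X :: "'h::real_inner set"
  assumes "finite X"
  shows "\<exists>B. finite B \<and> orthonormal B \<and> card B \<le> card X \<and> span B = span X"
proof -
  obtain C where C: "finite C" "card C \<le> card X" "span C = span X" "pairwise orthogonal C"
    using basis_orthogonal[OF assms] by blast
  define B where "B = (\<lambda>b. (1 / norm b) *\<^sub>R b) ` (C - {0})"
  have "card B \<le> card (C - {0})" unfolding B_def using C by (intro card_image_le) simp
  also have "\<dots> \<le> card C" using C by (intro card_mono) auto
  finally have "card B \<le> card X" using C by simp
  moreover have "orthonormal B"
    using C(4) by (auto simp: orthonormal_def B_def pairwise_def orthogonal_def)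
  moreover have "span B = span C"
  proof
    show "span B \<subseteq> span C"
      by (intro span_minimal) (auto simp: B_def intro: span_scale span_base)
    show "span C \<subseteq> span B"
    proof (intro span_minimal subsetI)
      fix b assume b: "b \<in> C"
      show "b \<in> span B"
      proof (cases "b = 0")
        case False
        then have "(1 / norm b) *\<^sub>R b \<in> span B" using b by (intro span_base) (auto simp: B_def)
        then have "norm b *\<^sub>R ((1 / norm b) *\<^sub>R b) \<in> span B" by (rule span_scale)
        with False show ?thesis by simp
      qed (simp add: span_zero)
    qed simp
  qed
  moreover have "finite B" using C by (simp add: B_def)
  ultimately show ?thesis using C(3) by (intro exI[of _ B]) simp
qed

text \<open>By Cauchy-Schwarz the coordinates of a unit vector have modulus at most 1, so the unit
  sphere of the span is a closed part of a compact box.\<close>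

lemma exists_max_on_unit_sphere:
  fixes B :: "'h::real_inner set" and f :: "'h \<Rightarrow> real"
  assumes "finite B" "orthonormal B" "B \<noteq> {}" "continuous_on UNIV f"
  obtains e where "e \<in> span B" "norm e = 1" "\<And>x. x \<in> span B \<Longrightarrow> norm x = 1 \<Longrightarrow> f x \<le> f e"
proof -
  define K where "K = {\<Sum>e\<in>B. c e *\<^sub>R e |c. \<forall>e\<in>B. \<bar>c e\<bar> \<le> 1} \<inter> {x. norm x = 1}"
  have K: "K = {x \<in> span B. norm x = 1}"
  proof (intro set_eqI iffI)
    fix x assume "x \<in> K"
    then show "x \<in> {x \<in> span B. norm x = 1}"
      by (auto simp: K_def) (intro span_sum span_scale span_base)
  next
    fix x assume x: "x \<in> {x \<in> span B. norm x = 1}"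
    have "\<bar>x \<bullet> e\<bar> \<le> 1" if "e \<in> B" for e
      using Cauchy_Schwarz_ineq2[of x e] x that assms(2) by (simp add: orthonormal_def)
    moreover have "x = (\<Sum>e\<in>B. (x \<bullet> e) *\<^sub>R e)"
      using orthonormal_expand[OF assms(1,2)] x by simp
    ultimately show "x \<in> K" using x unfolding K_def by fastforce
  qed
  have "compact K"
    unfolding K_def using assms(1) by (intro compact_Int_closed compact_box_combinations closed_Collect_eq continuous_intros) auto
  moreover have "K \<noteq> {}"
    using assms(2,3) unfolding K orthonormal_def by (auto intro: span_base)
  moreover have "continuous_on K f" using assms(4) by (rule continuous_on_subset) simp
  ultimately obtain e where "e \<in> K" "\<forall>x\<in>K. f x \<le> f e"
    using continuous_attains_sup by blast
  then show ?thesis by (intro that[of e]) (auto simp: K)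
qed

lemma zero_if_linear_le_quadratic:
  fixes a d :: real
  assumes "\<And>s. s * a \<le> s\<^sup>2 * d"
  shows "a = 0"
proof (rule ccontr)
  assume "a \<noteq> 0"
  \<comment> \<open>Any positive \<open>k\<close> above \<open>d\<close> will do: the choice
    \<open>s = a / k\<close> turns the assumption into \<open>a^2 * k \<le> a^2 * d\<close>.\<close>
  define k where "k = \<bar>d\<bar> + 1"
  have k: "0 < k" "d < k" by (auto simp: k_def)
  have "a / k * a \<le> (a / k)\<^sup>2 * d" by (rule assms)
  then have "a\<^sup>2 * k \<le> a\<^sup>2 * d"
    using k by (simp add: power2_eq_square field_simps)
  with \<open>a \<noteq> 0\<close> k show False by simp
qed

text \<open>The variational proof of the spectral theorem: a maximiser \<open>e\<close> of
  \<open>T x x\<close> on the unit sphere is \<open>T\<close>-orthogonal to every vector orthogonal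
  to it, and the argument continues on the complement of \<open>e\<close> in the span.\<close>

lemma symmetric_bilinear_diagonalization:
  fixes T :: "'h::real_inner \<Rightarrow> 'h \<Rightarrow> real"
  assumes T: "bilinear T" and sym: "\<And>x y. T x y = T y x"
    and cont: "continuous_on UNIV (\<lambda>x. T x x)" and "finite X"
  shows "\<exists>S. finite S \<and> orthonormal S \<and> span S = span X \<and> (\<forall>e\<in>S. \<forall>f\<in>S. e \<noteq> f \<longrightarrow> T e f = 0)"
  using \<open>finite X\<close>
proof (induction "card X" arbitrary: X rule: less_induct)
  case less
  obtain B where B: "finite B" "orthonormal B" "card B \<le> card X" "span B = span X"
    using exists_orthonormal_span[OF less.prems] by blast
  show ?case
  proof (cases "B = {}")
    case True
    with B show ?thesis by blast
  next
    case False
    obtain e where e: "e \<in> span B" "norm e = 1"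
      and max: "\<And>x. x \<in> span B \<Longrightarrow> norm x = 1 \<Longrightarrow> T x x \<le> T e e"
      using exists_max_on_unit_sphere[OF B(1,2) False cont] by blast
    have max': "T x x \<le> T e e * (norm x)\<^sup>2" if "x \<in> span B" for x
    proof (cases "x = 0")
      case True
      then show ?thesis using bilinear_lzero[OF T] by simp
    next
      case False
      define u where "u = (1 / norm x) *\<^sub>R x"
      have "T u u \<le> T e e"
        using that False by (intro max) (auto simp: u_def intro: span_scale)
      moreover have "T u u = T x x / (norm x)\<^sup>2"
        by (simp add: u_def bilinear_lmul[OF T] bilinear_rmul[OF T] power2_eq_square)
      ultimately show ?thesis using False by (simp add: divide_le_eq)
    qed
    have orth: "T e f = 0" if "f \<in> span B" "e \<bullet> f = 0" for f
    proof -
      \<comment> \<open>First variation: maximality tested at \<open>e + s f\<close> bounds a term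
        linear in \<open>s\<close> by a quadratic one for every real \<open>s\<close>, so the linear
        coefficient vanishes.\<close>
      have "s * (2 * T e f) \<le> s\<^sup>2 * (T e e * (norm f)\<^sup>2 - T f f)" for s
      proof -
        have "T (e + s *\<^sub>R f) (e + s *\<^sub>R f) \<le> T e e * (norm (e + s *\<^sub>R f))\<^sup>2"
          using that e by (intro max' span_add span_scale)
        moreover have "T (e + s *\<^sub>R f) (e + s *\<^sub>R f) = T e e + 2 * s * T e f + s\<^sup>2 * T f f"
          by (simp add: bilinear_ladd[OF T] bilinear_radd[OF T] bilinear_lmul[OF T] bilinear_rmul[OF T]
              sym[of f e] power2_eq_square algebra_simps)
        moreover have "(norm (e + s *\<^sub>R f))\<^sup>2 = 1 + s\<^sup>2 * (norm f)\<^sup>2"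
        proof -
          have "e \<bullet> e = 1" using e by (simp add: norm_eq_1)
          then show ?thesis
            using that unfolding power2_norm_eq_inner
            by (simp add: inner_add inner_commute[of f e] power2_eq_square)
        qed
        ultimately show ?thesis by (simp add: algebra_simps)
      qed
      from zero_if_linear_le_quadratic[OF this] show ?thesis by simp
    qed
    have e_expand: "e = (\<Sum>b\<in>B. (e \<bullet> b) *\<^sub>R b)"
      using orthonormal_expand[OF B(1,2) e(1)] by simp
    have "\<exists>b0\<in>B. e \<bullet> b0 \<noteq> 0"
    proof (rule ccontr)
      assume "\<not> (\<exists>b0\<in>B. e \<bullet> b0 \<noteq> 0)"
      then have "e = 0" by (subst e_expand) simp
      with e show False by simp
    qed
    \<comment> \<open>Since \<open>e\<close> has a component along \<open>b0\<close>, it can be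
      exchanged for \<open>b0\<close>. The projections of the other basis vectors then generate the
      complement of \<open>e\<close>, with at least one generator fewer.\<close>
    then obtain b0 where b0: "b0 \<in> B" "e \<bullet> b0 \<noteq> 0" by blast
    define X' where "X' = (\<lambda>b. b - (b \<bullet> e) *\<^sub>R e) ` (B - {b0})"
    have "card X' \<le> card (B - {b0})" unfolding X'_def using B by (intro card_image_le) simp
    also have "\<dots> < card B" using B b0 by (intro card_Diff1_less) auto
    finally have "card X' < card X" using B by simp
    then obtain S where S: "finite S" "orthonormal S" "span S = span X'"
      "\<forall>e\<in>S. \<forall>f\<in>S. e \<noteq> f \<longrightarrow> T e f = 0"
      using less.hyps[of X'] B by (auto simp: X'_def)
    have X'B: "X' \<subseteq> span B"
      using e by (auto simp: X'_def intro: span_diff span_scale span_base)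
    have ee: "e \<bullet> e = 1" using e by (simp add: norm_eq_1)
    have "X' \<subseteq> {x. e \<bullet> x = 0}"
      using ee by (auto simp: X'_def inner_diff_right inner_commute)
    then have perp: "e \<bullet> x = 0" if "x \<in> span X'" for x
      using span_minimal[of X' "{x. e \<bullet> x = 0}"] that
      by (auto simp: subspace_def inner_add_right)
    have S_sub: "f \<in> span X'" if "f \<in> S" for f using S(3) span_base[OF that] by simp
    have S_B: "f \<in> span B" if "f \<in> S" for f
      using S_sub[OF that] span_minimal[OF X'B] by auto
    have "orthonormal (insert e S)"
      using S(2) e perp S_sub unfolding orthonormal_def
      by (auto simp: pairwise_insert orthogonal_def inner_commute)
    moreover have "T x y = 0" if "x \<in> insert e S" "y \<in> insert e S" "x \<noteq> y" for x y
    proof -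
      have "T e f = 0" if "f \<in> S" for f using orth S_B perp S_sub that by blast
      then show ?thesis using that S(4) sym by (metis insert_iff)
    qed
    moreover have "span (insert e S) = span B"
    proof
      show "span (insert e S) \<subseteq> span B"
        using e S_B by (intro span_minimal) auto
      have X'S: "x \<in> span (insert e S)" if "x \<in> span X'" for x
        using that S(3) span_mono[of S "insert e S"] by auto
      have e_in: "e \<in> span (insert e S)" by (intro span_base) simp
      have other: "b \<in> span (insert e S)" if "b \<in> B - {b0}" for b
      proof -
        have "b - (b \<bullet> e) *\<^sub>R e \<in> span (insert e S)"
          using that by (intro X'S span_base) (auto simp: X'_def)
        then have "(b - (b \<bullet> e) *\<^sub>R e) + (b \<bullet> e) *\<^sub>R e \<in> span (insert e S)"
          by (intro span_add span_scale e_in)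
        then show ?thesis by simp
      qed
      have "e = (e \<bullet> b0) *\<^sub>R b0 + (\<Sum>b\<in>B - {b0}. (e \<bullet> b) *\<^sub>R b)"
        using e_expand sum.remove[OF B(1) b0(1), of "\<lambda>b. (e \<bullet> b) *\<^sub>R b"] by simp
      then have "e - (\<Sum>b\<in>B - {b0}. (e \<bullet> b) *\<^sub>R b) = (e \<bullet> b0) *\<^sub>R b0"
        by (simp only: diff_eq_eq)
      then have "b0 = (1 / (e \<bullet> b0)) *\<^sub>R (e - (\<Sum>b\<in>B - {b0}. (e \<bullet> b) *\<^sub>R b))"
        using b0 by simp
      also have "\<dots> \<in> span (insert e S)"
        by (intro span_scale span_diff span_sum e_in other)
      finally have "b0 \<in> span (insert e S)" .
      with other show "span B \<subseteq> span (insert e S)"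
        by (intro span_minimal) auto
    qed
    ultimately show ?thesis using S(1) B(4) by (intro exI[of _ "insert e S"]) auto
  qed
qed

section \<open>Double integrals of finite-rank tensors\<close>

lemma simple_tensor_Nil [simp]: "simple_tensor [] x y = 0"
  and simple_tensor_Cons [simp]: "simple_tensor ((c, h) # cs) x y = c * ((h \<bullet> x) * (h \<bullet> y)) + simple_tensor cs x y"
  by (simp_all add: simple_tensor_def)

lemma simple_wiener_I2_Nil [simp]: "simple_wiener_I2 W [] \<omega> = 0"
  and simple_wiener_I2_Cons [simp]: "simple_wiener_I2 W ((c, h) # cs) \<omega>
    = c * ((W h \<omega>)\<^sup>2 - (norm h)\<^sup>2) + simple_wiener_I2 W cs \<omega>"
  by (simp_all add: simple_wiener_I2_def)

lemma simple_tensor_bilinear: "bilinear (simple_tensor cs)"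
proof (induction cs)
  case (Cons p cs)
  then show ?case
    by (cases p) (auto simp: bilinear_def linear_iff inner_add_right algebra_simps)
qed (auto simp: bilinear_def linear_iff)

lemma simple_tensor_commute: "simple_tensor cs x y = simple_tensor cs y x"
  by (induction cs) (auto simp: mult_ac)

lemma continuous_simple_tensor: "continuous_on UNIV (\<lambda>x. simple_tensor cs x x)"
proof (induction cs)
  case (Cons p cs)
  then show ?case by (cases p) (auto intro!: continuous_intros)
qed simp

context isonormal
begin

text \<open>Expanding every vector in an orthonormal set turns the double integral into a sum of
  \<open>W e * W f\<close> minus its mean, weighted by \<open>simple_tensor cs e f\<close>. If that
  set diagonalises the tensor, the mixed products drop out.\<close>

lemma simple_wiener_I2_diagonal:
  obtains S y where "finite S" "orthonormal S"
    "AE \<omega> in M. simple_wiener_I2 W cs \<omega> = (\<Sum>e\<in>S. y e / 2 * ((W e \<omega>)\<^sup>2 - 1))"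
proof -
  have "\<exists>S. finite S \<and> orthonormal S \<and> span S = span (snd ` set cs) \<and>
      (\<forall>e\<in>S. \<forall>f\<in>S. e \<noteq> f \<longrightarrow> simple_tensor cs e f = 0)"
    by (intro symmetric_bilinear_diagonalization simple_tensor_bilinear simple_tensor_commute
        continuous_simple_tensor) simp
  then obtain S where S: "finite S" "orthonormal S" "span S = span (snd ` set cs)"
    and "\<forall>e\<in>S. \<forall>f\<in>S. e \<noteq> f \<longrightarrow> simple_tensor cs e f = 0"
    by (elim exE conjE)
  then have diag: "simple_tensor cs e f = 0" if "e \<in> S" "f \<in> S" "e \<noteq> f" for e f
    using that by simp
  have expand: "h = (\<Sum>e\<in>S. (h \<bullet> e) *\<^sub>R e)" if "h \<in> snd ` set cs" for h
    using orthonormal_expand[OF S(1,2)] span_base[OF that] S(3) by simp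
  have "AE \<omega> in M. \<forall>h\<in>snd ` set cs. W h \<omega> = (\<Sum>e\<in>S. (h \<bullet> e) * W e \<omega>)"
    by (intro AE_finite_allI AE_W_linear S(1) expand) auto
  \<comment> \<open>The eigenvalue carries a factor 2 to compensate for the 1/2 of the normal
    form.\<close>
  then have "AE \<omega> in M. simple_wiener_I2 W cs \<omega> = (\<Sum>e\<in>S. (2 * simple_tensor cs e e) / 2 * ((W e \<omega>)\<^sup>2 - 1))"
  proof eventually_elim
    case (elim \<omega>)
    define Y where "Y e f = W e \<omega> * W f \<omega> - of_bool (e = f)" for e f
    \<comment> \<open>Induction runs over lists \<open>ds\<close> with entries from
      \<open>cs\<close>, so that the orthonormal set and the exceptional null set stay those of
      \<open>cs\<close>.\<close>
    have "simple_wiener_I2 W ds \<omega> = (\<Sum>e\<in>S. \<Sum>f\<in>S. simple_tensor ds e f * Y e f)" if "set ds \<subseteq> set cs" for ds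
      using that
    proof (induction ds)
      case (Cons p ds)
      obtain c h where p: "p = (c, h)" by (cases p)
      have h: "h \<in> snd ` set cs" using Cons.prems p by force
      have n: "(norm h)\<^sup>2 = (\<Sum>e\<in>S. (h \<bullet> e)\<^sup>2)"
        using norm_sum_orthonormal[OF S(1,2), of "\<lambda>e. h \<bullet> e"] expand[OF h] by simp
      have "(W h \<omega>)\<^sup>2 = (\<Sum>e\<in>S. \<Sum>f\<in>S. (h \<bullet> e) * (h \<bullet> f) * (W e \<omega> * W f \<omega>))"
      proof -
        have "W h \<omega> = (\<Sum>e\<in>S. (h \<bullet> e) * W e \<omega>)" using elim h by blast
        then show ?thesis by (simp add: power2_eq_square sum_product mult_ac)
      qed
      moreover have "(norm h)\<^sup>2 = (\<Sum>e\<in>S. \<Sum>f\<in>S. (h \<bullet> e) * (h \<bullet> f) * of_bool (e = f))"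
        unfolding n using S(1) by (simp add: of_bool_def if_distrib power2_eq_square cong: if_cong)
      ultimately have "(W h \<omega>)\<^sup>2 - (norm h)\<^sup>2 = (\<Sum>e\<in>S. \<Sum>f\<in>S. (h \<bullet> e) * (h \<bullet> f) * Y e f)"
        by (simp add: Y_def right_diff_distrib sum_subtractf)
      then show ?case
        using Cons p by (simp add: distrib_right sum.distrib sum_distrib_left mult.assoc)
    qed simp
    then have "simple_wiener_I2 W cs \<omega> = (\<Sum>e\<in>S. \<Sum>f\<in>S. simple_tensor cs e f * Y e f)" by simp
    also have "\<dots> = (\<Sum>e\<in>S. \<Sum>f\<in>S. if f = e then simple_tensor cs e e * Y e e else 0)"
      using diag by (intro sum.cong refl) (metis mult_zero_left)
    also have "\<dots> = (\<Sum>e\<in>S. simple_tensor cs e e * Y e e)"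
      using S(1) by simp
    finally show ?case by (simp add: Y_def power2_eq_square)
  qed
  with S(1,2) show ?thesis by (rule that)
qed

end

section \<open>Hypercontractivity\<close>

lemma abs_power_Suc_diff_le:
  fixes x y :: real
  shows "\<bar>x ^ Suc l - y ^ Suc l\<bar> \<le> real (Suc l) * (\<bar>x - y\<bar> * (\<bar>x\<bar> ^ l + \<bar>y\<bar> ^ l))"
proof -
  have term_le: "\<bar>x ^ p * y ^ (l - p)\<bar> \<le> \<bar>x\<bar> ^ l + \<bar>y\<bar> ^ l" if "p < Suc l" for p
  proof -
    define u where "u = max \<bar>x\<bar> \<bar>y\<bar>"
    have "\<bar>x ^ p * y ^ (l - p)\<bar> \<le> u ^ p * u ^ (l - p)"
      unfolding abs_mult power_abs u_def by (intro mult_mono power_mono) auto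
    also have "\<dots> = u ^ l" using that by (simp flip: power_add)
    also have "\<dots> \<le> \<bar>x\<bar> ^ l + \<bar>y\<bar> ^ l"
      by (auto simp: u_def max_def)
    finally show ?thesis .
  qed
  have "\<bar>\<Sum>p<Suc l. x ^ p * y ^ (l - p)\<bar> \<le> (\<Sum>p<Suc l. \<bar>x\<bar> ^ l + \<bar>y\<bar> ^ l)"
    by (rule order_trans[OF sum_abs]) (intro sum_mono term_le, simp)
  then have "\<bar>x - y\<bar> * \<bar>\<Sum>p<Suc l. x ^ p * y ^ (l - p)\<bar> \<le> \<bar>x - y\<bar> * (real (Suc l) * (\<bar>x\<bar> ^ l + \<bar>y\<bar> ^ l))"
    by (intro mult_left_mono) auto
  then show ?thesis
    unfolding diff_power_eq_sum abs_mult by (simp add: mult_ac)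
qed

lemma integrable_of_even_power:
  fixes X :: "'a \<Rightarrow> real"
  assumes "finite_measure M" "X \<in> borel_measurable M" "integrable M (\<lambda>\<omega>. X \<omega> ^ (2 * k))"
  shows "integrable M (\<lambda>\<omega>. X \<omega> ^ k)"
proof (rule Bochner_Integration.integrable_bound)
  interpret finite_measure M by fact
  show "integrable M (\<lambda>\<omega>. 1 + X \<omega> ^ (2 * k))" using assms by simp
  show "AE \<omega> in M. norm (X \<omega> ^ k) \<le> norm (1 + X \<omega> ^ (2 * k))"
  proof (intro AE_I2)
    fix \<omega>
    have "0 \<le> (\<bar>X \<omega> ^ k\<bar> - 1)\<^sup>2" "0 \<le> (\<bar>X \<omega> ^ k\<bar>)\<^sup>2" by simp_all
    moreover have "\<bar>X \<omega> ^ k\<bar>\<^sup>2 = X \<omega> ^ (2 * k)" by (simp add: power_mult power2_eq_square mult_2 power_add)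
    ultimately show "norm (X \<omega> ^ k) \<le> norm (1 + X \<omega> ^ (2 * k))"
      by (simp add: power2_diff)
  qed
qed (use assms in measurable)

lemma square_add_le: "(a + b)\<^sup>2 \<le> 2 * a\<^sup>2 + 2 * (b::real)\<^sup>2"
  using zero_le_power2[of "a - b"] by (simp add: power2_eq_square algebra_simps)

lemma integrable_square_diff:
  fixes X Y :: "'a \<Rightarrow> real"
  assumes [measurable]: "X \<in> borel_measurable M" "Y \<in> borel_measurable M"
    and "integrable M (\<lambda>\<omega>. (X \<omega>)\<^sup>2)" "integrable M (\<lambda>\<omega>. (Y \<omega>)\<^sup>2)"
  shows "integrable M (\<lambda>\<omega>. (X \<omega> - Y \<omega>)\<^sup>2)"
proof (rule Bochner_Integration.integrable_bound)
  show "integrable M (\<lambda>\<omega>. 2 * (X \<omega>)\<^sup>2 + 2 * (Y \<omega>)\<^sup>2)" using assms by simp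
  show "AE \<omega> in M. norm ((X \<omega> - Y \<omega>)\<^sup>2) \<le> norm (2 * (X \<omega>)\<^sup>2 + 2 * (Y \<omega>)\<^sup>2)"
  proof (rule AE_I2)
    fix \<omega>
    show "norm ((X \<omega> - Y \<omega>)\<^sup>2) \<le> norm (2 * (X \<omega>)\<^sup>2 + 2 * (Y \<omega>)\<^sup>2)"
      using square_add_le[of "X \<omega>" "- Y \<omega>"] by simp
  qed
qed simp

lemma integral_square_diff_triangle:
  fixes X Y Z :: "'a \<Rightarrow> real"
  assumes "integrable M (\<lambda>\<omega>. (X \<omega> - Y \<omega>)\<^sup>2)" "integrable M (\<lambda>\<omega>. (Y \<omega> - Z \<omega>)\<^sup>2)"
  shows "(LINT \<omega>|M. (X \<omega> - Z \<omega>)\<^sup>2) \<le> 2 * (LINT \<omega>|M. (X \<omega> - Y \<omega>)\<^sup>2) + 2 * (LINT \<omega>|M. (Y \<omega> - Z \<omega>)\<^sup>2)"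
proof -
  have "(LINT \<omega>|M. (X \<omega> - Z \<omega>)\<^sup>2) \<le> (LINT \<omega>|M. 2 * (X \<omega> - Y \<omega>)\<^sup>2 + 2 * (Y \<omega> - Z \<omega>)\<^sup>2)"
  proof (rule integral_mono_AE')
    show "AE \<omega> in M. (X \<omega> - Z \<omega>)\<^sup>2 \<le> 2 * (X \<omega> - Y \<omega>)\<^sup>2 + 2 * (Y \<omega> - Z \<omega>)\<^sup>2"
    proof (rule AE_I2)
      fix \<omega>
      show "(X \<omega> - Z \<omega>)\<^sup>2 \<le> 2 * (X \<omega> - Y \<omega>)\<^sup>2 + 2 * (Y \<omega> - Z \<omega>)\<^sup>2"
        using square_add_le[of "X \<omega> - Y \<omega>" "Y \<omega> - Z \<omega>"] by simp
    qed
  qed (use assms in auto)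
  then show ?thesis using assms by simp
qed

text \<open>Young's inequality with a free parameter takes the place of Cauchy-Schwarz: the
  difference goes into the term divided by \<open>\<epsilon>\<close>, the higher moments into the
  term multiplied by it.\<close>

lemma integral_power_diff_le:
  fixes X Y :: "'a \<Rightarrow> real"
  assumes X: "\<And>k. integrable M (\<lambda>\<omega>. X \<omega> ^ k)" "(LINT \<omega>|M. X \<omega> ^ (2 * l)) \<le> C"
    and Y: "\<And>k. integrable M (\<lambda>\<omega>. Y \<omega> ^ k)" "(LINT \<omega>|M. Y \<omega> ^ (2 * l)) \<le> C"
    and D: "integrable M (\<lambda>\<omega>. (X \<omega> - Y \<omega>)\<^sup>2)" and "0 < \<epsilon>"
  shows "\<bar>(LINT \<omega>|M. X \<omega> ^ Suc l) - (LINT \<omega>|M. Y \<omega> ^ Suc l)\<bar>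
    \<le> real (Suc l) * ((LINT \<omega>|M. (X \<omega> - Y \<omega>)\<^sup>2) / (2 * \<epsilon>) + 2 * \<epsilon> * C)"
proof -
  let ?B = "\<lambda>\<omega>. real (Suc l) * ((X \<omega> - Y \<omega>)\<^sup>2 / (2 * \<epsilon>) + \<epsilon> * (X \<omega> ^ (2 * l) + Y \<omega> ^ (2 * l)))"
  have bound: "\<bar>X \<omega> ^ Suc l - Y \<omega> ^ Suc l\<bar> \<le> ?B \<omega>" for \<omega>
  proof -
    define d s where "d = \<bar>X \<omega> - Y \<omega>\<bar>" and "s = \<bar>X \<omega>\<bar> ^ l + \<bar>Y \<omega>\<bar> ^ l"
    have "0 \<le> (d - \<epsilon> * s)\<^sup>2" by simp
    then have "d * s \<le> d\<^sup>2 / (2 * \<epsilon>) + \<epsilon> / 2 * s\<^sup>2"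
      using \<open>0 < \<epsilon>\<close> by (simp add: power2_eq_square field_simps)
    also have "\<epsilon> / 2 * s\<^sup>2 \<le> \<epsilon> / 2 * (2 * (X \<omega>) ^ (2 * l) + 2 * (Y \<omega>) ^ (2 * l))"
      using square_add_le[of "\<bar>X \<omega>\<bar> ^ l" "\<bar>Y \<omega>\<bar> ^ l"] \<open>0 < \<epsilon>\<close>
      by (intro mult_left_mono) (simp_all add: s_def power_mult[symmetric] mult.commute[of l] power_even_abs)
    finally have "d * s \<le> (X \<omega> - Y \<omega>)\<^sup>2 / (2 * \<epsilon>) + \<epsilon> * (X \<omega> ^ (2 * l) + Y \<omega> ^ (2 * l))"
      by (simp add: d_def algebra_simps)
    then have "real (Suc l) * (d * s) \<le> ?B \<omega>" by (intro mult_left_mono) auto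
    with abs_power_Suc_diff_le[of "X \<omega>" l "Y \<omega>"] show ?thesis
      unfolding d_def s_def by (rule order_trans)
  qed
  have B: "integrable M ?B" using X(1) Y(1) D by simp
  have "\<bar>(LINT \<omega>|M. X \<omega> ^ Suc l) - (LINT \<omega>|M. Y \<omega> ^ Suc l)\<bar> = \<bar>LINT \<omega>|M. X \<omega> ^ Suc l - Y \<omega> ^ Suc l\<bar>"
    by (simp only: Bochner_Integration.integral_diff[OF X(1) Y(1)])
  also have "\<dots> \<le> (LINT \<omega>|M. \<bar>X \<omega> ^ Suc l - Y \<omega> ^ Suc l\<bar>)" by (rule integral_abs_bound)
  also have "\<dots> \<le> (LINT \<omega>|M. ?B \<omega>)"
    by (intro integral_mono B integrable_abs Bochner_Integration.integrable_diff X(1) Y(1) bound)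
  also have "\<dots> = real (Suc l) * ((LINT \<omega>|M. (X \<omega> - Y \<omega>)\<^sup>2) / (2 * \<epsilon>)
      + \<epsilon> * ((LINT \<omega>|M. X \<omega> ^ (2 * l)) + (LINT \<omega>|M. Y \<omega> ^ (2 * l))))"
    using X(1) Y(1) D by simp
  also have "\<dots> \<le> real (Suc l) * ((LINT \<omega>|M. (X \<omega> - Y \<omega>)\<^sup>2) / (2 * \<epsilon>) + \<epsilon> * (C + C))"
    using X(2) Y(2) \<open>0 < \<epsilon>\<close> by (intro mult_left_mono add_left_mono add_mono) auto
  finally show ?thesis by (simp add: algebra_simps)
qed

lemma moments_asymptotically_equal:
  fixes X Y :: "nat \<Rightarrow> 'a \<Rightarrow> real"
  assumes X: "\<And>n k. integrable M (\<lambda>\<omega>. X n \<omega> ^ k)" "\<And>n k. (LINT \<omega>|M. X n \<omega> ^ (2 * k)) \<le> C k"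
    and Y: "\<And>n k. integrable M (\<lambda>\<omega>. Y n \<omega> ^ k)" "\<And>n k. (LINT \<omega>|M. Y n \<omega> ^ (2 * k)) \<le> C k"
    and D: "\<And>n. integrable M (\<lambda>\<omega>. (X n \<omega> - Y n \<omega>)\<^sup>2)"
    and lim: "(\<lambda>n. LINT \<omega>|M. (X n \<omega> - Y n \<omega>)\<^sup>2) \<longlonglongrightarrow> 0"
  shows "(\<lambda>n. (LINT \<omega>|M. X n \<omega> ^ k) - (LINT \<omega>|M. Y n \<omega> ^ k)) \<longlonglongrightarrow> 0"
proof (cases k)
  case (Suc l)
  define d where "d n = (LINT \<omega>|M. (X n \<omega> - Y n \<omega>)\<^sup>2)" for n
  \<comment> \<open>The square root of the squared distance balances the two error terms; the
    summand \<open>1 / (n + 1)\<close> keeps the parameter positive when that distance is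
    zero.\<close>
  define \<epsilon> where "\<epsilon> n = sqrt (d n) + inverse (real (Suc n))" for n
  have d0: "0 \<le> d n" for n unfolding d_def by (intro Bochner_Integration.integral_nonneg) auto
  have \<epsilon>: "0 < \<epsilon> n" for n using d0[of n] by (simp add: \<epsilon>_def add_nonneg_pos)
  have "\<epsilon> \<longlonglongrightarrow> sqrt 0 + 0"
    unfolding \<epsilon>_def using lim by (intro tendsto_intros LIMSEQ_inverse_real_of_nat) (simp add: d_def)
  then have \<epsilon>_lim: "\<epsilon> \<longlonglongrightarrow> 0" by simp
  have "(\<lambda>n. real (Suc l) * (\<epsilon> n / 2 + 2 * \<epsilon> n * C l)) \<longlonglongrightarrow> real (Suc l) * (0 / 2 + 2 * 0 * C l)"
    by (intro tendsto_intros \<epsilon>_lim) auto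
  then have lim0: "(\<lambda>n. real (Suc l) * (\<epsilon> n / 2 + 2 * \<epsilon> n * C l)) \<longlonglongrightarrow> 0" by simp
  have "\<bar>(LINT \<omega>|M. X n \<omega> ^ k) - (LINT \<omega>|M. Y n \<omega> ^ k)\<bar> \<le> real (Suc l) * (\<epsilon> n / 2 + 2 * \<epsilon> n * C l)" for n
  proof -
    have "d n = sqrt (d n) * sqrt (d n)" using d0 by simp
    also have "\<dots> \<le> \<epsilon> n * \<epsilon> n"
      using d0[of n] by (intro mult_mono) (auto simp: \<epsilon>_def)
    finally have "d n / (2 * \<epsilon> n) \<le> \<epsilon> n / 2" using \<epsilon>[of n] by (simp add: field_simps)
    then have "real (Suc l) * (d n / (2 * \<epsilon> n) + 2 * \<epsilon> n * C l) \<le> real (Suc l) * (\<epsilon> n / 2 + 2 * \<epsilon> n * C l)"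
      by (intro mult_left_mono) auto
    with integral_power_diff_le[OF X Y D \<epsilon>] show ?thesis
      unfolding Suc d_def by (rule order_trans)
  qed
  then show ?thesis
    by (intro Lim_null_comparison[OF _ lim0]) auto
qed simp

text \<open>By \<open>cmoment_gaussian_square\<close> with \<open>y = sqrt 2\<close> this is the
  moment of order \<open>2 * p\<close> of \<open>(N^2 - 1) / sqrt 2\<close> for a standard normal
  \<open>N\<close>: the rank-one element of unit variance, whose cumulants are the largest in
  modulus.\<close>

definition hypercontractivity_const :: "nat \<Rightarrow> real" where
  "hypercontractivity_const p = cmoment (\<lambda>j. sqrt 2 ^ j) (2 * p)"

context isonormal
begin

lemma simple_wiener_I2_measurable [measurable]: "simple_wiener_I2 W cs \<in> borel_measurable M"
proof -
  have "(\<lambda>\<omega>. simple_wiener_I2 W cs \<omega>) \<in> borel_measurable M"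
  proof (induction cs)
    case (Cons p cs)
    then show ?case by (cases p) simp
  qed simp
  then show ?thesis by simp
qed

lemma simple_wiener_I2_moments:
  assumes "finite S" "orthonormal S"
    and AE: "AE \<omega> in M. simple_wiener_I2 W cs \<omega> = (\<Sum>e\<in>S. y e / 2 * ((W e \<omega>)\<^sup>2 - 1))"
  shows "integrable M (\<lambda>\<omega>. simple_wiener_I2 W cs \<omega> ^ n)"
    and "expectation (\<lambda>\<omega>. simple_wiener_I2 W cs \<omega> ^ n) = cmoment (\<lambda>j. power_sum S y (j + 2) / 2) n"
proof -
  have [measurable]: "(\<lambda>\<omega>. \<Sum>e\<in>S. y e / 2 * ((W e \<omega>)\<^sup>2 - 1)) \<in> borel_measurable M" by measurable
  have "AE \<omega> in M. simple_wiener_I2 W cs \<omega> ^ n = (\<Sum>e\<in>S. y e / 2 * ((W e \<omega>)\<^sup>2 - 1)) ^ n"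
    using AE by eventually_elim simp
  then have "integrable M (\<lambda>\<omega>. simple_wiener_I2 W cs \<omega> ^ n) \<longleftrightarrow>
      integrable M (\<lambda>\<omega>. (\<Sum>e\<in>S. y e / 2 * ((W e \<omega>)\<^sup>2 - 1)) ^ n)"
    "expectation (\<lambda>\<omega>. simple_wiener_I2 W cs \<omega> ^ n) = expectation (\<lambda>\<omega>. (\<Sum>e\<in>S. y e / 2 * ((W e \<omega>)\<^sup>2 - 1)) ^ n)"
    by (intro integrable_cong_AE integral_cong_AE; simp)+
  then show "integrable M (\<lambda>\<omega>. simple_wiener_I2 W cs \<omega> ^ n)"
    "expectation (\<lambda>\<omega>. simple_wiener_I2 W cs \<omega> ^ n) = cmoment (\<lambda>j. power_sum S y (j + 2) / 2) n"
    using moments_orthonormal[OF assms(1,2)] by simp_all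
qed

lemma simple_wiener_I2_integrable: "integrable M (\<lambda>\<omega>. simple_wiener_I2 W cs \<omega> ^ n)"
proof -
  obtain S y where "finite S" "orthonormal S"
    "AE \<omega> in M. simple_wiener_I2 W cs \<omega> = (\<Sum>e\<in>S. y e / 2 * ((W e \<omega>)\<^sup>2 - 1))"
    by (rule simple_wiener_I2_diagonal)
  then show ?thesis by (rule simple_wiener_I2_moments(1))
qed

text \<open>For variance \<open>\<sigma>^2\<close>, every power sum is bounded in modulus by its
  value for the single eigenvalue \<open>sqrt 2 * \<sigma>\<close>. Monotonicity and homogeneity of
  the moment polynomials do the rest.\<close>

lemma simple_wiener_I2_hypercontractive:
  "expectation (\<lambda>\<omega>. simple_wiener_I2 W cs \<omega> ^ (2 * p))
    \<le> hypercontractivity_const p * expectation (\<lambda>\<omega>. (simple_wiener_I2 W cs \<omega>)\<^sup>2) ^ p"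
proof -
  obtain S y where S: "finite S" "orthonormal S"
    "AE \<omega> in M. simple_wiener_I2 W cs \<omega> = (\<Sum>e\<in>S. y e / 2 * ((W e \<omega>)\<^sup>2 - 1))"
    by (rule simple_wiener_I2_diagonal)
  note mom = simple_wiener_I2_moments(2)[OF S]
  define m where "m j = power_sum S y (j + 2) / 2" for j
  define \<sigma> where "\<sigma> = sqrt (power_sum S y 2 / 2)"
  have p2: "0 \<le> power_sum S y 2" by (simp add: power_sum_even_nonneg)
  have \<sigma>2: "\<sigma>\<^sup>2 = expectation (\<lambda>\<omega>. (simple_wiener_I2 W cs \<omega>)\<^sup>2)"
    unfolding mom[of 2] using p2 by (simp add: \<sigma>_def eval_nat_numeral)
  have "\<bar>m j\<bar> \<le> \<sigma> ^ (j + 2) * sqrt 2 ^ j" for j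
  proof -
    have "\<bar>m j\<bar> \<le> sqrt (power_sum S y 2) ^ j * (power_sum S y 2 / 2)"
      using abs_power_sum_le[OF S(1), of y j] by (simp add: m_def add.commute)
    also have "sqrt (power_sum S y 2) = \<sigma> * sqrt 2" by (simp add: \<sigma>_def real_sqrt_divide)
    also have "power_sum S y 2 / 2 = \<sigma>\<^sup>2" using p2 by (simp add: \<sigma>_def)
    finally show ?thesis by (simp add: power_mult_distrib power_add power2_eq_square mult_ac)
  qed
  then have "\<bar>cmoment m (2 * p)\<bar> \<le> cmoment (\<lambda>j. \<sigma> ^ (j + 2) * sqrt 2 ^ j) (2 * p)"
    by (rule abs_cmoment_le)
  also have "\<dots> = (\<sigma>\<^sup>2) ^ p * hypercontractivity_const p"
    unfolding cmoment_scale hypercontractivity_const_def by (simp add: power_mult)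
  finally show ?thesis
    unfolding \<sigma>2 using mom[of "2 * p"] by (simp add: m_def[abs_def] mult.commute)
qed

lemma second_wiener_chaos_approx:
  assumes "X \<in> second_wiener_chaos M W"
  shows "X \<in> borel_measurable M" "integrable M (\<lambda>\<omega>. (X \<omega>)\<^sup>2)"
    "\<exists>cs. (\<lambda>k. expectation (\<lambda>\<omega>. (X \<omega> - simple_wiener_I2 W (cs k) \<omega>)\<^sup>2)) \<longlonglongrightarrow> 0"
  using assms by (auto simp: second_wiener_chaos_def is_wiener_I2_def)

lemma integrable_diff_simple:
  assumes "X \<in> second_wiener_chaos M W"
  shows "integrable M (\<lambda>\<omega>. (X \<omega> - simple_wiener_I2 W cs \<omega>)\<^sup>2)"
  using second_wiener_chaos_approx[OF assms] simple_wiener_I2_integrable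
  by (intro integrable_square_diff) auto

text \<open>Fatou's lemma along an almost surely convergent subsequence of simple integrals.\<close>

lemma second_wiener_chaos_hypercontractive:
  assumes X: "X \<in> second_wiener_chaos M W"
  shows "integrable M (\<lambda>\<omega>. X \<omega> ^ (2 * p))"
    and "expectation (\<lambda>\<omega>. X \<omega> ^ (2 * p)) \<le> hypercontractivity_const p * expectation (\<lambda>\<omega>. (X \<omega>)\<^sup>2) ^ p"
proof -
  note [measurable] = second_wiener_chaos_approx(1)[OF X]
  note X2 = second_wiener_chaos_approx(2)[OF X]
  obtain cs where cs: "(\<lambda>k. expectation (\<lambda>\<omega>. (X \<omega> - simple_wiener_I2 W (cs k) \<omega>)\<^sup>2)) \<longlonglongrightarrow> 0"
    using second_wiener_chaos_approx(3)[OF X] by blast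
  define G where "G k = simple_wiener_I2 W (cs k)" for k
  have [measurable]: "G k \<in> borel_measurable M" for k by (simp add: G_def)
  have G_int: "integrable M (\<lambda>\<omega>. G k \<omega> ^ n)" for k n
    unfolding G_def by (rule simple_wiener_I2_integrable)
  have D: "integrable M (\<lambda>\<omega>. (X \<omega> - G k \<omega>)\<^sup>2)" for k
    unfolding G_def by (rule integrable_diff_simple[OF X])
  define d where "d k = expectation (\<lambda>\<omega>. (X \<omega> - G k \<omega>)\<^sup>2)" for k
  have d: "d \<longlonglongrightarrow> 0" using cs by (simp add: d_def[abs_def] G_def)
  define a where "a = expectation (\<lambda>\<omega>. (X \<omega>)\<^sup>2)"
  have a0: "0 \<le> a" unfolding a_def by (intro Bochner_Integration.integral_nonneg) auto
  have d0: "0 \<le> d k" for k unfolding d_def by (intro Bochner_Integration.integral_nonneg) auto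
  \<comment> \<open>The factor \<open>1 + \<epsilon>\<close> instead of 2 preserves the constant,
    because \<open>\<epsilon>\<close> is sent to 0 at the end.\<close>
  have G2: "expectation (\<lambda>\<omega>. (G k \<omega>)\<^sup>2) \<le> (1 + \<epsilon>) * a + (1 + 1 / \<epsilon>) * d k" if "0 < \<epsilon>" for k \<epsilon>
  proof -
    have "(G k \<omega>)\<^sup>2 \<le> (1 + \<epsilon>) * (X \<omega>)\<^sup>2 + (1 + 1 / \<epsilon>) * (X \<omega> - G k \<omega>)\<^sup>2" for \<omega>
    proof -
      define x e where "x = X \<omega>" and "e = X \<omega> - G k \<omega>"
      have "0 \<le> (\<epsilon> * x + e)\<^sup>2 / \<epsilon>" using that by simp
      then have "(x - e)\<^sup>2 \<le> (1 + \<epsilon>) * x\<^sup>2 + (1 + 1 / \<epsilon>) * e\<^sup>2"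
        using that by (simp add: power2_eq_square field_simps)
      then show ?thesis by (simp add: x_def e_def)
    qed
    then have "expectation (\<lambda>\<omega>. (G k \<omega>)\<^sup>2)
        \<le> expectation (\<lambda>\<omega>. (1 + \<epsilon>) * (X \<omega>)\<^sup>2 + (1 + 1 / \<epsilon>) * (X \<omega> - G k \<omega>)\<^sup>2)"
      using G_int X2 D by (intro integral_mono) auto
    then show ?thesis using X2 D by (simp add: a_def d_def)
  qed
  \<comment> \<open>L2 convergence is L1 convergence of the squared differences, hence almost sure
    convergence along a subsequence.\<close>
  obtain r where r: "strict_mono r" "AE \<omega> in M. (\<lambda>k. (X \<omega> - G (r k) \<omega>)\<^sup>2) \<longlonglongrightarrow> 0"
    using tendsto_L1_AE_subseq[of M "\<lambda>k \<omega>. (X \<omega> - G k \<omega>)\<^sup>2"] D d by (auto simp: d_def[abs_def])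
  have conv: "AE \<omega> in M. (\<lambda>k. ennreal (G (r k) \<omega> ^ (2 * p))) \<longlonglongrightarrow> ennreal (X \<omega> ^ (2 * p))"
    using r(2)
  proof eventually_elim
    case (elim \<omega>)
    then have "(\<lambda>k. sqrt ((X \<omega> - G (r k) \<omega>)\<^sup>2)) \<longlonglongrightarrow> sqrt 0" by (intro tendsto_intros)
    then have "(\<lambda>k. X \<omega> - G (r k) \<omega>) \<longlonglongrightarrow> 0" by (simp add: tendsto_rabs_zero_iff)
    then have "(\<lambda>k. X \<omega> - (X \<omega> - G (r k) \<omega>)) \<longlonglongrightarrow> X \<omega> - 0" by (intro tendsto_intros)
    then have "(\<lambda>k. G (r k) \<omega>) \<longlonglongrightarrow> X \<omega>" by simp
    then show ?case by (intro tendsto_intros)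
  qed
  have C: "0 \<le> hypercontractivity_const p"
    unfolding hypercontractivity_const_def by (rule cmoment_nonneg) simp
  have bound: "(\<integral>\<^sup>+\<omega>. ennreal (X \<omega> ^ (2 * p)) \<partial>M) \<le> ennreal (hypercontractivity_const p * ((1 + \<epsilon>) * a + \<epsilon>) ^ p)"
    if "0 < \<epsilon>" for \<epsilon>
  proof -
    have "(\<lambda>k. (1 + 1 / \<epsilon>) * d (r k)) \<longlonglongrightarrow> (1 + 1 / \<epsilon>) * 0"
      using LIMSEQ_subseq_LIMSEQ[OF d r(1)] by (intro tendsto_intros) (simp add: comp_def)
    then have ev: "\<forall>\<^sub>F k in sequentially. (1 + 1 / \<epsilon>) * d (r k) < \<epsilon>"
      using that by (intro order_tendstoD) auto
    have "(\<integral>\<^sup>+\<omega>. ennreal (X \<omega> ^ (2 * p)) \<partial>M) = (\<integral>\<^sup>+\<omega>. liminf (\<lambda>k. ennreal (G (r k) \<omega> ^ (2 * p))) \<partial>M)"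
    proof (rule nn_integral_cong_AE)
      show "AE \<omega> in M. ennreal (X \<omega> ^ (2 * p)) = liminf (\<lambda>k. ennreal (G (r k) \<omega> ^ (2 * p)))"
        using conv by eventually_elim (rule lim_imp_Liminf[OF sequentially_bot, symmetric])
    qed
    also have "\<dots> \<le> liminf (\<lambda>k. \<integral>\<^sup>+\<omega>. ennreal (G (r k) \<omega> ^ (2 * p)) \<partial>M)"
      by (rule nn_integral_liminf) simp
    also have "\<dots> \<le> ennreal (hypercontractivity_const p * ((1 + \<epsilon>) * a + \<epsilon>) ^ p)"
    proof (rule Liminf_le)
      show "\<forall>\<^sub>F k in sequentially. (\<integral>\<^sup>+\<omega>. ennreal (G (r k) \<omega> ^ (2 * p)) \<partial>M)
          \<le> ennreal (hypercontractivity_const p * ((1 + \<epsilon>) * a + \<epsilon>) ^ p)"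
        using ev
      proof eventually_elim
        case (elim k)
        have "(\<integral>\<^sup>+\<omega>. ennreal (G (r k) \<omega> ^ (2 * p)) \<partial>M) = ennreal (expectation (\<lambda>\<omega>. G (r k) \<omega> ^ (2 * p)))"
          by (intro nn_integral_eq_integral G_int) (auto simp: power_mult)
        also have "\<dots> \<le> ennreal (hypercontractivity_const p * expectation (\<lambda>\<omega>. (G (r k) \<omega>)\<^sup>2) ^ p)"
          unfolding G_def by (intro ennreal_leI simple_wiener_I2_hypercontractive)
        also have "\<dots> \<le> ennreal (hypercontractivity_const p * ((1 + \<epsilon>) * a + \<epsilon>) ^ p)"
          using G2[OF that, of "r k"] elim C
          by (intro ennreal_leI mult_left_mono power_mono) (auto intro!: Bochner_Integration.integral_nonneg)
        finally show ?case .
      qed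
    qed simp
    finally show ?thesis .
  qed
  have "(\<integral>\<^sup>+\<omega>. ennreal (X \<omega> ^ (2 * p)) \<partial>M) < \<infinity>"
    using bound[of 1] by (simp add: order_le_less_trans)
  then show int: "integrable M (\<lambda>\<omega>. X \<omega> ^ (2 * p))"
    by (intro integrableI_nonneg) (auto simp: power_mult)
  have le: "expectation (\<lambda>\<omega>. X \<omega> ^ (2 * p)) \<le> hypercontractivity_const p * ((1 + \<epsilon>) * a + \<epsilon>) ^ p"
    if "0 < \<epsilon>" for \<epsilon>
  proof -
    have "(\<integral>\<^sup>+\<omega>. ennreal (X \<omega> ^ (2 * p)) \<partial>M) = ennreal (expectation (\<lambda>\<omega>. X \<omega> ^ (2 * p)))"
      by (intro nn_integral_eq_integral int) (auto simp: power_mult)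
    with bound[OF that] show ?thesis
      using that a0 C by (simp add: ennreal_le_iff)
  qed
  have "(\<lambda>n. hypercontractivity_const p * ((1 + inverse (real (Suc n))) * a + inverse (real (Suc n))) ^ p)
    \<longlonglongrightarrow> hypercontractivity_const p * ((1 + 0) * a + 0) ^ p"
    by (intro tendsto_intros LIMSEQ_inverse_real_of_nat)
  then have "expectation (\<lambda>\<omega>. X \<omega> ^ (2 * p)) \<le> hypercontractivity_const p * ((1 + 0) * a + 0) ^ p"
    by (rule LIMSEQ_le_const) (use le in auto)
  then show "expectation (\<lambda>\<omega>. X \<omega> ^ (2 * p)) \<le> hypercontractivity_const p * expectation (\<lambda>\<omega>. (X \<omega>)\<^sup>2) ^ p"
    by (simp add: a_def)
qed

lemma second_wiener_chaos_integrable: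
  assumes "X \<in> second_wiener_chaos M W"
  shows "integrable M (\<lambda>\<omega>. X \<omega> ^ k)"
  by (rule integrable_of_even_power[OF finite_measure_axioms second_wiener_chaos_approx(1)[OF assms]
        second_wiener_chaos_hypercontractive(1)[OF assms]])

end

section \<open>Wasserstein distance, weak convergence and the product law\<close>

lemma wasserstein2_le:
  fixes X Y :: "'a \<Rightarrow> real"
  assumes "prob_space M" and [measurable]: "X \<in> borel_measurable M" "Y \<in> borel_measurable M"
    and int: "integrable M (\<lambda>\<omega>. (X \<omega> - Y \<omega>)\<^sup>2)"
  shows "wasserstein2 (distr M borel X) (distr M borel Y) \<le> ennreal (sqrt (LINT \<omega>|M. (X \<omega> - Y \<omega>)\<^sup>2))"
proof -
  interpret prob_space M by fact
  define \<gamma> where "\<gamma> = distr M (borel \<Otimes>\<^sub>M borel) (\<lambda>\<omega>. (X \<omega>, Y \<omega>))"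
  have XY: "(\<lambda>\<omega>. (X \<omega>, Y \<omega>)) \<in> M \<rightarrow>\<^sub>M borel \<Otimes>\<^sub>M borel" by measurable
  have "prob_space \<gamma>" unfolding \<gamma>_def by (rule prob_space_distr[OF XY])
  moreover have "distr \<gamma> borel fst = distr M borel X" "distr \<gamma> borel snd = distr M borel Y"
    unfolding \<gamma>_def by (subst distr_distr[OF _ XY]; simp add: comp_def)+
  ultimately have "\<gamma> \<in> couplings (distr M borel X) (distr M borel Y)"
    by (simp add: couplings_def \<gamma>_def)
  then have "wasserstein2 (distr M borel X) (distr M borel Y)
      \<le> ennreal_sqrt (\<integral>\<^sup>+ (x, y). ennreal ((x - y)\<^sup>2) \<partial>\<gamma>)"
    unfolding wasserstein2_def by (rule INF_lower)
  also have "(\<integral>\<^sup>+ (x, y). ennreal ((x - y)\<^sup>2) \<partial>\<gamma>) = (\<integral>\<^sup>+ \<omega>. ennreal ((X \<omega> - Y \<omega>)\<^sup>2) \<partial>M)"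
    unfolding \<gamma>_def by (subst nn_integral_distr[OF XY]) (simp_all add: split_beta)
  also have "\<dots> = ennreal (LINT \<omega>|M. (X \<omega> - Y \<omega>)\<^sup>2)"
    by (intro nn_integral_eq_integral int) simp
  finally show ?thesis by (simp add: ennreal_sqrt_def)
qed

text \<open>The function \<open>exp (i t x)\<close> is Lipschitz in \<open>x\<close> with constant
  \<open>|t|\<close>. The strict inequality supplies a coupling below \<open>\<epsilon>\<close>
  without the infimum being attained, and Young's inequality bounds its mean distance by
  \<open>\<epsilon>\<close>.\<close>

lemma char_diff_le_wasserstein2:
  assumes "real_distribution \<mu>" "real_distribution \<nu>" and "0 < \<epsilon>"
    and W: "wasserstein2 \<mu> \<nu> < ennreal \<epsilon>"
  shows "cmod (char \<mu> t - char \<nu> t) \<le> \<bar>t\<bar> * \<epsilon>"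
proof -
  obtain \<gamma> where \<gamma>: "\<gamma> \<in> couplings \<mu> \<nu>"
    and less: "ennreal_sqrt (\<integral>\<^sup>+ (x, y). ennreal ((x - y)\<^sup>2) \<partial>\<gamma>) < ennreal \<epsilon>"
    using W unfolding wasserstein2_def by (auto simp: INF_less_iff)
  define J where "J = (\<integral>\<^sup>+ (x, y). ennreal ((x - y)\<^sup>2) \<partial>\<gamma>)"
  have sets: "sets \<gamma> = sets (borel \<Otimes>\<^sub>M borel)" and marg: "distr \<gamma> borel fst = \<mu>" "distr \<gamma> borel snd = \<nu>"
    and "prob_space \<gamma>"
    using \<gamma> by (auto simp: couplings_def)
  interpret prob_space \<gamma> by fact
  note [measurable_cong] = sets
  have "J \<noteq> \<infinity>" using less by (auto simp: ennreal_sqrt_def J_def)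
  have "(\<lambda>p::real \<times> real. (fst p - snd p)\<^sup>2) \<in> borel_measurable \<gamma>" by measurable
  then have int: "integrable \<gamma> (\<lambda>p. (fst p - snd p)\<^sup>2)"
    using \<open>J \<noteq> \<infinity>\<close> by (intro integrableI_nonneg) (auto simp: J_def split_beta' less_top)
  have "J = ennreal (LINT p|\<gamma>. (fst p - snd p)\<^sup>2)"
    unfolding J_def split_beta' by (intro nn_integral_eq_integral int) simp
  then have "sqrt (LINT p|\<gamma>. (fst p - snd p)\<^sup>2) < \<epsilon>"
    using less \<open>0 < \<epsilon>\<close> unfolding J_def[symmetric] by (simp add: ennreal_sqrt_def ennreal_less_iff)
  then have J2: "(LINT p|\<gamma>. (fst p - snd p)\<^sup>2) \<le> \<epsilon>\<^sup>2"
    by (meson less_imp_le real_le_lsqrt sqrt_le_D)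
  have iexp_int: "integrable \<gamma> (\<lambda>p. iexp (t * f p))" if [measurable]: "f \<in> borel_measurable \<gamma>" for f :: "real \<times> real \<Rightarrow> real"
    by (rule integrable_iexp) auto
  have "char \<mu> t = (CLINT p|\<gamma>. iexp (t * fst p))" "char \<nu> t = (CLINT p|\<gamma>. iexp (t * snd p))"
    unfolding char_def marg[symmetric] by (subst integral_distr; simp)+
  then have "char \<mu> t - char \<nu> t = (CLINT p|\<gamma>. iexp (t * fst p) - iexp (t * snd p))"
    using iexp_int[of fst] iexp_int[of snd] by (subst Bochner_Integration.integral_diff) auto
  also have "cmod \<dots> \<le> (LINT p|\<gamma>. cmod (iexp (t * fst p) - iexp (t * snd p)))"
    by (rule integral_norm_bound)
  also have "\<dots> \<le> (LINT p|\<gamma>. \<bar>t\<bar> * ((fst p - snd p)\<^sup>2 / (2 * \<epsilon>) + \<epsilon> / 2))"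
  proof (rule integral_mono)
    show "integrable \<gamma> (\<lambda>p. cmod (iexp (t * fst p) - iexp (t * snd p)))"
      using iexp_int[of fst] iexp_int[of snd]
      by (intro integrable_norm Bochner_Integration.integrable_diff) auto
    show "integrable \<gamma> (\<lambda>p. \<bar>t\<bar> * ((fst p - snd p)\<^sup>2 / (2 * \<epsilon>) + \<epsilon> / 2))"
      using int by simp
    fix p :: "real \<times> real"
    have "iexp (t * fst p) - iexp (t * snd p) = iexp (t * snd p) * (iexp (t * (fst p - snd p)) - 1)"
      by (simp add: algebra_simps flip: exp_add)
    then have "cmod (iexp (t * fst p) - iexp (t * snd p)) = cmod (iexp (t * (fst p - snd p)) - 1)"
      by (simp add: norm_mult)
    also have "\<dots> \<le> \<bar>t * (fst p - snd p)\<bar>"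
      using iexp_approx1[of "t * (fst p - snd p)" 0] by simp
    also have "\<dots> \<le> \<bar>t\<bar> * ((fst p - snd p)\<^sup>2 / (2 * \<epsilon>) + \<epsilon> / 2)"
    proof -
      have "0 \<le> (\<bar>fst p - snd p\<bar> - \<epsilon>)\<^sup>2" by simp
      then have "2 * \<epsilon> * \<bar>fst p - snd p\<bar> \<le> (fst p - snd p)\<^sup>2 + \<epsilon>\<^sup>2"
        by (simp add: power2_diff algebra_simps)
      then have "\<bar>fst p - snd p\<bar> \<le> (fst p - snd p)\<^sup>2 / (2 * \<epsilon>) + \<epsilon> / 2"
        using \<open>0 < \<epsilon>\<close> by (simp add: field_simps power2_eq_square)
      then show ?thesis unfolding abs_mult by (rule mult_left_mono) simp
    qed
    finally show "cmod (iexp (t * fst p) - iexp (t * snd p)) \<le> \<bar>t\<bar> * ((fst p - snd p)\<^sup>2 / (2 * \<epsilon>) + \<epsilon> / 2)" .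
  qed
  also have "\<dots> = \<bar>t\<bar> * ((LINT p|\<gamma>. (fst p - snd p)\<^sup>2) / (2 * \<epsilon>) + \<epsilon> / 2)"
    using int by (simp add: prob_space)
  also have "\<dots> \<le> \<bar>t\<bar> * (\<epsilon>\<^sup>2 / (2 * \<epsilon>) + \<epsilon> / 2)"
    using J2 \<open>0 < \<epsilon>\<close> by (intro mult_left_mono add_right_mono divide_right_mono) auto
  also have "\<dots> = \<bar>t\<bar> * \<epsilon>"
    using \<open>0 < \<epsilon>\<close> by (simp add: power2_eq_square)
  finally show ?thesis .
qed

lemma wasserstein2_imp_weak_conv:
  assumes \<mu>: "\<And>n. real_distribution (\<mu> n)" and \<nu>: "real_distribution \<nu>"
    and lim: "(\<lambda>n. wasserstein2 (\<mu> n) \<nu>) \<longlonglongrightarrow> 0"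
  shows "weak_conv_m \<mu> \<nu>"
proof (rule levy_continuity[OF \<mu> \<nu>])
  fix t
  show "(\<lambda>n. char (\<mu> n) t) \<longlonglongrightarrow> char \<nu> t"
  proof (rule tendstoI)
    fix e :: real assume "0 < e"
    define \<epsilon> where "\<epsilon> = e / (\<bar>t\<bar> + 1)"
    have \<epsilon>: "0 < \<epsilon>" "\<bar>t\<bar> * \<epsilon> < e" using \<open>0 < e\<close> by (auto simp: \<epsilon>_def field_simps)
    have "\<forall>\<^sub>F n in sequentially. wasserstein2 (\<mu> n) \<nu> < ennreal \<epsilon>"
      using order_tendstoD(2)[OF lim, of "ennreal \<epsilon>"] \<epsilon> by simp
    then show "\<forall>\<^sub>F n in sequentially. dist (char (\<mu> n) t) (char \<nu> t) < e"
    proof eventually_elim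
      case (elim n)
      then show ?case
        using char_diff_le_wasserstein2[OF \<mu> \<nu> \<epsilon>(1) elim, of t] \<epsilon>(2) by (simp add: dist_norm)
    qed
  qed
qed

text \<open>The uniform bound on the moments of order \<open>2 * k\<close> makes the error of
  truncation at \<open>R\<close> small uniformly in \<open>n\<close>. For even \<open>k\<close> the
  power is nonnegative, so a cut from above already produces a bounded continuous function.\<close>

lemma weak_conv_imp_even_moment_conv:
  assumes \<mu>: "\<And>n. real_distribution (\<mu> n)" and \<nu>: "real_distribution \<nu>"
    and conv: "weak_conv_m \<mu> \<nu>" and "even k"
    and int: "\<And>n k. integrable (\<mu> n) (\<lambda>x. x ^ k)" "\<And>k. integrable \<nu> (\<lambda>x. x ^ k)"
    and C: "\<And>n. (LINT x|\<mu> n. x ^ (2 * k)) \<le> C" "(LINT x|\<nu>. x ^ (2 * k)) \<le> C"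
  shows "(\<lambda>n. LINT x|\<mu> n. x ^ k) \<longlonglongrightarrow> (LINT x|\<nu>. x ^ k)"
proof (rule tendstoI)
  fix e :: real assume "0 < e"
  define R where "R = 4 * (\<bar>C\<bar> + 1) / e"
  have R: "0 < R" "\<bar>C\<bar> / R \<le> e / 4" using \<open>0 < e\<close> by (auto simp: R_def field_simps)
  define f where "f x = min (x ^ k) R" for x :: real
  have nonneg: "0 \<le> x ^ k" for x :: real using \<open>even k\<close> by (rule zero_le_even_power)
  have f_bound: "norm (f x) \<le> R" for x using nonneg[of x] R by (auto simp: f_def)
  have trunc: "\<bar>(LINT x|\<kappa>. x ^ k) - (LINT x|\<kappa>. f x)\<bar> \<le> e / 4"
    if "real_distribution \<kappa>" and int: "\<And>k. integrable \<kappa> (\<lambda>x. x ^ k)" and C: "(LINT x|\<kappa>. x ^ (2 * k)) \<le> C" for \<kappa>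
  proof -
    interpret real_distribution \<kappa> by fact
    have f_int: "integrable \<kappa> f"
      by (rule integrable_const_bound[where B = R]) (use f_bound in \<open>auto simp: f_def[abs_def]\<close>)
    \<comment> \<open>Where the cut is active, \<open>x ^ k / R\<close> exceeds 1, which trades the
      excess for the moment of twice the order.\<close>
    have pw: "\<bar>x ^ k - f x\<bar> \<le> x ^ (2 * k) / R" for x
    proof (cases "x ^ k \<le> R")
      case True
      then show ?thesis using R by (simp add: f_def power_mult power2_eq_square)
    next
      case False
      then have "x ^ k - R \<le> x ^ k * (x ^ k / R)"
      proof -
        have "x ^ k * 1 \<le> x ^ k * (x ^ k / R)"
          using False R nonneg[of x] by (intro mult_left_mono) auto
        then show ?thesis using R by simp
      qed
      then show ?thesis using False R by (simp add: f_def mult_2 power_add)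
    qed
    have "(LINT x|\<kappa>. x ^ k) - (LINT x|\<kappa>. f x) = (LINT x|\<kappa>. x ^ k - f x)"
      using int f_int by simp
    also have "\<bar>\<dots>\<bar> \<le> (LINT x|\<kappa>. \<bar>x ^ k - f x\<bar>)" by (rule integral_abs_bound)
    also have "\<dots> \<le> (LINT x|\<kappa>. x ^ (2 * k) / R)"
      using int f_int pw by (intro integral_mono) auto
    also have "\<dots> \<le> \<bar>C\<bar> / R" using C R by (simp add: divide_right_mono)
    finally show ?thesis using R(2) by linarith
  qed
  have "(\<lambda>n. LINT x|\<mu> n. f x) \<longlonglongrightarrow> (LINT x|\<nu>. f x)"
    using \<mu> \<nu> conv f_bound
    by (intro weak_conv_imp_integral_bdd_continuous_conv) (auto simp: f_def[abs_def] intro!: continuous_intros)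
  then have "\<forall>\<^sub>F n in sequentially. dist (LINT x|\<mu> n. f x) (LINT x|\<nu>. f x) < e / 4"
    using \<open>0 < e\<close> by (intro tendstoD) auto
  then show "\<forall>\<^sub>F n in sequentially. dist (LINT x|\<mu> n. x ^ k) (LINT x|\<nu>. x ^ k) < e"
  proof eventually_elim
    case (elim n)
    have "\<bar>(LINT x|\<mu> n. x ^ k) - (LINT x|\<mu> n. f x)\<bar> \<le> e / 4" by (rule trunc[OF \<mu> int(1) C(1)])
    moreover have "\<bar>(LINT x|\<nu>. x ^ k) - (LINT x|\<nu>. f x)\<bar> \<le> e / 4" by (rule trunc[OF \<nu> int(2) C(2)])
    ultimately show ?case using elim \<open>0 < e\<close> unfolding dist_real_def by linarith
  qed
qed

section \<open>The law of a product of independent standard normal variables\<close>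

definition normal_product_law :: "real measure" where
  "normal_product_law = distr (std_normal_distribution \<Otimes>\<^sub>M std_normal_distribution) borel (\<lambda>(x, y). x * y)"

lemma (in prob_space) distr_normal_product:
  fixes X Y :: "'a \<Rightarrow> real"
  assumes indep: "indep_var borel X borel Y"
    and X: "distr M borel X = std_normal_distribution" and Y: "distr M borel Y = std_normal_distribution"
  shows "distr M borel (\<lambda>\<omega>. X \<omega> * Y \<omega>) = normal_product_law"
proof -
  have [measurable]: "X \<in> borel_measurable M" "Y \<in> borel_measurable M"
    using indep by (auto dest: indep_var_rv1 indep_var_rv2)
  have eq: "std_normal_distribution \<Otimes>\<^sub>M std_normal_distribution = distr M (borel \<Otimes>\<^sub>M borel) (\<lambda>\<omega>. (X \<omega>, Y \<omega>))"
    using indep X Y unfolding indep_var_distribution_eq by simp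
  show ?thesis
    unfolding normal_product_law_def eq by (subst distr_distr) (auto simp: comp_def)
qed

lemma (in prob_space) normal_product_moments:
  fixes X Y :: "'a \<Rightarrow> real"
  assumes indep: "indep_var borel X borel Y"
    and X: "distr M borel X = std_normal_distribution" and Y: "distr M borel Y = std_normal_distribution"
  shows "integrable M (\<lambda>\<omega>. (X \<omega> * Y \<omega>) ^ k)"
    and "expectation (\<lambda>\<omega>. (X \<omega> * Y \<omega>) ^ k) = (LINT x|std_normal_distribution. x ^ k)\<^sup>2"
proof -
  have [measurable]: "X \<in> borel_measurable M" "Y \<in> borel_measurable M"
    using indep by (auto dest: indep_var_rv1 indep_var_rv2)
  have int: "integrable M (\<lambda>\<omega>. Z \<omega> ^ k)" "expectation (\<lambda>\<omega>. Z \<omega> ^ k) = (LINT x|std_normal_distribution. x ^ k)"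
    if [measurable]: "Z \<in> borel_measurable M" and Z: "distr M borel Z = std_normal_distribution" for Z
    using integrable_std_normal_distribution_moment[of k] unfolding Z[symmetric]
    by (simp_all add: integrable_distr_eq integral_distr)
  have ind: "indep_var borel (\<lambda>\<omega>. X \<omega> ^ k) borel (\<lambda>\<omega>. Y \<omega> ^ k)"
    using indep_var_compose[OF indep, of "\<lambda>x. x ^ k" borel "\<lambda>x. x ^ k" borel] by (simp add: comp_def)
  show "integrable M (\<lambda>\<omega>. (X \<omega> * Y \<omega>) ^ k)"
    unfolding power_mult_distrib using X Y by (intro indep_var_integrable ind int) auto
  show "expectation (\<lambda>\<omega>. (X \<omega> * Y \<omega>) ^ k) = (LINT x|std_normal_distribution. x ^ k)\<^sup>2"
    unfolding power_mult_distrib using X Y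
    by (subst indep_var_lebesgue_integral[OF ind]) (auto simp: int power2_eq_square)
qed

context isonormal
begin

text \<open>Rotation by 45 degrees: the normalised sum and difference of \<open>a\<close> and
  \<open>b\<close> are again orthonormal, so the difference of squares factors into a product of two
  independent standard normal variables.\<close>

lemma distr_square_diff:
  assumes "orthonormal S" "a \<in> S" "b \<in> S" "a \<noteq> b"
  shows "distr M borel (\<lambda>\<omega>. ((W a \<omega>)\<^sup>2 - (W b \<omega>)\<^sup>2) / 2) = normal_product_law"
proof -
  define f g where "f = (1 / sqrt 2) *\<^sub>R (a + b)" and "g = (1 / sqrt 2) *\<^sub>R (a - b)"
  have ab: "a \<bullet> a = 1" "b \<bullet> b = 1" "a \<bullet> b = 0" "b \<bullet> a = 0"
    using assms by (auto simp: orthonormal_def norm_eq_1 pairwise_def orthogonal_def)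
  have fg: "f \<bullet> f = 1" "g \<bullet> g = 1" "f \<bullet> g = 0" "g \<bullet> f = 0"
    by (simp_all add: f_def g_def inner_add inner_diff ab field_simps)
  then have "f \<noteq> g" by auto
  have fg_on: "orthonormal {f, g}"
    using fg by (auto simp: orthonormal_def norm_eq_1 pairwise_def orthogonal_def)
  have "indep_var borel (W f) borel (\<lambda>\<omega>. \<Sum>h\<in>{g}. W h \<omega>)"
    using \<open>f \<noteq> g\<close> indep_vars_orthonormal[OF _ fg_on] by (intro indep_vars_sum) auto
  then have indep: "indep_var borel (W f) borel (W g)" by simp
  have "AE \<omega> in M. W f \<omega> = (\<Sum>e\<in>{a, b}. (1 / sqrt 2) * W e \<omega>)"
    by (rule AE_W_linear) (use assms in \<open>auto simp: f_def scaleR_add_right\<close>)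
  moreover have "AE \<omega> in M. W g \<omega> = (\<Sum>e\<in>{a, b}. (if e = a then 1 / sqrt 2 else - (1 / sqrt 2)) * W e \<omega>)"
    by (rule AE_W_linear) (use assms in \<open>auto simp: g_def scaleR_diff_right\<close>)
  ultimately have "AE \<omega> in M. ((W a \<omega>)\<^sup>2 - (W b \<omega>)\<^sup>2) / 2 = W f \<omega> * W g \<omega>"
  proof eventually_elim
    case (elim \<omega>)
    have "W f \<omega> = (W a \<omega> + W b \<omega>) / sqrt 2" "W g \<omega> = (W a \<omega> - W b \<omega>) / sqrt 2"
      using elim assms by (auto simp: field_simps)
    then show ?case by (simp add: power2_eq_square algebra_simps)
  qed
  then have "distr M borel (\<lambda>\<omega>. ((W a \<omega>)\<^sup>2 - (W b \<omega>)\<^sup>2) / 2) = distr M borel (\<lambda>\<omega>. W f \<omega> * W g \<omega>)"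
    by (intro distr_cong_AE) auto
  also have "\<dots> = normal_product_law"
    using fg by (intro distr_normal_product indep distr_W_unit) (auto simp: norm_eq_1)
  finally show ?thesis .
qed

text \<open>The target is itself a diagonal form, with eigenvalue 1 at \<open>a\<close>, -1 at
  \<open>b\<close> and 0 elsewhere. The difference is thus diagonal in \<open>y - v\<close>, and its
  second moment is half of its second power sum.\<close>

lemma square_dist_two_eigenvalues:
  assumes S: "finite S" "orthonormal S" and ab: "a \<in> S" "b \<in> S" "a \<noteq> b"
  shows "expectation (\<lambda>\<omega>. ((\<Sum>e\<in>S. y e / 2 * ((W e \<omega>)\<^sup>2 - 1)) - ((W a \<omega>)\<^sup>2 - (W b \<omega>)\<^sup>2) / 2)\<^sup>2)
    = ((y a - 1)\<^sup>2 + (y b + 1)\<^sup>2 + power_sum (S - {a, b}) y 2) / 2"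
proof -
  define v :: "'h \<Rightarrow> real" where "v e = (if e = a then 1 else if e = b then - 1 else 0)" for e
  have split: "sum f S = f a + f b + sum f (S - {a, b})" for f :: "'h \<Rightarrow> real"
    using S ab by (simp add: sum.remove[of S a] sum.remove[of "S - {a}" b] Diff_insert2[symmetric] insert_commute add.assoc)
  have rest: "sum f (S - {a, b}) = sum g (S - {a, b})" if "\<And>e. e \<noteq> a \<Longrightarrow> e \<noteq> b \<Longrightarrow> f e = g e" for f g :: "'h \<Rightarrow> real"
    using that by (intro sum.cong) auto
  have "(\<Sum>e\<in>S. v e / 2 * ((W e \<omega>)\<^sup>2 - 1)) = ((W a \<omega>)\<^sup>2 - (W b \<omega>)\<^sup>2) / 2" for \<omega>
    unfolding split using ab rest[of "\<lambda>e. v e / 2 * ((W e \<omega>)\<^sup>2 - 1)" "\<lambda>_. 0"]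
    by (simp add: v_def field_simps)
  then have "(\<Sum>e\<in>S. y e / 2 * ((W e \<omega>)\<^sup>2 - 1)) - ((W a \<omega>)\<^sup>2 - (W b \<omega>)\<^sup>2) / 2
      = (\<Sum>e\<in>S. (y e - v e) / 2 * ((W e \<omega>)\<^sup>2 - 1))" for \<omega>
    by (simp only: diff_divide_distrib left_diff_distrib sum_subtractf)
  moreover have "power_sum S (\<lambda>e. y e - v e) 2 = (y a - 1)\<^sup>2 + (y b + 1)\<^sup>2 + power_sum (S - {a, b}) y 2"
    unfolding power_sum_def split using ab rest[of "\<lambda>e. (y e - v e)\<^sup>2" "\<lambda>e. (y e)\<^sup>2"]
    by (simp add: v_def)
  ultimately show ?thesis
    using moments_orthonormal(2)[OF S, of "\<lambda>e. y e - v e" 2] by (simp add: eval_nat_numeral)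
qed

end

section \<open>Equivalence of the three assertions\<close>

context isonormal
begin

text \<open>The coupling lives on the given probability space: \<open>Y n\<close> is formed from the
  same process at the two eigenvectors singled out in the limit. It has the limit law only
  eventually, which is enough for a statement about limits.\<close>

lemma moments_imp_normal_product_coupling:
  assumes F: "\<And>n. F n \<in> second_wiener_chaos M W"
    and F2: "\<And>n. expectation (\<lambda>\<omega>. (F n \<omega>)\<^sup>2) = 1"
    and F4: "(\<lambda>n. expectation (\<lambda>\<omega>. F n \<omega> ^ 4)) \<longlonglongrightarrow> 9"
    and "r \<ge> 3"
    and Fr: "(\<lambda>n. expectation (\<lambda>\<omega>. F n \<omega> ^ (2 * r))) \<longlonglongrightarrow> cmoment alt_cumulants (2 * r)"
  obtains Y :: "nat \<Rightarrow> 'a \<Rightarrow> real" where "\<And>n. Y n \<in> borel_measurable M"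
    "\<forall>\<^sub>F n in sequentially. distr M borel (Y n) = normal_product_law"
    "\<And>n. integrable M (\<lambda>\<omega>. (F n \<omega> - Y n \<omega>)\<^sup>2)"
    "(\<lambda>n. expectation (\<lambda>\<omega>. (F n \<omega> - Y n \<omega>)\<^sup>2)) \<longlonglongrightarrow> 0"
proof -
  note F_meas[measurable] = second_wiener_chaos_approx(1)[OF F]
  \<comment> \<open>One simple integral per \<open>n\<close>, with squared error below
    \<open>1 / (n + 1)\<close>, suffices: the two sequences then have the same limits of
    moments.\<close>
  have "\<exists>cs. expectation (\<lambda>\<omega>. (F n \<omega> - simple_wiener_I2 W cs \<omega>)\<^sup>2) < inverse (real (Suc n))" for n
  proof -
    obtain cs where "(\<lambda>k. expectation (\<lambda>\<omega>. (F n \<omega> - simple_wiener_I2 W (cs k) \<omega>)\<^sup>2)) \<longlonglongrightarrow> 0"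
      using second_wiener_chaos_approx(3)[OF F] by blast
    then have "\<forall>\<^sub>F k in sequentially. expectation (\<lambda>\<omega>. (F n \<omega> - simple_wiener_I2 W (cs k) \<omega>)\<^sup>2) < inverse (real (Suc n))"
      by (rule order_tendstoD) simp
    then show ?thesis using eventually_happens'[OF sequentially_bot] by blast
  qed
  then obtain cs where cs: "\<And>n. expectation (\<lambda>\<omega>. (F n \<omega> - simple_wiener_I2 W (cs n) \<omega>)\<^sup>2) < inverse (real (Suc n))"
    by metis
  define G where "G n = simple_wiener_I2 W (cs n)" for n
  have G_meas[measurable]: "G n \<in> borel_measurable M" for n by (simp add: G_def)
  have G_int: "integrable M (\<lambda>\<omega>. G n \<omega> ^ k)" for n k
    unfolding G_def by (rule simple_wiener_I2_integrable)
  have D_int: "integrable M (\<lambda>\<omega>. (F n \<omega> - G n \<omega>)\<^sup>2)" for n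
    unfolding G_def by (rule integrable_diff_simple[OF F])
  have D_nonneg: "0 \<le> expectation (\<lambda>\<omega>. (F n \<omega> - G n \<omega>)\<^sup>2)" for n
    by (intro Bochner_Integration.integral_nonneg) auto
  have FG: "(\<lambda>n. expectation (\<lambda>\<omega>. (F n \<omega> - G n \<omega>)\<^sup>2)) \<longlonglongrightarrow> 0"
    by (rule tendsto_sandwich[OF _ _ tendsto_const LIMSEQ_inverse_real_of_nat])
      (use D_nonneg less_imp_le[OF cs] in \<open>auto simp: G_def intro!: always_eventually\<close>)
  have C0: "0 \<le> hypercontractivity_const p" for p
    unfolding hypercontractivity_const_def by (rule cmoment_nonneg) simp
  \<comment> \<open>Twice the squared error, which is at most 1, plus twice the second moment of
    \<open>F n\<close>, which is 1.\<close>
  have G2: "expectation (\<lambda>\<omega>. (G n \<omega>)\<^sup>2) \<le> 4" for n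
  proof -
    have "integrable M (\<lambda>\<omega>. (G n \<omega> - F n \<omega>)\<^sup>2)" "integrable M (\<lambda>\<omega>. (F n \<omega> - 0)\<^sup>2)"
      using D_int[of n] second_wiener_chaos_approx(2)[OF F] by (simp_all add: power2_commute)
    from integral_square_diff_triangle[OF this]
    have "expectation (\<lambda>\<omega>. (G n \<omega>)\<^sup>2) \<le> 2 * expectation (\<lambda>\<omega>. (F n \<omega> - G n \<omega>)\<^sup>2) + 2"
      by (simp add: F2 power2_commute)
    moreover have "inverse (real (Suc n)) \<le> 1" by (simp add: inverse_le_1_iff)
    ultimately show ?thesis using cs[of n] unfolding G_def by linarith
  qed
  have F_bound: "expectation (\<lambda>\<omega>. F n \<omega> ^ (2 * k)) \<le> hypercontractivity_const k * 4 ^ k" for n k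
  proof -
    have "expectation (\<lambda>\<omega>. F n \<omega> ^ (2 * k)) \<le> hypercontractivity_const k * 1 ^ k"
      using second_wiener_chaos_hypercontractive(2)[OF F, of n k] by (simp add: F2)
    also have "\<dots> \<le> hypercontractivity_const k * 4 ^ k"
      by (intro mult_left_mono power_mono C0) auto
    finally show ?thesis .
  qed
  have G_bound: "expectation (\<lambda>\<omega>. G n \<omega> ^ (2 * k)) \<le> hypercontractivity_const k * 4 ^ k" for n k
  proof -
    have "expectation (\<lambda>\<omega>. G n \<omega> ^ (2 * k)) \<le> hypercontractivity_const k * expectation (\<lambda>\<omega>. (G n \<omega>)\<^sup>2) ^ k"
      unfolding G_def by (rule simple_wiener_I2_hypercontractive)
    also have "\<dots> \<le> hypercontractivity_const k * 4 ^ k"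
      using G2 by (intro mult_left_mono power_mono C0) (auto intro!: Bochner_Integration.integral_nonneg)
    finally show ?thesis .
  qed
  have FG_moments: "(\<lambda>n. expectation (\<lambda>\<omega>. F n \<omega> ^ k) - expectation (\<lambda>\<omega>. G n \<omega> ^ k)) \<longlonglongrightarrow> 0" for k
    by (rule moments_asymptotically_equal[OF second_wiener_chaos_integrable[OF F] F_bound G_int G_bound D_int FG])
  have G_lim: "(\<lambda>n. expectation (\<lambda>\<omega>. G n \<omega> ^ k)) \<longlonglongrightarrow> l"
    if "(\<lambda>n. expectation (\<lambda>\<omega>. F n \<omega> ^ k)) \<longlonglongrightarrow> l" for k l
    using tendsto_diff[OF that FG_moments[of k]] by simp
  have "\<forall>n. \<exists>Sy. finite (fst Sy) \<and> orthonormal (fst Sy) \<and>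
      (AE \<omega> in M. G n \<omega> = (\<Sum>e\<in>fst Sy. snd Sy e / 2 * ((W e \<omega>)\<^sup>2 - 1)))"
  proof
    fix n
    obtain S y where "finite S" "orthonormal S" "AE \<omega> in M. G n \<omega> = (\<Sum>e\<in>S. y e / 2 * ((W e \<omega>)\<^sup>2 - 1))"
      unfolding G_def by (rule simple_wiener_I2_diagonal)
    then show "\<exists>Sy. finite (fst Sy) \<and> orthonormal (fst Sy) \<and>
        (AE \<omega> in M. G n \<omega> = (\<Sum>e\<in>fst Sy. snd Sy e / 2 * ((W e \<omega>)\<^sup>2 - 1)))"
      by (intro exI[of _ "(S, y)"]) simp
  qed
  from choice[OF this] obtain Sy where Sy: "\<forall>n. finite (fst (Sy n)) \<and> orthonormal (fst (Sy n)) \<and>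
      (AE \<omega> in M. G n \<omega> = (\<Sum>e\<in>fst (Sy n). snd (Sy n) e / 2 * ((W e \<omega>)\<^sup>2 - 1)))" ..
  define S y where "S n = fst (Sy n)" and "y n = snd (Sy n)" for n
  have S: "finite (S n)" "orthonormal (S n)"
    and G_eq: "AE \<omega> in M. G n \<omega> = (\<Sum>e\<in>S n. y n e / 2 * ((W e \<omega>)\<^sup>2 - 1))" for n
    using Sy by (simp_all add: S_def y_def)
  define m where "m n j = power_sum (S n) (y n) (j + 2) / 2" for n j
  have mom: "expectation (\<lambda>\<omega>. G n \<omega> ^ k) = cmoment (m n) k" for n k
    using simple_wiener_I2_moments(2)[OF S G_eq[unfolded G_def]] by (simp add: G_def m_def[abs_def])
  \<comment> \<open>These two formulas are solved for \<open>m n 0\<close> and \<open>m n 2\<close>;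
    the limits 1 and 9 of the moments make both tend to 1.\<close>
  have cm2: "cmoment (m n) 2 = m n 0" and cm4: "cmoment (m n) 4 = 3 * (m n 0)\<^sup>2 + 6 * m n 2" for n
    by (simp_all add: eval_nat_numeral)
  have "(\<lambda>n. cmoment (m n) 2) \<longlonglongrightarrow> 1"
    unfolding mom[symmetric] by (rule G_lim) (simp add: F2)
  then have m0: "(\<lambda>n. m n 0) \<longlonglongrightarrow> 1" by (simp add: cm2)
  have "(\<lambda>n. cmoment (m n) 4) \<longlonglongrightarrow> 9"
    unfolding mom[symmetric] by (rule G_lim[OF F4])
  then have "(\<lambda>n. (cmoment (m n) 4 - 3 * (m n 0)\<^sup>2) / 6) \<longlonglongrightarrow> (9 - 3 * 1\<^sup>2) / 6"
    by (intro tendsto_intros m0) auto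
  then have m2: "(\<lambda>n. m n 2) \<longlonglongrightarrow> 1" by (simp add: cm4)
  have p2: "(\<lambda>n. power_sum (S n) (y n) 2) \<longlonglongrightarrow> 2"
    using tendsto_mult[OF tendsto_const[of 2] m0] by (simp add: m_def numeral_2_eq_2)
  have p4: "(\<lambda>n. power_sum (S n) (y n) 4) \<longlonglongrightarrow> 2"
    using tendsto_mult[OF tendsto_const[of 2] m2] by (simp add: m_def)
  have "(\<lambda>n. cmoment (m n) (2 * r)) \<longlonglongrightarrow> cmoment alt_cumulants (2 * r)"
    unfolding mom[symmetric] by (rule G_lim[OF Fr])
  then have lim_r: "(\<lambda>n. cmoment (\<lambda>j. power_sum (S n) (y n) (j + 2) / 2) (2 * r)) \<longlonglongrightarrow> cmoment alt_cumulants (2 * r)"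
    by (simp add: m_def[abs_def])
  note p63 = power_sums_limit_of_cmoment[OF S(1) p2 p4 \<open>r \<ge> 3\<close> lim_r]
  obtain a b where ab: "\<forall>\<^sub>F n in sequentially. a n \<in> S n \<and> b n \<in> S n \<and> a n \<noteq> b n"
    and lim0: "(\<lambda>n. (y n (a n) - 1)\<^sup>2 + (y n (b n) + 1)\<^sup>2 + power_sum (S n - {a n, b n}) (y n) 2) \<longlonglongrightarrow> 0"
    by (rule two_eigenvalues_limit[OF S(1) p2 p63(2) p4 p63(1)])
  \<comment> \<open>For small \<open>n\<close> nothing is known about \<open>a n\<close> and
    \<open>b n\<close>, but measurability and square integrability of \<open>Y n\<close> hold for
    any two vectors.\<close>
  define Y where "Y n \<omega> = ((W (a n) \<omega>)\<^sup>2 - (W (b n) \<omega>)\<^sup>2) / 2" for n \<omega>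
  have Y_meas[measurable]: "Y n \<in> borel_measurable M" for n
    unfolding Y_def[abs_def] by measurable
  have Y_int: "integrable M (\<lambda>\<omega>. (Y n \<omega>)\<^sup>2)" for n
  proof -
    have "integrable M (\<lambda>\<omega>. ((W (a n) \<omega>)\<^sup>2 - (W (b n) \<omega>)\<^sup>2)\<^sup>2)"
      by (rule integrable_square_diff) (simp_all add: integrable_W_power flip: power_mult)
    then show ?thesis by (simp add: Y_def power_divide)
  qed
  have GY_int: "integrable M (\<lambda>\<omega>. (G n \<omega> - Y n \<omega>)\<^sup>2)" for n
    by (rule integrable_square_diff[OF G_meas Y_meas G_int Y_int])
  have FY_int: "integrable M (\<lambda>\<omega>. (F n \<omega> - Y n \<omega>)\<^sup>2)" for n
    by (rule integrable_square_diff[OF F_meas Y_meas second_wiener_chaos_approx(2)[OF F] Y_int])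
  have GY: "(\<lambda>n. expectation (\<lambda>\<omega>. (G n \<omega> - Y n \<omega>)\<^sup>2)) \<longlonglongrightarrow> 0"
  proof (rule Lim_transform_eventually)
    show "(\<lambda>n. ((y n (a n) - 1)\<^sup>2 + (y n (b n) + 1)\<^sup>2 + power_sum (S n - {a n, b n}) (y n) 2) / 2) \<longlonglongrightarrow> 0"
      using tendsto_divide[OF lim0 tendsto_const[of 2]] by simp
    show "\<forall>\<^sub>F n in sequentially. ((y n (a n) - 1)\<^sup>2 + (y n (b n) + 1)\<^sup>2 + power_sum (S n - {a n, b n}) (y n) 2) / 2
        = expectation (\<lambda>\<omega>. (G n \<omega> - Y n \<omega>)\<^sup>2)"
      using ab
    proof eventually_elim
      case (elim n)
      have "AE \<omega> in M. (G n \<omega> - Y n \<omega>)\<^sup>2 = ((\<Sum>e\<in>S n. y n e / 2 * ((W e \<omega>)\<^sup>2 - 1)) - ((W (a n) \<omega>)\<^sup>2 - (W (b n) \<omega>)\<^sup>2) / 2)\<^sup>2"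
        using G_eq[of n] by eventually_elim (simp add: Y_def)
      then have "expectation (\<lambda>\<omega>. (G n \<omega> - Y n \<omega>)\<^sup>2)
          = expectation (\<lambda>\<omega>. ((\<Sum>e\<in>S n. y n e / 2 * ((W e \<omega>)\<^sup>2 - 1)) - ((W (a n) \<omega>)\<^sup>2 - (W (b n) \<omega>)\<^sup>2) / 2)\<^sup>2)"
        by (rule integral_cong_AE[rotated 2]) measurable
      then show ?case
        using square_dist_two_eigenvalues[OF S, of "a n" n "b n" "y n"] elim by simp
    qed
  qed
  have "(\<lambda>n. 2 * expectation (\<lambda>\<omega>. (F n \<omega> - G n \<omega>)\<^sup>2) + 2 * expectation (\<lambda>\<omega>. (G n \<omega> - Y n \<omega>)\<^sup>2)) \<longlonglongrightarrow> 2 * 0 + 2 * 0"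
    by (intro tendsto_intros FG GY)
  then have upper: "(\<lambda>n. 2 * expectation (\<lambda>\<omega>. (F n \<omega> - G n \<omega>)\<^sup>2) + 2 * expectation (\<lambda>\<omega>. (G n \<omega> - Y n \<omega>)\<^sup>2)) \<longlonglongrightarrow> 0"
    by simp
  have FY: "(\<lambda>n. expectation (\<lambda>\<omega>. (F n \<omega> - Y n \<omega>)\<^sup>2)) \<longlonglongrightarrow> 0"
    by (rule tendsto_sandwich[OF _ _ tendsto_const upper])
      (auto intro!: always_eventually Bochner_Integration.integral_nonneg integral_square_diff_triangle D_int GY_int)
  have "\<forall>\<^sub>F n in sequentially. distr M borel (Y n) = normal_product_law"
    using ab by eventually_elim (auto simp: Y_def[abs_def] intro: distr_square_diff[OF S(2)])
  from that[OF Y_meas this FY_int FY] show ?thesis .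
qed

end

theorem theorem1p3:
  fixes M :: "'a measure"
    and W :: "'h::{real_inner,polish_space} \<Rightarrow> 'a \<Rightarrow> real"
    and F :: "nat \<Rightarrow> 'a \<Rightarrow> real"
    and P :: "'b measure" and N1 N2 :: "'b \<Rightarrow> real"
    and Q :: "'c measure" and Finf :: "'c \<Rightarrow> real"
  assumes "prob_space M"
    and "isonormal_gaussian_process M W"
    and "\<And>n. n \<ge> 1 \<Longrightarrow> F n \<in> second_wiener_chaos M W"
    and "\<And>n. n \<ge> 1 \<Longrightarrow> moment M 2 (F n) = 1"
    and "prob_space P"
    and "distributed P lborel N1 std_normal_density"
    and "distributed P lborel N2 std_normal_density"
    and "prob_space.indep_var P borel N1 borel N2"
    and "prob_space Q"
    and "Finf \<in> borel_measurable Q"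
    and "distr Q borel Finf = distr P borel (\<lambda>\<omega>. N1 \<omega> * N2 \<omega>)"
  shows "((\<lambda>n. wasserstein2 (distr M borel (F n)) (distr Q borel Finf)) \<longlonglongrightarrow> 0
            \<longleftrightarrow> weak_conv_m (\<lambda>n. distr M borel (F n)) (distr Q borel Finf))
       \<and> (weak_conv_m (\<lambda>n. distr M borel (F n)) (distr Q borel Finf)
            \<longleftrightarrow> (\<lambda>n. moment M 4 (F n)) \<longlonglongrightarrow> 9
                \<and> (\<exists>r\<ge>3. (\<lambda>n. moment M (2 * r) (F n)) \<longlonglongrightarrow> (real (double_fact (2 * r - 1)))\<^sup>2))"
    (is "(?I \<longleftrightarrow> ?II) \<and> (?II \<longleftrightarrow> ?III)")
proof -
  interpret isonormal M W
    using assms(1,2) by (simp add: isonormal_def isonormal_axioms_def)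
  interpret P: prob_space P by fact
  let ?L = "distr Q borel Finf"
  \<comment> \<open>The assumptions on \<open>F\<close> start at index 1, so the argument runs on
    the shifted sequence, which has the same limits.\<close>
  define F' where "F' n = F (Suc n)" for n
  have F': "F' n \<in> second_wiener_chaos M W" for n using assms(3) by (simp add: F'_def)
  have F'2: "expectation (\<lambda>\<omega>. (F' n \<omega>)\<^sup>2) = 1" for n
    using assms(4)[of "Suc n"] by (simp add: F'_def moment_def)
  note F'_meas[measurable] = second_wiener_chaos_approx(1)[OF F']
  have distr_N: "distr P borel N = std_normal_distribution" if "distributed P lborel N std_normal_density" for N
  proof -
    have "distr P borel N = distr P lborel N" by (rule distr_cong) auto
    then show ?thesis using that by (simp add: distributed_def)
  qed
  note N12 = assms(8) distr_N[OF assms(6)] distr_N[OF assms(7)]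
  have [measurable]: "N1 \<in> borel_measurable P" "N2 \<in> borel_measurable P"
    using assms(8) by (auto dest: P.indep_var_rv1 P.indep_var_rv2)
  have L: "?L = normal_product_law"
    using assms(11) P.distr_normal_product[OF N12] by simp
  have L_int: "integrable ?L (\<lambda>x. x ^ k)" for k
    unfolding assms(11) using P.normal_product_moments(1)[OF N12, of k] by (subst integrable_distr_eq) auto
  have L_mom: "(LINT x|?L. x ^ k) = (LINT x|std_normal_distribution. x ^ k)\<^sup>2" for k
    unfolding assms(11) using P.normal_product_moments(2)[OF N12, of k] by (subst integral_distr) auto
  have L4: "(LINT x|?L. x ^ 4) = 9"
    unfolding L_mom using std_normal_distribution_even_moments(1)[of 2] by (simp add: fact_numeral)
  have L6: "(LINT x|?L. x ^ 6) = (real (double_fact 5))\<^sup>2"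
    unfolding L_mom using std_normal_distribution_even_moments(1)[of 3]
    by (simp add: fact_numeral eval_nat_numeral)
  have F'_real: "real_distribution (distr M borel (F' n))" for n by simp
  have L_real: "real_distribution ?L"
    unfolding assms(11) by simp
  have I_iff: "?I \<longleftrightarrow> (\<lambda>n. wasserstein2 (distr M borel (F' n)) ?L) \<longlonglongrightarrow> 0"
    unfolding F'_def by (rule filterlim_sequentially_Suc[symmetric])
  have II_iff: "?II \<longleftrightarrow> weak_conv_m (\<lambda>n. distr M borel (F' n)) ?L"
    unfolding weak_conv_m_def weak_conv_def F'_def
    using filterlim_sequentially_Suc[of "\<lambda>n. cdf (distr M borel (F n)) _"] by blast
  have mom_iff: "(\<lambda>n. moment M k (F n)) \<longlonglongrightarrow> l \<longleftrightarrow> (\<lambda>n. expectation (\<lambda>\<omega>. F' n \<omega> ^ k)) \<longlonglongrightarrow> l" for k l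
    unfolding F'_def moment_def by (rule filterlim_sequentially_Suc[symmetric])
  have "?II" if "?I"
    using wasserstein2_imp_weak_conv[OF F'_real L_real] that unfolding I_iff II_iff .
  moreover have "?III" if "?II"
  proof -
    have conv: "(\<lambda>n. expectation (\<lambda>\<omega>. F' n \<omega> ^ k)) \<longlonglongrightarrow> (LINT x|?L. x ^ k)" if "even k" for k
    proof -
      have "(\<lambda>n. LINT x|distr M borel (F' n). x ^ k) \<longlonglongrightarrow> (LINT x|?L. x ^ k)"
      proof (rule weak_conv_imp_even_moment_conv[OF F'_real L_real _ that])
        show "weak_conv_m (\<lambda>n. distr M borel (F' n)) ?L" using \<open>?II\<close> unfolding II_iff .
        show "integrable (distr M borel (F' n)) (\<lambda>x. x ^ k)" for n k
          using second_wiener_chaos_integrable[OF F'] by (subst integrable_distr_eq) auto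
        show "integrable ?L (\<lambda>x. x ^ k)" for k by (rule L_int)
        \<comment> \<open>With unit second moment, hypercontractivity gives a bound independent of
          \<open>n\<close>; the maximum includes the corresponding moment of the limit law.\<close>
        show "(LINT x|distr M borel (F' n). x ^ (2 * k)) \<le> max (hypercontractivity_const k) (LINT x|?L. x ^ (2 * k))" for n
          using second_wiener_chaos_hypercontractive(2)[OF F', of n k] F'2[of n]
          by (subst integral_distr) auto
      qed simp
      then show ?thesis by (simp add: integral_distr)
    qed
    have "(\<lambda>n. moment M 4 (F n)) \<longlonglongrightarrow> 9"
      unfolding mom_iff using conv[of 4] L4 by simp
    \<comment> \<open>The smallest admissible exponent serves as witness; the limit is
      \<open>(5!!)^2 = 225\<close>.\<close>
    moreover have "(\<lambda>n. moment M (2 * 3) (F n)) \<longlonglongrightarrow> (real (double_fact (2 * 3 - 1)))\<^sup>2"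
      unfolding mom_iff using conv[of 6] L6 by simp
    ultimately show ?thesis by blast
  qed
  moreover have "?I" if "?III"
  proof -
    obtain r where r: "r \<ge> 3" "(\<lambda>n. moment M (2 * r) (F n)) \<longlonglongrightarrow> (real (double_fact (2 * r - 1)))\<^sup>2"
      using \<open>?III\<close> by blast
    have F'4: "(\<lambda>n. expectation (\<lambda>\<omega>. F' n \<omega> ^ 4)) \<longlonglongrightarrow> 9"
      using \<open>?III\<close> unfolding mom_iff by blast
    have F'r: "(\<lambda>n. expectation (\<lambda>\<omega>. F' n \<omega> ^ (2 * r))) \<longlonglongrightarrow> cmoment alt_cumulants (2 * r)"
      using r(2) unfolding mom_iff cmoment_alt_even .
    obtain Y where Y_meas[measurable]: "\<And>n. Y n \<in> borel_measurable M"
      and Y_law: "\<forall>\<^sub>F n in sequentially. distr M borel (Y n) = normal_product_law"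
      and int: "\<And>n. integrable M (\<lambda>\<omega>. (F' n \<omega> - Y n \<omega>)\<^sup>2)"
      and lim: "(\<lambda>n. expectation (\<lambda>\<omega>. (F' n \<omega> - Y n \<omega>)\<^sup>2)) \<longlonglongrightarrow> 0"
      using moments_imp_normal_product_coupling[OF F' F'2 F'4 r(1) F'r] by blast
    have "(\<lambda>n. ennreal (sqrt (expectation (\<lambda>\<omega>. (F' n \<omega> - Y n \<omega>)\<^sup>2)))) \<longlonglongrightarrow> ennreal (sqrt 0)"
      by (intro tendsto_intros lim)
    then have lim': "(\<lambda>n. ennreal (sqrt (expectation (\<lambda>\<omega>. (F' n \<omega> - Y n \<omega>)\<^sup>2)))) \<longlonglongrightarrow> 0" by simp
    show ?thesis
      unfolding I_iff
    proof (rule tendsto_sandwich[OF _ _ tendsto_const lim'])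
      show "\<forall>\<^sub>F n in sequentially. wasserstein2 (distr M borel (F' n)) ?L
          \<le> ennreal (sqrt (expectation (\<lambda>\<omega>. (F' n \<omega> - Y n \<omega>)\<^sup>2)))"
        using Y_law
      proof eventually_elim
        case (elim n)
        have "wasserstein2 (distr M borel (F' n)) (distr M borel (Y n))
            \<le> ennreal (sqrt (expectation (\<lambda>\<omega>. (F' n \<omega> - Y n \<omega>)\<^sup>2)))"
          by (rule wasserstein2_le[OF prob_space_axioms _ _ int]) measurable
        then show ?case unfolding elim L .
      qed
    qed simp
  qed
  ultimately show ?thesis by blast
qed

end
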